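(* Let $R$ be a commutative noetherian ring, and let $\mathcal{D}$ be an $R$-linear triangulated category with arbitrary coproducts. Suppose that $\mathcal{D}$ has a compact generator $G\in\mathcal{D}^c$ such that $\mathcal{D}(G,G[n])\in\mathrm{mod}\text{-}R$ for all $n\in\mathbb{Z}$. If $M\in\mathrm{Mod}\text{-}\mathcal{D}^c$ is a cohomological module, then $M$ is $\mathcal{D}^c$-locally coherent if and only if $M(C)\in\mathrm{mod}\text{-}R$ for all $C\in\mathcal{D}^c$. Consequently $$\mathcal{D}_{lcoh}=\{X\in\mathcal{D}\mid\mathcal{D}(C,X)\in\mathrm{mod}\text{-}R\text{ for all }C\in\mathcal{D}^c\}.$$
   Context: $\mathrm{mod}\text{-}R$ is the category of finitely presented $R$-modules. $\mathcal{D}^c$ is the full subcategory of compact objects of $\mathcal{D}$. A compact generator is an object $G\in\mathcal{D}^c$ such that $\mathcal{D}(G[i],X)=0$ for all $i\in\mathbb{Z}$ implies $X=0$. $\mathrm{Mod}\text{-}\mathcal{D}^c$ is the category of $R$-linear contravariant functors (modules) $\mathcal{D}^c\to\mathrm{Mod}\text{-}R$; such a module is cohomological if it sends triangles to exact sequences. The restricted Yoneda functor is $\mathbf{y}:\mathcal{D}\to\mathrm{Mod}\text{-}\mathcal{D}^c$, $\mathbf{y}X=\mathcal{D}(-,X)|_{\mathcal{D}^c}$. For $H\in\mathcal{D}^c$, a module $M\in\mathrm{Mod}\text{-}\mathcal{D}^c$ is $H$-locally coherent if: (LC1) there are $D\in\mathcal{D}^c$ and a natural transformation $\alpha:\mathbf{y}D\to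 M$ such that $\alpha^H:\mathcal{D}^c(H,D)\to M(H)$ is surjective; and (LC2) for every natural transformation $\beta:\mathbf{y}D\to M$ with $D\in\mathcal{D}^c$, there is a map $f:C\to D$ in $\mathcal{D}^c$ such that $\beta\circ\mathbf{y}f=0$ and the sequence $\mathcal{D}^c(H,C)\to\mathcal{D}^c(H,D)\to M(H)$ is exact. For a class $\mathcal{G}\subseteq\mathcal{D}^c$, $M$ is $\mathcal{G}$-locally coherent if it is $H$-locally coherent for every $H\in\mathcal{G}$. $\mathcal{D}_{lcoh}$ is the full subcategory of all $X\in\mathcal{D}$ such that $\mathbf{y}X$ is $\{G[n]\mid n\in\mathbb{Z}\}$-locally coherent. *)

theory Defs
  imports "HOL-Algebra.Module" "HOL-Algebra.Ring_Divisibility" "HOL-Algebra.Product_Groups"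
    "HOL-Library.Equipollence"
begin

section \<open>Modules over a commutative ring\<close>

definition mod_hom ::
  "('r, 'x) ring_scheme \<Rightarrow> ('r, 'a, 'y) module_scheme \<Rightarrow> ('r, 'b, 'z) module_scheme \<Rightarrow> ('a \<Rightarrow> 'b) set"
  where "mod_hom R M N =
    {h \<in> carrier M \<rightarrow> carrier N.
       (\<forall>x\<in>carrier M. \<forall>y\<in>carrier M. h (x \<oplus>\<^bsub>M\<^esub> y) = h x \<oplus>\<^bsub>N\<^esub> h y) \<and>
       (\<forall>a\<in>carrier R. \<forall>x\<in>carrier M. h (a \<odot>\<^bsub>M\<^esub> x) = a \<odot>\<^bsub>N\<^esub> h x)}"

definition exact_at ::
  "('r, 'a, 'x) module_scheme \<Rightarrow> ('r, 'b, 'y) module_scheme \<Rightarrow> ('r, 'c, 'z) module_scheme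
    \<Rightarrow> ('a \<Rightarrow> 'b) \<Rightarrow> ('b \<Rightarrow> 'c) \<Rightarrow> bool"
  where "exact_at L M N f g \<longleftrightarrow> f ` carrier L = kernel (add_monoid M) (add_monoid N) g"

definition free_module :: "('r, 'x) ring_scheme \<Rightarrow> nat \<Rightarrow> ('r, nat \<Rightarrow> 'r) module"
  where "free_module R n =
    \<lparr>carrier = (\<Pi>\<^sub>E i\<in>{..<n}. carrier R),
     monoid.mult = (\<lambda>x y. \<lambda>i\<in>{..<n}. x i \<otimes>\<^bsub>R\<^esub> y i),
     monoid.one = (\<lambda>i\<in>{..<n}. \<one>\<^bsub>R\<^esub>),
     ring.zero = (\<lambda>i\<in>{..<n}. \<zero>\<^bsub>R\<^esub>),
     ring.add = (\<lambda>x y. \<lambda>i\<in>{..<n}. x i \<oplus>\<^bsub>R\<^esub> y i),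
     module.smult = (\<lambda>a x. \<lambda>i\<in>{..<n}. a \<otimes>\<^bsub>R\<^esub> x i)\<rparr>"

definition finitely_presented :: "('r, 'x) ring_scheme \<Rightarrow> ('r, 'a, 'y) module_scheme \<Rightarrow> bool"
  where "finitely_presented R M \<longleftrightarrow> module R M \<and>
    (\<exists>m n. \<exists>\<phi>\<in>mod_hom R (free_module R m) (free_module R n). \<exists>\<pi>\<in>mod_hom R (free_module R n) M.
       exact_at (free_module R m) (free_module R n) M \<phi> \<pi> \<and>
       \<pi> ` carrier (free_module R n) = carrier M)"


section \<open>Linear categories\<close>

text \<open>
  The record carries, besides a category with hom-modules, a shift (on objects and on
  morphisms) and the distinguished triangles: \<open>Tri D X Y Z u v w\<close> says that
  \<open>X \<rightarrow> Y \<rightarrow> Z \<rightarrow> X[1]\<close>, with maps \<open>u\<close>, \<open>v\<close>, \<open>w\<close>, is distinguished. Only the carrier, addition,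
  zero and scalar multiplication of a hom-module are meaningful; its ring multiplication is junk.
\<close>

record ('r, 'o, 'm) tricat =
  Obj :: "'o set"
  Hom :: "'o \<Rightarrow> 'o \<Rightarrow> ('r, 'm) module"
  ident :: "'o \<Rightarrow> 'm"
  cmp :: "'m \<Rightarrow> 'm \<Rightarrow> 'm"  (infixr \<open>\<bullet>\<index>\<close> 75)
  shO :: "'o \<Rightarrow> 'o"
  shM :: "'m \<Rightarrow> 'm"
  Tri :: "'o \<Rightarrow> 'o \<Rightarrow> 'o \<Rightarrow> 'm \<Rightarrow> 'm \<Rightarrow> 'm \<Rightarrow> bool"

abbreviation Arr :: "('r, 'o, 'm, 'x) tricat_scheme \<Rightarrow> 'o \<Rightarrow> 'o \<Rightarrow> 'm set"
  where "Arr D X Y \<equiv> carrier (Hom D X Y)"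

locale linear_category =
  fixes R :: "('r, 'x) ring_scheme" and D :: "('r, 'o, 'm, 'y) tricat_scheme" (structure)
  assumes base_cring: "cring R"
    and ident_arr: "X \<in> Obj D \<Longrightarrow> ident D X \<in> Arr D X X"
    and cmp_arr: "\<lbrakk>X \<in> Obj D; Y \<in> Obj D; Z \<in> Obj D; f \<in> Arr D X Y; g \<in> Arr D Y Z\<rbrakk>
      \<Longrightarrow> g \<bullet> f \<in> Arr D X Z"
    and cmp_ident_right: "\<lbrakk>X \<in> Obj D; Y \<in> Obj D; f \<in> Arr D X Y\<rbrakk> \<Longrightarrow> f \<bullet> ident D X = f"
    and cmp_ident_left: "\<lbrakk>X \<in> Obj D; Y \<in> Obj D; f \<in> Arr D X Y\<rbrakk> \<Longrightarrow> ident D Y \<bullet> f = f"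
    and cmp_assoc: "\<lbrakk>X \<in> Obj D; Y \<in> Obj D; Z \<in> Obj D; W \<in> Obj D;
        f \<in> Arr D X Y; g \<in> Arr D Y Z; h \<in> Arr D Z W\<rbrakk> \<Longrightarrow> (h \<bullet> g) \<bullet> f = h \<bullet> (g \<bullet> f)"
    and Arr_unique: "\<lbrakk>X \<in> Obj D; Y \<in> Obj D; X' \<in> Obj D; Y' \<in> Obj D;
        f \<in> Arr D X Y; f \<in> Arr D X' Y'\<rbrakk> \<Longrightarrow> X = X' \<and> Y = Y'"
    and Hom_module: "\<lbrakk>X \<in> Obj D; Y \<in> Obj D\<rbrakk> \<Longrightarrow> module R (Hom D X Y)"
    and cmp_linear_left: "\<lbrakk>X \<in> Obj D; Y \<in> Obj D; Z \<in> Obj D; f \<in> Arr D X Y\<rbrakk>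
      \<Longrightarrow> (\<lambda>g. g \<bullet> f) \<in> mod_hom R (Hom D Y Z) (Hom D X Z)"
    and cmp_linear_right: "\<lbrakk>X \<in> Obj D; Y \<in> Obj D; Z \<in> Obj D; g \<in> Arr D Y Z\<rbrakk>
      \<Longrightarrow> (\<lambda>f. g \<bullet> f) \<in> mod_hom R (Hom D X Y) (Hom D X Z)"

definition zero_object :: "('r, 'o, 'm, 'y) tricat_scheme \<Rightarrow> 'o \<Rightarrow> bool"
  where "zero_object D Z \<longleftrightarrow> Z \<in> Obj D \<and>
    (\<forall>X\<in>Obj D. Arr D Z X = {\<zero>\<^bsub>Hom D Z X\<^esub>} \<and> Arr D X Z = {\<zero>\<^bsub>Hom D X Z\<^esub>})"

definition iso_arr :: "('r, 'o, 'm, 'y) tricat_scheme \<Rightarrow> 'o \<Rightarrow> 'o \<Rightarrow> 'm \<Rightarrow> bool"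
  where "iso_arr D X Y f \<longleftrightarrow> f \<in> Arr D X Y \<and>
    (\<exists>g\<in>Arr D Y X. g \<bullet>\<^bsub>D\<^esub> f = ident D X \<and> f \<bullet>\<^bsub>D\<^esub> g = ident D Y)"

definition biproduct ::
  "('r, 'o, 'm, 'y) tricat_scheme \<Rightarrow> 'o \<Rightarrow> 'o \<Rightarrow> 'o \<Rightarrow> 'm \<Rightarrow> 'm \<Rightarrow> 'm \<Rightarrow> 'm \<Rightarrow> bool"
  where "biproduct D X Y P i j p q \<longleftrightarrow> P \<in> Obj D \<and>
    i \<in> Arr D X P \<and> j \<in> Arr D Y P \<and> p \<in> Arr D P X \<and> q \<in> Arr D P Y \<and>
    p \<bullet>\<^bsub>D\<^esub> i = ident D X \<and> q \<bullet>\<^bsub>D\<^esub> j = ident D Y \<and>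
    q \<bullet>\<^bsub>D\<^esub> i = \<zero>\<^bsub>Hom D X Y\<^esub> \<and> p \<bullet>\<^bsub>D\<^esub> j = \<zero>\<^bsub>Hom D Y X\<^esub> \<and>
    (i \<bullet>\<^bsub>D\<^esub> p) \<oplus>\<^bsub>Hom D P P\<^esub> (j \<bullet>\<^bsub>D\<^esub> q) = ident D P"

locale additive_category = linear_category +
  assumes ex_zero_object: "\<exists>Z. zero_object D Z"
    and ex_biproduct: "\<lbrakk>X \<in> Obj D; Y \<in> Obj D\<rbrakk> \<Longrightarrow> \<exists>P i j p q. biproduct D X Y P i j p q"


section \<open>Triangulated categories\<close>

text \<open>
  Verdier's axioms. The shift is a linear automorphism of the category, so that all
  its integer powers are defined strictly.
\<close>

locale triangulated_category = additive_category +
  assumes shO_bij: "bij_betw (shO D) (Obj D) (Obj D)"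
    and shM_bij: "\<lbrakk>X \<in> Obj D; Y \<in> Obj D\<rbrakk>
      \<Longrightarrow> bij_betw (shM D) (Arr D X Y) (Arr D (shO D X) (shO D Y))"
    and shM_linear: "\<lbrakk>X \<in> Obj D; Y \<in> Obj D\<rbrakk>
      \<Longrightarrow> shM D \<in> mod_hom R (Hom D X Y) (Hom D (shO D X) (shO D Y))"
    and shM_ident: "X \<in> Obj D \<Longrightarrow> shM D (ident D X) = ident D (shO D X)"
    and shM_cmp: "\<lbrakk>X \<in> Obj D; Y \<in> Obj D; Z \<in> Obj D; f \<in> Arr D X Y; g \<in> Arr D Y Z\<rbrakk>
      \<Longrightarrow> shM D (g \<bullet> f) = shM D g \<bullet> shM D f"
    and Tri_arr: "Tri D X Y Z u v w \<Longrightarrow> X \<in> Obj D \<and> Y \<in> Obj D \<and> Z \<in> Obj D \<and>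
        u \<in> Arr D X Y \<and> v \<in> Arr D Y Z \<and> w \<in> Arr D Z (shO D X)"
    and Tri_iso: "\<lbrakk>Tri D X Y Z u v w; X' \<in> Obj D; Y' \<in> Obj D; Z' \<in> Obj D;
        u' \<in> Arr D X' Y'; v' \<in> Arr D Y' Z'; w' \<in> Arr D Z' (shO D X');
        iso_arr D X X' a; iso_arr D Y Y' b; iso_arr D Z Z' c;
        b \<bullet> u = u' \<bullet> a; c \<bullet> v = v' \<bullet> b; shM D a \<bullet> w = w' \<bullet> c\<rbrakk>
      \<Longrightarrow> Tri D X' Y' Z' u' v' w'"
    and Tri_ident: "\<lbrakk>X \<in> Obj D; zero_object D Z\<rbrakk>
      \<Longrightarrow> Tri D X X Z (ident D X) \<zero>\<^bsub>Hom D X Z\<^esub> \<zero>\<^bsub>Hom D Z (shO D X)\<^esub>"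
    and Tri_cone: "\<lbrakk>X \<in> Obj D; Y \<in> Obj D; u \<in> Arr D X Y\<rbrakk> \<Longrightarrow> \<exists>Z v w. Tri D X Y Z u v w"
    and Tri_rotate: "\<lbrakk>X \<in> Obj D; Y \<in> Obj D; Z \<in> Obj D;
        u \<in> Arr D X Y; v \<in> Arr D Y Z; w \<in> Arr D Z (shO D X)\<rbrakk>
      \<Longrightarrow> Tri D X Y Z u v w \<longleftrightarrow>
          Tri D Y Z (shO D X) v w (\<ominus>\<^bsub>Hom D (shO D X) (shO D Y)\<^esub> shM D u)"
    and Tri_morphism: "\<lbrakk>Tri D X Y Z u v w; Tri D X' Y' Z' u' v' w';
        a \<in> Arr D X X'; b \<in> Arr D Y Y'; b \<bullet> u = u' \<bullet> a\<rbrakk>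
      \<Longrightarrow> \<exists>c\<in>Arr D Z Z'. c \<bullet> v = v' \<bullet> b \<and> shM D a \<bullet> w = w' \<bullet> c"
    and Tri_octahedral: "\<lbrakk>Tri D X Y Z' u j k; Tri D Y Z X' v l i; Tri D X Z Y' (v \<bullet> u) m n\<rbrakk>
      \<Longrightarrow> \<exists>f\<in>Arr D Z' Y'. \<exists>g\<in>Arr D Y' X'. Tri D Z' Y' X' f g (shM D j \<bullet> i) \<and>
            f \<bullet> j = m \<bullet> v \<and> n \<bullet> f = k \<and> g \<bullet> m = l \<and> i \<bullet> g = shM D u \<bullet> n"

definition shift :: "('r, 'o, 'm, 'y) tricat_scheme \<Rightarrow> int \<Rightarrow> 'o \<Rightarrow> 'o"
  where "shift D n X =
    (if 0 \<le> n then (shO D ^^ nat n) X else (inv_into (Obj D) (shO D) ^^ nat (- n)) X)"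


section \<open>Coproducts and compact objects\<close>

text \<open>
  ``Arbitrary coproducts'' means coproducts of all small families in a category with small
  hom-sets. Coproducts indexed by all sets of a type as large as the type of morphisms would
  force the category to be trivial, so smallness is a parameter: a predicate on the subsets of an
  index type that is closed under passing to sets of smaller or equal cardinality and
  under small unions, and holds for some infinite set. The sets of cardinality below an
  uncountable regular cardinal, in particular those belonging to a Grothendieck universe, form
  an instance.
\<close>

locale smallness =
  fixes small :: "'i set \<Rightarrow> bool"
  assumes small_lepoll: "\<lbrakk>small B; A \<lesssim> B\<rbrakk> \<Longrightarrow> small A"
    and small_infinite: "\<exists>A. small A \<and> infinite A"
    and small_Union: "\<lbrakk>small A; \<And>a. a \<in> A \<Longrightarrow> small (F a)\<rbrakk> \<Longrightarrow> small (\<Union>a\<in>A. F a)"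

definition locally_small :: "('i set \<Rightarrow> bool) \<Rightarrow> ('r, 'o, 'm, 'y) tricat_scheme \<Rightarrow> bool"
  where "locally_small small D \<longleftrightarrow>
    (\<forall>X\<in>Obj D. \<forall>Y\<in>Obj D. \<exists>A. small A \<and> Arr D X Y \<lesssim> A)"

definition coproduct ::
  "('r, 'o, 'm, 'y) tricat_scheme \<Rightarrow> 'i set \<Rightarrow> ('i \<Rightarrow> 'o) \<Rightarrow> 'o \<Rightarrow> ('i \<Rightarrow> 'm) \<Rightarrow> bool"
  where "coproduct D I X P \<iota> \<longleftrightarrow> P \<in> Obj D \<and> (\<forall>i\<in>I. \<iota> i \<in> Arr D (X i) P) \<and>
    (\<forall>Y\<in>Obj D. \<forall>f. (\<forall>i\<in>I. f i \<in> Arr D (X i) Y) \<longrightarrow>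
       (\<exists>!h. h \<in> Arr D P Y \<and> (\<forall>i\<in>I. h \<bullet>\<^bsub>D\<^esub> \<iota> i = f i)))"

definition has_coproducts :: "('i set \<Rightarrow> bool) \<Rightarrow> ('r, 'o, 'm, 'y) tricat_scheme \<Rightarrow> bool"
  where "has_coproducts small D \<longleftrightarrow>
    (\<forall>I X. small I \<longrightarrow> X \<in> I \<rightarrow> Obj D \<longrightarrow> (\<exists>P \<iota>. coproduct D I X P \<iota>))"

text \<open>
  An object \<open>C\<close> is compact if the canonical map from the direct sum of the \<open>Hom(C, X i)\<close> to
  \<open>Hom(C, \<Coprod> X i)\<close> is an isomorphism; being additive, it is one iff it is bijective.
\<close>

definition compact_objects :: "('i set \<Rightarrow> bool) \<Rightarrow> ('r, 'o, 'm, 'y) tricat_scheme \<Rightarrow> 'o set"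
  where "compact_objects small D = {C \<in> Obj D.
    \<forall>I X P \<iota>. small I \<longrightarrow> X \<in> I \<rightarrow> Obj D \<longrightarrow> coproduct D I X P \<iota> \<longrightarrow>
      bij_betw (\<lambda>x. \<Oplus>\<^bsub>Hom D C P\<^esub> i\<in>{i \<in> I. x i \<noteq> \<zero>\<^bsub>Hom D C (X i)\<^esub>}. \<iota> i \<bullet>\<^bsub>D\<^esub> x i)
        (carrier (sum_group I (\<lambda>i. add_monoid (Hom D C (X i))))) (Arr D C P)}"

definition compact_generator :: "('i set \<Rightarrow> bool) \<Rightarrow> ('r, 'o, 'm, 'y) tricat_scheme \<Rightarrow> 'o \<Rightarrow> bool"
  where "compact_generator small D G \<longleftrightarrow> G \<in> compact_objects small D \<and>
    (\<forall>X\<in>Obj D. (\<forall>n. Arr D (shift D n G) X = {\<zero>\<^bsub>Hom D (shift D n G) X\<^esub>}) \<longrightarrow> zero_object D X)"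


section \<open>Modules over a full subcategory\<close>

text \<open>
  A full subcategory is given by its set \<open>K\<close> of objects. A contravariant functor from it to
  modules consists of its values on objects and its action on morphisms, where for \<open>f : A \<rightarrow> B\<close>
  the map \<open>act M f\<close> goes from \<open>val M B\<close> to \<open>val M A\<close>.
\<close>

record ('r, 'o, 'm, 'b) cmodule =
  val :: "'o \<Rightarrow> ('r, 'b) module"
  act :: "'m \<Rightarrow> 'b \<Rightarrow> 'b"

definition category_module ::
  "('r, 'x) ring_scheme \<Rightarrow> ('r, 'o, 'm, 'y) tricat_scheme \<Rightarrow> 'o set \<Rightarrow> ('r, 'o, 'm, 'b) cmodule \<Rightarrow> bool"
  where "category_module R D K M \<longleftrightarrow>
    (\<forall>A\<in>K. module R (val M A)) \<and>
    (\<forall>A\<in>K. \<forall>B\<in>K. \<forall>f\<in>Arr D A B. act M f \<in> mod_hom R (val M B) (val M A)) \<and>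
    (\<forall>A\<in>K. \<forall>x\<in>carrier (val M A). act M (ident D A) x = x) \<and>
    (\<forall>A\<in>K. \<forall>B\<in>K. \<forall>C\<in>K. \<forall>f\<in>Arr D A B. \<forall>g\<in>Arr D B C. \<forall>x\<in>carrier (val M C).
       act M (g \<bullet>\<^bsub>D\<^esub> f) x = act M f (act M g x)) \<and>
    (\<forall>A\<in>K. \<forall>B\<in>K. \<forall>x\<in>carrier (val M B). (\<lambda>f. act M f x) \<in> mod_hom R (Hom D A B) (val M A))"

definition cohomological ::
  "('r, 'o, 'm, 'y) tricat_scheme \<Rightarrow> 'o set \<Rightarrow> ('r, 'o, 'm, 'b) cmodule \<Rightarrow> bool"
  where "cohomological D K M \<longleftrightarrow>
    (\<forall>X\<in>K. \<forall>Y\<in>K. \<forall>Z\<in>K. \<forall>u v w. Tri D X Y Z u v w \<longrightarrow>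
       exact_at (val M Z) (val M Y) (val M X) (act M v) (act M u))"

definition natural_transformations ::
  "('r, 'x) ring_scheme \<Rightarrow> ('r, 'o, 'm, 'y) tricat_scheme \<Rightarrow> 'o set \<Rightarrow>
   ('r, 'o, 'm, 'a) cmodule \<Rightarrow> ('r, 'o, 'm, 'b) cmodule \<Rightarrow> ('o \<Rightarrow> 'a \<Rightarrow> 'b) set"
  where "natural_transformations R D K M N =
    {\<alpha>. (\<forall>A\<in>K. \<alpha> A \<in> mod_hom R (val M A) (val N A)) \<and>
        (\<forall>A\<in>K. \<forall>B\<in>K. \<forall>f\<in>Arr D A B. \<forall>x\<in>carrier (val M B).
           \<alpha> A (act M f x) = act N f (\<alpha> B x))}"

definition yoneda :: "('r, 'o, 'm, 'y) tricat_scheme \<Rightarrow> 'o \<Rightarrow> ('r, 'o, 'm, 'm) cmodule"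
  where "yoneda D X = \<lparr>val = (\<lambda>A. Hom D A X), act = (\<lambda>f h. h \<bullet>\<^bsub>D\<^esub> f)\<rparr>"

definition yoneda_map :: "('r, 'o, 'm, 'y) tricat_scheme \<Rightarrow> 'm \<Rightarrow> 'o \<Rightarrow> 'm \<Rightarrow> 'm"
  where "yoneda_map D f A h = f \<bullet>\<^bsub>D\<^esub> h"


section \<open>Local coherence\<close>

definition locally_coherent_at ::
  "('r, 'x) ring_scheme \<Rightarrow> ('r, 'o, 'm, 'y) tricat_scheme \<Rightarrow> 'o set \<Rightarrow> 'o \<Rightarrow>
   ('r, 'o, 'm, 'b) cmodule \<Rightarrow> bool"
  where "locally_coherent_at R D K H M \<longleftrightarrow>
    (\<exists>B\<in>K. \<exists>\<alpha>\<in>natural_transformations R D K (yoneda D B) M.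
       \<alpha> H ` Arr D H B = carrier (val M H)) \<and>
    (\<forall>B\<in>K. \<forall>\<beta>\<in>natural_transformations R D K (yoneda D B) M.
       \<exists>C\<in>K. \<exists>f\<in>Arr D C B.
         (\<forall>A\<in>K. \<forall>h\<in>Arr D A C. \<beta> A (yoneda_map D f A h) = \<zero>\<^bsub>val M A\<^esub>) \<and>
         exact_at (Hom D H C) (Hom D H B) (val M H) (yoneda_map D f H) (\<beta> H))"

definition locally_coherent ::
  "('r, 'x) ring_scheme \<Rightarrow> ('r, 'o, 'm, 'y) tricat_scheme \<Rightarrow> 'o set \<Rightarrow> 'o set \<Rightarrow>
   ('r, 'o, 'm, 'b) cmodule \<Rightarrow> bool"
  where "locally_coherent R D K \<G> M \<longleftrightarrow> (\<forall>H\<in>\<G>. locally_coherent_at R D K H M)"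

definition lcoh_objects ::
  "('r, 'x) ring_scheme \<Rightarrow> ('i set \<Rightarrow> bool) \<Rightarrow> ('r, 'o, 'm, 'y) tricat_scheme \<Rightarrow> 'o \<Rightarrow> 'o set"
  where "lcoh_objects R small D G = {X \<in> Obj D.
    locally_coherent R D (compact_objects small D) {shift D n G | n. True} (yoneda D X)}"

end

theory Submission
  imports Defs "HOL-Library.Nat_Bijection"
begin

text \<open>
  The argument rests on the fact that every compact object lies in the thick closure of the shifts
  of \<open>G\<close>: a class of objects that is closed under extensions and retracts and contains all shifts of
  \<open>G\<close> contains every compact object (\<open>thick_induction\<close>). For fixed \<open>X\<close>, the objects \<open>A\<close> with finitely
  presented \<open>Hom(A, X)\<close> form such a class as soon as the shifts of \<open>G\<close> belong to it, because triangles
  give exact sequences of hom-modules and, \<open>R\<close> being noetherian, a module between two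
  finitely presented ones in an exact sequence is finitely presented. The same holds for \<open>Hom(H, -)\<close>.
  Two inductions therefore lead from the modules \<open>Hom(G, G[n])\<close> to all hom-modules between compact objects.

  Now let \<open>M\<close> be a module on the compact objects. If it is locally coherent at \<open>H\<close>, then \<open>M(H)\<close>
  is a quotient of \<open>Hom(H, B)\<close> with \<open>B\<close> compact, hence finitely presented. Conversely, transformations
  from a representable functor to \<open>M\<close> are elements of \<open>M\<close>, and finitely many elements of
  \<open>M(H)\<close> are restrictions of a single element over a finite sum of copies of \<open>H\<close>. This gives the first
  condition of local coherence; applied to the kernel of a transformation from
  the functor represented by \<open>B\<close>, whose value at \<open>H\<close> is a submodule of \<open>Hom(H, B)\<close>, it gives the second.
  For a representable module it is enough to test shifts of \<open>G\<close>, again by thick induction.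

  To prove thick induction for a compact \<open>C\<close>, form the tower \<open>C = X 0 \<rightarrow> X 1 \<rightarrow> \<dots>\<close> in which \<open>X (n + 1)\<close> is the
  cone of all maps from shifts of \<open>G\<close> to \<open>X n\<close>. Its homotopy colimit receives no nonzero map from
  a shift of \<open>G\<close>, so it is zero, and compactness of \<open>C\<close> makes \<open>C \<rightarrow> X n\<close> zero for some \<open>n\<close>
  (\<open>tower_vanishes\<close>). Descending the tower, one finds compact \<open>K \<rightarrow> C\<close> with cones in the given class whose
  composites to ever lower stages vanish: a compact object meets only finitely many of the attached
  shifts of \<open>G\<close>, and the octahedral axiom controls the cones. At the bottom \<open>K \<rightarrow> C\<close> is
  zero, and \<open>C\<close> is a retract of its cone.
\<close>

section \<open>Finitely generated modules over a noetherian ring\<close>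

text \<open>
  The submodule generated by \<open>S\<close>. Closing up inductively, instead of taking linear combinations,
  turns every statement about spans into a rule induction without finite sums.
\<close>

inductive_set lspan :: "('r, 'x) ring_scheme \<Rightarrow> ('r, 'a, 'y) module_scheme \<Rightarrow> 'a set \<Rightarrow> 'a set"
  for R M S where
  zero: "\<zero>\<^bsub>M\<^esub> \<in> lspan R M S"
| base: "s \<in> S \<Longrightarrow> s \<in> lspan R M S"
| add: "\<lbrakk>x \<in> lspan R M S; y \<in> lspan R M S\<rbrakk> \<Longrightarrow> x \<oplus>\<^bsub>M\<^esub> y \<in> lspan R M S"
| smult: "\<lbrakk>a \<in> carrier R; x \<in> lspan R M S\<rbrakk> \<Longrightarrow> a \<odot>\<^bsub>M\<^esub> x \<in> lspan R M S"

lemma mod_homI: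
  assumes "\<And>x. x \<in> carrier M \<Longrightarrow> h x \<in> carrier N"
    and "\<And>x y. \<lbrakk>x \<in> carrier M; y \<in> carrier M\<rbrakk> \<Longrightarrow> h (x \<oplus>\<^bsub>M\<^esub> y) = h x \<oplus>\<^bsub>N\<^esub> h y"
    and "\<And>a x. \<lbrakk>a \<in> carrier R; x \<in> carrier M\<rbrakk> \<Longrightarrow> h (a \<odot>\<^bsub>M\<^esub> x) = a \<odot>\<^bsub>N\<^esub> h x"
  shows "h \<in> mod_hom R M N"
  using assms by (auto simp: mod_hom_def)

lemma mod_homD:
  assumes "h \<in> mod_hom R M N"
  shows "x \<in> carrier M \<Longrightarrow> h x \<in> carrier N"
    and "\<lbrakk>x \<in> carrier M; y \<in> carrier M\<rbrakk> \<Longrightarrow> h (x \<oplus>\<^bsub>M\<^esub> y) = h x \<oplus>\<^bsub>N\<^esub> h y"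
    and "\<lbrakk>a \<in> carrier R; x \<in> carrier M\<rbrakk> \<Longrightarrow> h (a \<odot>\<^bsub>M\<^esub> x) = a \<odot>\<^bsub>N\<^esub> h x"
  using assms by (auto simp: mod_hom_def)

lemma mod_hom_zero:
  assumes h: "h \<in> mod_hom R M N" and "module R M" "module R N"
  shows "h \<zero>\<^bsub>M\<^esub> = \<zero>\<^bsub>N\<^esub>"
proof -
  interpret M: module R M by fact
  interpret N: module R N by fact
  have "h \<zero>\<^bsub>M\<^esub> \<oplus>\<^bsub>N\<^esub> h \<zero>\<^bsub>M\<^esub> = h \<zero>\<^bsub>M\<^esub>"
    using mod_homD(2)[OF h, of "\<zero>\<^bsub>M\<^esub>" "\<zero>\<^bsub>M\<^esub>"] by simp
  then show ?thesis using mod_homD(1)[OF h, of "\<zero>\<^bsub>M\<^esub>"]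
    by (simp add: N.add.l_cancel_one')
qed

lemma mod_hom_minus:
  assumes h: "h \<in> mod_hom R M N" and "module R M" "module R N"
    and x: "x \<in> carrier M" and y: "y \<in> carrier M"
  shows "h (x \<ominus>\<^bsub>M\<^esub> y) = h x \<ominus>\<^bsub>N\<^esub> h y"
proof -
  interpret M: module R M by fact
  interpret N: module R N by fact
  have "h x = h ((x \<ominus>\<^bsub>M\<^esub> y) \<oplus>\<^bsub>M\<^esub> y)"
    using x y by (simp add: M.minus_eq M.a_assoc M.l_neg)
  also have "\<dots> = h (x \<ominus>\<^bsub>M\<^esub> y) \<oplus>\<^bsub>N\<^esub> h y"
    using x y by (intro mod_homD(2)[OF h]) auto
  finally show ?thesis
    using mod_homD(1)[OF h] x y
    by (simp add: N.minus_eq N.a_assoc N.r_neg)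
qed

lemma mod_hom_finsum:
  assumes h: "h \<in> mod_hom R A B" and A: "module R A" and B: "module R B"
    and "finite F" "\<And>i. i \<in> F \<Longrightarrow> s i \<in> carrier A"
  shows "h (\<Oplus>\<^bsub>A\<^esub>i\<in>F. s i) = (\<Oplus>\<^bsub>B\<^esub>i\<in>F. h (s i))"
proof -
  interpret A: module R A by (rule A)
  interpret B: module R B by (rule B)
  show ?thesis
    using assms(4,5)
  proof (induction F rule: finite_induct)
    case empty
    show ?case by (simp add: mod_hom_zero[OF h A B])
  next
    case (insert x F)
    have "h (s x \<oplus>\<^bsub>A\<^esub> (\<Oplus>\<^bsub>A\<^esub>i\<in>F. s i)) = h (s x) \<oplus>\<^bsub>B\<^esub> h (\<Oplus>\<^bsub>A\<^esub>i\<in>F. s i)"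
      using insert by (intro mod_homD(2)[OF h] A.M.finsum_closed) auto
    then show ?case
      using insert mod_homD(1)[OF h] by (simp add: Pi_def)
  qed
qed

context module
begin

lemma submoduleI':
  assumes "H \<subseteq> carrier M" "\<zero>\<^bsub>M\<^esub> \<in> H" "\<And>a b. \<lbrakk>a \<in> H; b \<in> H\<rbrakk> \<Longrightarrow> a \<oplus>\<^bsub>M\<^esub> b \<in> H"
    "\<And>a x. \<lbrakk>a \<in> carrier R; x \<in> H\<rbrakk> \<Longrightarrow> a \<odot>\<^bsub>M\<^esub> x \<in> H"
  shows "submodule H R M"
proof (rule submoduleI)
  fix a assume a: "a \<in> H"
  then have "(\<ominus> \<one>) \<odot>\<^bsub>M\<^esub> a = \<ominus>\<^bsub>M\<^esub> a"
    using assms(1) smult_l_minus[of \<one> a] by auto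
  then show "\<ominus>\<^bsub>M\<^esub> a \<in> H" using assms(4)[of "\<ominus> \<one>" a] a by auto
qed (use assms in auto)

lemma submodule_zero: "submodule H R M \<Longrightarrow> \<zero>\<^bsub>M\<^esub> \<in> H"
  using submoduleE(1,2,4) smult_l_null by (metis R.zero_closed ex_in_conv subsetD)

lemma submodule_minus:
  assumes "submodule H R M" "x \<in> H" "y \<in> H" shows "x \<ominus>\<^bsub>M\<^esub> y \<in> H"
  using submoduleE(5)[OF assms(1,2) submoduleE(3)[OF assms(1,3)]] by (simp add: M.minus_eq)

lemma lspan_carrier:
  assumes "S \<subseteq> carrier M" shows "lspan R M S \<subseteq> carrier M"
proof
  fix x assume "x \<in> lspan R M S"
  then show "x \<in> carrier M" by induction (use assms in auto)
qed

lemma lspan_submodule: "S \<subseteq> carrier M \<Longrightarrow> submodule (lspan R M S) R M"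
  by (rule submoduleI'[OF lspan_carrier]) (auto intro: lspan.intros)

lemma lspan_least:
  assumes "submodule H R M" "S \<subseteq> H" shows "lspan R M S \<subseteq> H"
proof
  fix x assume "x \<in> lspan R M S"
  then show "x \<in> H"
    by induction (use assms submodule_zero submoduleE in auto)
qed

lemma lspan_mono: "S \<subseteq> T \<Longrightarrow> T \<subseteq> carrier M \<Longrightarrow> lspan R M S \<subseteq> lspan R M T"
  by (intro lspan_least lspan_submodule) (auto intro: lspan.base)

lemma lspan_insertE:
  assumes "x \<in> lspan R M (insert s S)" "s \<in> carrier M" "S \<subseteq> carrier M"
  obtains a y where "a \<in> carrier R" "y \<in> lspan R M S" "x = a \<odot>\<^bsub>M\<^esub> s \<oplus>\<^bsub>M\<^esub> y"
proof -
  have sub: "lspan R M S \<subseteq> carrier M" using assms by (intro lspan_carrier)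
  have "\<exists>a\<in>carrier R. \<exists>y\<in>lspan R M S. x = a \<odot>\<^bsub>M\<^esub> s \<oplus>\<^bsub>M\<^esub> y"
    using assms(1)
  proof induction
    case zero
    show ?case using assms(2)
      by (intro bexI[of _ \<zero>] bexI[of _ "\<zero>\<^bsub>M\<^esub>"]) (auto intro: lspan.zero)
  next
    case (base t)
    show ?case
    proof (cases "t = s")
      case True
      then show ?thesis using assms(2)
        by (intro bexI[of _ \<one>] bexI[of _ "\<zero>\<^bsub>M\<^esub>"]) (auto intro: lspan.zero)
    next
      case False
      then show ?thesis using assms(2,3) base
        by (intro bexI[of _ \<zero>] bexI[of _ t]) (auto intro: lspan.base)
    qed
  next
    case (add x y)
    then obtain a u b v where *: "a \<in> carrier R" "u \<in> lspan R M S" "x = a \<odot>\<^bsub>M\<^esub> s \<oplus>\<^bsub>M\<^esub> u"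
      "b \<in> carrier R" "v \<in> lspan R M S" "y = b \<odot>\<^bsub>M\<^esub> s \<oplus>\<^bsub>M\<^esub> v" by auto
    have "x \<oplus>\<^bsub>M\<^esub> y = (a \<oplus> b) \<odot>\<^bsub>M\<^esub> s \<oplus>\<^bsub>M\<^esub> (u \<oplus>\<^bsub>M\<^esub> v)"
      using * assms(2) subsetD[OF sub] by (simp add: smult_l_distr M.a_ac)
    then show ?case using * by (intro bexI[of _ "a \<oplus> b"] bexI[of _ "u \<oplus>\<^bsub>M\<^esub> v"]) (auto intro: lspan.add)
  next
    case (smult c x)
    then obtain a u where *: "a \<in> carrier R" "u \<in> lspan R M S" "x = a \<odot>\<^bsub>M\<^esub> s \<oplus>\<^bsub>M\<^esub> u" by auto
    have "c \<odot>\<^bsub>M\<^esub> x = (c \<otimes> a) \<odot>\<^bsub>M\<^esub> s \<oplus>\<^bsub>M\<^esub> (c \<odot>\<^bsub>M\<^esub> u)"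
      using * smult(1) assms(2) subsetD[OF sub] by (simp add: smult_r_distr smult_assoc1)
    then show ?case using * smult(1)
      by (intro bexI[of _ "c \<otimes> a"] bexI[of _ "c \<odot>\<^bsub>M\<^esub> u"]) (auto intro: lspan.smult)
  qed
  then show thesis using that by auto
qed

end

lemma submodule_image:
  assumes h: "h \<in> mod_hom R M N" and M: "module R M" and N: "module R N" and H: "submodule H R M"
  shows "submodule (h ` H) R N"
proof -
  interpret M: module R M by fact
  interpret N: module R N by fact
  have HM: "H \<subseteq> carrier M" using M.submoduleE(1)[OF H] .
  note D = mod_homD[OF h]
  show ?thesis
  proof (rule N.submoduleI')
    show "h ` H \<subseteq> carrier N" using D(1) HM by auto
    show "\<zero>\<^bsub>N\<^esub> \<in> h ` H" using mod_hom_zero[OF h M N] M.submodule_zero[OF H] by (metis imageI)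
    fix a b assume "a \<in> h ` H" "b \<in> h ` H"
    then show "a \<oplus>\<^bsub>N\<^esub> b \<in> h ` H" using HM D(2) M.submoduleE(5)[OF H]
      by (smt (verit) imageE imageI subsetD)
  next
    fix a x assume "a \<in> carrier R" "x \<in> h ` H"
    then show "a \<odot>\<^bsub>N\<^esub> x \<in> h ` H" using HM D(3) M.submoduleE(4)[OF H]
      by (smt (verit) imageE imageI subsetD)
  qed
qed

lemma submodule_preimage:
  assumes h: "h \<in> mod_hom R M N" and M: "module R M" and N: "module R N" and H: "submodule H R N"
  shows "submodule {x \<in> carrier M. h x \<in> H} R M"
proof -
  interpret M: module R M by fact
  interpret N: module R N by fact
  note D = mod_homD[OF h]
  show ?thesis
    by (rule M.submoduleI')
      (use D mod_hom_zero[OF h M N] N.submodule_zero[OF H] N.submoduleE(4,5)[OF H] in auto)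
qed

lemma image_lspan:
  assumes h: "h \<in> mod_hom R M N" and M: "module R M" and N: "module R N" and S: "S \<subseteq> carrier M"
  shows "h ` lspan R M S = lspan R N (h ` S)"
proof
  interpret M: module R M by fact
  interpret N: module R N by fact
  have hS: "h ` S \<subseteq> carrier N" using S mod_homD(1)[OF h] by auto
  have "lspan R M S \<subseteq> {x \<in> carrier M. h x \<in> lspan R N (h ` S)}"
    by (intro M.lspan_least submodule_preimage[OF h M N] N.lspan_submodule hS)
      (use S in \<open>auto intro: lspan.base\<close>)
  then show "h ` lspan R M S \<subseteq> lspan R N (h ` S)" by auto
  show "lspan R N (h ` S) \<subseteq> h ` lspan R M S"
    by (intro N.lspan_least submodule_image[OF h M N] M.lspan_submodule S)
      (auto intro: lspan.base)
qed

text \<open>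
  The coefficients at \<open>s\<close> of the elements of \<open>N\<close>, taken modulo \<open>L\<close>.
\<close>

lemma (in module) coefficient_ideal:
  assumes "submodule L R M" "submodule N R M" and s: "s \<in> carrier M"
  shows "ideal {a \<in> carrier R. \<exists>y\<in>L. a \<odot>\<^bsub>M\<^esub> s \<oplus>\<^bsub>M\<^esub> y \<in> N} R" (is "ideal ?I R")
proof -
  note Lcl = submoduleE(4,5)[OF assms(1)] submodule_zero[OF assms(1)]
  note Ncl = submoduleE(4,5)[OF assms(2)] submodule_zero[OF assms(2)]
  have LM: "L \<subseteq> carrier M" using submoduleE(1)[OF assms(1)] .
  have addI: "a \<oplus> b \<in> ?I" if ab: "a \<in> ?I" "b \<in> ?I" for a b
  proof -
    obtain y z where *: "a \<in> carrier R" "b \<in> carrier R" "y \<in> L" "z \<in> L"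
      "a \<odot>\<^bsub>M\<^esub> s \<oplus>\<^bsub>M\<^esub> y \<in> N" "b \<odot>\<^bsub>M\<^esub> s \<oplus>\<^bsub>M\<^esub> z \<in> N" using ab by blast
    have "(a \<oplus> b) \<odot>\<^bsub>M\<^esub> s \<oplus>\<^bsub>M\<^esub> (y \<oplus>\<^bsub>M\<^esub> z)
        = (a \<odot>\<^bsub>M\<^esub> s \<oplus>\<^bsub>M\<^esub> y) \<oplus>\<^bsub>M\<^esub> (b \<odot>\<^bsub>M\<^esub> s \<oplus>\<^bsub>M\<^esub> z)"
      using * s subsetD[OF LM] by (simp add: smult_l_distr M.a_ac)
    then show ?thesis using * Ncl(2) Lcl(2) by (auto intro!: bexI[of _ "y \<oplus>\<^bsub>M\<^esub> z"])
  qed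
  have multI: "c \<otimes> a \<in> ?I" if c: "c \<in> carrier R" and a: "a \<in> ?I" for a c
  proof -
    obtain y where *: "a \<in> carrier R" "y \<in> L" "a \<odot>\<^bsub>M\<^esub> s \<oplus>\<^bsub>M\<^esub> y \<in> N" using a by blast
    have "(c \<otimes> a) \<odot>\<^bsub>M\<^esub> s \<oplus>\<^bsub>M\<^esub> (c \<odot>\<^bsub>M\<^esub> y) = c \<odot>\<^bsub>M\<^esub> (a \<odot>\<^bsub>M\<^esub> s \<oplus>\<^bsub>M\<^esub> y)"
      using * s subsetD[OF LM] c by (simp add: smult_r_distr smult_assoc1)
    then show ?thesis using * Ncl(1) Lcl(1) c
      by (auto intro!: bexI[of _ "c \<odot>\<^bsub>M\<^esub> y"])
  qed
  have zeroI: "\<zero> \<in> ?I" using s Ncl(3) Lcl(3) by (auto intro!: bexI[of _ "\<zero>\<^bsub>M\<^esub>"])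
  show ?thesis
  proof (rule idealI)
    show "ring R" by (rule R.ring_axioms)
    show "subgroup ?I (add_monoid R)"
    proof (rule R.add.subgroupI)
      fix a assume a: "a \<in> ?I"
      then have "\<ominus> a = (\<ominus> \<one>) \<otimes> a" by (auto simp: R.l_minus)
      then show "\<ominus> a \<in> ?I" using multI[OF _ a, of "\<ominus> \<one>"] by simp
    next
      show "?I \<noteq> {}" using zeroI by blast
    next
      show "a \<oplus> b \<in> ?I" if "a \<in> ?I" "b \<in> ?I" for a b using addI[OF that] .
    qed auto
    show 1: "x \<otimes> a \<in> ?I" if "a \<in> ?I" "x \<in> carrier R" for a x
      using multI[OF that(2,1)] .
    show "a \<otimes> x \<in> ?I" if "a \<in> ?I" "x \<in> carrier R" for a x
    proof -
      have "a \<otimes> x = x \<otimes> a" using that by (auto simp: R.m_comm)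
      then show ?thesis using 1[OF that] by argo
    qed
  qed
qed

text \<open>
  Hilbert's argument, one generator at a time: the coefficients at a chosen generator of the
  elements of a submodule form an ideal; finitely many elements realise generators of this
  ideal, and subtracting combinations of them leaves the span of the remaining generators.
\<close>

lemma (in module) noetherian_submodule_finitely_generated:
  assumes noeth: "noetherian_ring R" and "finite S" "S \<subseteq> carrier M"
    and "submodule N R M" "N \<subseteq> lspan R M S"
  shows "\<exists>T. finite T \<and> T \<subseteq> N \<and> N = lspan R M T"
  using assms(2-)
proof (induction S arbitrary: N rule: finite_induct)
  case empty
  have "submodule {\<zero>\<^bsub>M\<^esub>} R M" by (rule submoduleI') auto
  then have z: "lspan R M {} \<subseteq> {\<zero>\<^bsub>M\<^esub>}" by (rule lspan_least) simp
  then have "N \<subseteq> {\<zero>\<^bsub>M\<^esub>}" using empty by auto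
  then have "N = {\<zero>\<^bsub>M\<^esub>}" using submodule_zero[OF empty(2)] by auto
  moreover have "{\<zero>\<^bsub>M\<^esub>} = lspan R M {}" using z lspan.zero[of M R "{}"] by auto
  ultimately show ?case by (intro exI[of _ "{}"]) auto
next
  case (insert s S)
  let ?L = "lspan R M S"
  have s: "s \<in> carrier M" and S: "S \<subseteq> carrier M" using insert.prems by auto
  have LM: "?L \<subseteq> carrier M" by (rule lspan_carrier[OF S])
  have subL: "submodule ?L R M" by (rule lspan_submodule[OF S])
  have NM: "N \<subseteq> carrier M" using submoduleE(1)[OF insert.prems(2)] .
  define I where "I N = {a \<in> carrier R. \<exists>y\<in>?L. a \<odot>\<^bsub>M\<^esub> s \<oplus>\<^bsub>M\<^esub> y \<in> N}" for N
  have "ideal (I N) R" unfolding I_def by (rule coefficient_ideal[OF subL insert.prems(2) s])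
  then obtain A where A: "finite A" "A \<subseteq> carrier R" "I N = Idl A"
    using noetherian_ring.finetely_gen[OF noeth] by blast
  have AI: "A \<subseteq> I N" using A R.genideal_self by auto
  then have "\<forall>a\<in>A. \<exists>n\<in>N. \<exists>y\<in>?L. n = a \<odot>\<^bsub>M\<^esub> s \<oplus>\<^bsub>M\<^esub> y"
    unfolding I_def by blast
  then obtain n where n: "\<And>a. a \<in> A \<Longrightarrow> n a \<in> N \<and> (\<exists>y\<in>?L. n a = a \<odot>\<^bsub>M\<^esub> s \<oplus>\<^bsub>M\<^esub> y)" by metis
  obtain U where U: "finite U" "U \<subseteq> N \<inter> ?L" "N \<inter> ?L = lspan R M U"
  proof -
    have "submodule (N \<inter> ?L) R M"
      by (rule submoduleI')
        (use NM submoduleE(4,5)[OF subL] submodule_zero[OF subL]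
          submoduleE(4,5)[OF insert.prems(2)] submodule_zero[OF insert.prems(2)] in auto)
    then show thesis using insert.IH[OF S, of "N \<inter> ?L"] that by auto
  qed
  let ?T = "n ` A \<union> U"
  have TN: "?T \<subseteq> N" using n U by auto
  then have TM: "?T \<subseteq> carrier M" using NM by auto
  let ?P = "lspan R M ?T"
  have subP: "submodule ?P R M" by (rule lspan_submodule[OF TM])
  have PN: "?P \<subseteq> N" by (rule lspan_least[OF insert.prems(2) TN])
  have "A \<subseteq> I ?P"
  proof
    fix a assume a: "a \<in> A"
    with n obtain y where "y \<in> ?L" "n a = a \<odot>\<^bsub>M\<^esub> s \<oplus>\<^bsub>M\<^esub> y" by blast
    moreover have "n a \<in> ?P" using a by (auto intro: lspan.base)
    ultimately show "a \<in> I ?P" using a A(2) by (auto simp: I_def)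
  qed
  then have IP: "I N \<subseteq> I ?P" unfolding A(3)
    by (intro R.genideal_minimal) (auto simp: I_def intro: coefficient_ideal[OF subL subP s])
  have "N \<subseteq> ?P"
  proof
    fix x assume x: "x \<in> N"
    then have "x \<in> lspan R M (insert s S)" using insert.prems by auto
    then obtain a y where ay: "a \<in> carrier R" "y \<in> ?L" "x = a \<odot>\<^bsub>M\<^esub> s \<oplus>\<^bsub>M\<^esub> y"
      using lspan_insertE[OF _ s S] by metis
    then have "a \<in> I ?P" using x IP by (auto simp: I_def)
    then obtain z where z: "z \<in> ?L" "a \<odot>\<^bsub>M\<^esub> s \<oplus>\<^bsub>M\<^esub> z \<in> ?P" by (auto simp: I_def)
    let ?p = "a \<odot>\<^bsub>M\<^esub> s \<oplus>\<^bsub>M\<^esub> z"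
    have yz: "y \<in> carrier M" "z \<in> carrier M" using ay z LM by auto
    have "x \<ominus>\<^bsub>M\<^esub> ?p = y \<ominus>\<^bsub>M\<^esub> z"
      using ay(1,3) yz s by (simp add: M.minus_eq M.minus_add M.a_ac M.r_neg M.r_neg1 M.r_neg2)
    then have "x \<ominus>\<^bsub>M\<^esub> ?p \<in> N \<inter> ?L"
      using submodule_minus[OF insert.prems(2) x, of ?p] PN z submodule_minus[OF subL ay(2) z(1)]
      by auto
    then have "x \<ominus>\<^bsub>M\<^esub> ?p \<in> ?P" unfolding U(3) using lspan_mono[of U ?T] TM by auto
    then have "(x \<ominus>\<^bsub>M\<^esub> ?p) \<oplus>\<^bsub>M\<^esub> ?p \<in> ?P"
      by (rule submoduleE(5)[OF subP _ z(2)])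
    moreover have "(x \<ominus>\<^bsub>M\<^esub> ?p) \<oplus>\<^bsub>M\<^esub> ?p = x"
      using x NM ay(1) s yz by (auto simp: M.minus_eq M.a_assoc M.l_neg)
    ultimately show "x \<in> ?P" by simp
  qed
  then have "N = ?P" using PN by auto
  then show ?case using TN A(1) U(1) by (intro exI[of _ ?T]) auto
qed


lemma (in cring) module_free_module: "module R (free_module R n)"
proof (rule moduleI)
  show "cring R" by (rule is_cring)
  show "abelian_group (free_module R n)"
  proof (rule abelian_groupI)
    fix x assume "x \<in> carrier (free_module R n)"
    then show "\<exists>y\<in>carrier (free_module R n). y \<oplus>\<^bsub>free_module R n\<^esub> x = \<zero>\<^bsub>free_module R n\<^esub>"
      by (intro bexI[of _ "\<lambda>i\<in>{..<n}. \<ominus> x i"])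
        (auto simp: free_module_def PiE_iff l_neg)
  next
    fix x assume "x \<in> carrier (free_module R n)"
    then show "\<zero>\<^bsub>free_module R n\<^esub> \<oplus>\<^bsub>free_module R n\<^esub> x = x"
      by (auto simp: free_module_def PiE_iff extensional_def fun_eq_iff)
  qed (auto simp: free_module_def PiE_iff a_ac fun_eq_iff)
next
  fix x assume "x \<in> carrier (free_module R n)"
  then show "\<one> \<odot>\<^bsub>free_module R n\<^esub> x = x"
    by (auto simp: free_module_def PiE_iff extensional_def fun_eq_iff)
qed (auto simp: free_module_def PiE_iff l_distr r_distr m_assoc fun_eq_iff)

definition unit_vector :: "('r, 'x) ring_scheme \<Rightarrow> nat \<Rightarrow> nat \<Rightarrow> nat \<Rightarrow> 'r"
  where "unit_vector R n i = (\<lambda>j\<in>{..<n}. if i = j then \<one>\<^bsub>R\<^esub> else \<zero>\<^bsub>R\<^esub>)"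

lemma (in cring) unit_vector_carrier: "unit_vector R n i \<in> carrier (free_module R n)"
  by (auto simp: unit_vector_def free_module_def)

text \<open>
  Induction on the number of coordinates that may be nonzero, splitting off the last one.
\<close>

lemma (in cring) lspan_unit_vectors:
  "lspan R (free_module R n) (unit_vector R n ` {..<n}) = carrier (free_module R n)"
proof
  let ?F = "free_module R n" and ?S = "unit_vector R n ` {..<n}"
  interpret F: module R ?F by (rule module_free_module)
  show "lspan R ?F ?S \<subseteq> carrier ?F"
    by (rule F.lspan_carrier) (auto intro: unit_vector_carrier)
  have "x \<in> lspan R ?F ?S"
    if "k \<le> n" "x \<in> carrier ?F" "\<And>j. \<lbrakk>k \<le> j; j < n\<rbrakk> \<Longrightarrow> x j = \<zero>" for k x
    using that
  proof (induction k arbitrary: x)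
    case 0
    then have "x = \<zero>\<^bsub>?F\<^esub>" by (auto simp: free_module_def PiE_iff extensional_def fun_eq_iff)
    show ?case unfolding \<open>x = \<zero>\<^bsub>?F\<^esub>\<close> by (rule lspan.zero)
  next
    case (Suc k)
    let ?y = "\<lambda>i\<in>{..<n}. if i = k then \<zero> else x i"
    have x: "x i \<in> carrier R" if "i < n" for i
      using Suc.prems(2) that by (auto simp: free_module_def)
    have xu: "x i = undefined" if "\<not> i < n" for i
      using Suc.prems(2) that by (auto simp: free_module_def)
    have "?y \<in> lspan R ?F ?S"
    proof (rule Suc.IH)
      show "?y \<in> carrier ?F" using x by (simp add: free_module_def)
      show "?y j = \<zero>" if "k \<le> j" "j < n" for j
        using that Suc.prems(3)[of j] by (cases "j = k") auto
    qed (use Suc.prems(1) in simp)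
    moreover have "x k \<odot>\<^bsub>?F\<^esub> unit_vector R n k \<in> lspan R ?F ?S"
      using Suc.prems(1) x by (intro lspan.smult lspan.base) auto
    ultimately have "x k \<odot>\<^bsub>?F\<^esub> unit_vector R n k \<oplus>\<^bsub>?F\<^esub> ?y \<in> lspan R ?F ?S"
      by (intro lspan.add)
    also have "x k \<odot>\<^bsub>?F\<^esub> unit_vector R n k \<oplus>\<^bsub>?F\<^esub> ?y = x"
    proof
      show "(x k \<odot>\<^bsub>?F\<^esub> unit_vector R n k \<oplus>\<^bsub>?F\<^esub> ?y) i = x i" for i
        using x[of i] x[of k] xu[of i] Suc.prems(1) by (cases "i < n"; cases "i = k") (simp_all add: free_module_def unit_vector_def)
    qed
    finally show ?case .
  qed
  from this[OF le_refl] show "carrier ?F \<subseteq> lspan R ?F ?S" by (meson leD subsetI)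
qed

text \<open>
  A finite family in a module extends to a linear map from a free module. This converts
  generating sets into the free covers that finite presentations are made of.
\<close>

lemma (in module) free_module_map:
  assumes s: "\<And>i. i < n \<Longrightarrow> s i \<in> carrier M"
  obtains \<pi> where "\<pi> \<in> mod_hom R (free_module R n) M"
    and "\<pi> ` carrier (free_module R n) = lspan R M (s ` {..<n})"
proof -
  let ?F = "free_module R n"
  define \<pi> where "\<pi> x = (\<Oplus>\<^bsub>M\<^esub>i\<in>{..<n}. x i \<odot>\<^bsub>M\<^esub> s i)" for x
  have F: "module R ?F" by (rule R.module_free_module)
  have hom: "\<pi> \<in> mod_hom R ?F M"
  proof (rule mod_homI)
    fix x y assume x: "x \<in> carrier ?F" and y: "y \<in> carrier ?F"
    have 1: "x i \<in> carrier R" "y i \<in> carrier R" if "i < n" for i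
      using x y that by (auto simp: free_module_def)
    have "\<pi> (x \<oplus>\<^bsub>?F\<^esub> y) = (\<Oplus>\<^bsub>M\<^esub>i\<in>{..<n}. x i \<odot>\<^bsub>M\<^esub> s i \<oplus>\<^bsub>M\<^esub> y i \<odot>\<^bsub>M\<^esub> s i)"
      unfolding \<pi>_def by (rule M.finsum_cong') (use 1 s in \<open>auto simp: free_module_def smult_l_distr\<close>)
    also have "\<dots> = \<pi> x \<oplus>\<^bsub>M\<^esub> \<pi> y"
      unfolding \<pi>_def by (rule M.finsum_addf) (use 1 s in auto)
    finally show "\<pi> (x \<oplus>\<^bsub>?F\<^esub> y) = \<pi> x \<oplus>\<^bsub>M\<^esub> \<pi> y" .
  next
    fix a x assume a: "a \<in> carrier R" and x: "x \<in> carrier ?F"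
    have 1: "x i \<in> carrier R" if "i < n" for i using x that by (auto simp: free_module_def)
    have "\<pi> (a \<odot>\<^bsub>?F\<^esub> x) = (\<Oplus>\<^bsub>M\<^esub>i\<in>{..<n}. a \<odot>\<^bsub>M\<^esub> (x i \<odot>\<^bsub>M\<^esub> s i))"
      unfolding \<pi>_def by (rule M.finsum_cong') (use 1 s a in \<open>auto simp: free_module_def smult_assoc1\<close>)
    also have "\<dots> = a \<odot>\<^bsub>M\<^esub> \<pi> x"
      unfolding \<pi>_def by (rule finsum_smult_ldistr[symmetric]) (use 1 s a in auto)
    finally show "\<pi> (a \<odot>\<^bsub>?F\<^esub> x) = a \<odot>\<^bsub>M\<^esub> \<pi> x" .
  qed (use s in \<open>auto simp: \<pi>_def free_module_def intro!: M.finsum_closed\<close>)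
  have unit: "\<pi> (unit_vector R n i) = s i" if "i < n" for i
  proof -
    have "\<pi> (unit_vector R n i) = (\<Oplus>\<^bsub>M\<^esub>j\<in>{..<n}. if i = j then s j else \<zero>\<^bsub>M\<^esub>)"
      unfolding \<pi>_def by (rule M.finsum_cong') (use s in \<open>auto simp: unit_vector_def\<close>)
    also have "\<dots> = s i" by (rule M.finsum_singleton) (use s that in auto)
    finally show ?thesis .
  qed
  have "\<pi> ` carrier ?F = \<pi> ` lspan R ?F (unit_vector R n ` {..<n})"
    by (simp add: R.lspan_unit_vectors)
  also have "\<dots> = lspan R M (\<pi> ` unit_vector R n ` {..<n})"
    by (rule image_lspan[OF hom F module_axioms]) (auto intro: R.unit_vector_carrier)
  also have "\<pi> ` unit_vector R n ` {..<n} = s ` {..<n}"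
    using unit by (auto simp: image_image intro!: image_cong)
  finally show thesis using that[OF hom] by blast
qed

lemma exact_atI:
  assumes "\<And>x. x \<in> carrier L \<Longrightarrow> f x \<in> carrier M \<and> g (f x) = \<zero>\<^bsub>N\<^esub>"
    and "\<And>y. \<lbrakk>y \<in> carrier M; g y = \<zero>\<^bsub>N\<^esub>\<rbrakk> \<Longrightarrow> \<exists>x\<in>carrier L. f x = y"
  shows "exact_at L M N f g"
  using assms unfolding exact_at_def kernel_def by auto

text \<open>
  Over a noetherian ring the kernel of a finite free cover is itself finitely generated, and
  its generators serve as the relations of a presentation.
\<close>

lemma finitely_presented_iff_finitely_generated:
  fixes R :: "('r, 'x) ring_scheme" and M :: "('r, 'a, 'y) module_scheme"
  assumes noeth: "noetherian_ring R" and M: "module R M"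
  shows "finitely_presented R M \<longleftrightarrow> (\<exists>S. finite S \<and> S \<subseteq> carrier M \<and> lspan R M S = carrier M)"
proof
  interpret M: module R M by fact
  have F: "module R (free_module R n)" for n by (rule M.R.module_free_module)
  have unit: "unit_vector R n ` {..<n} \<subseteq> carrier (free_module R n)" for n
    by (auto intro: M.R.unit_vector_carrier)
  {
    assume "finitely_presented R M"
    then obtain n \<pi> where \<pi>: "\<pi> \<in> mod_hom R (free_module R n) M"
      "\<pi> ` carrier (free_module R n) = carrier M" by (auto simp: finitely_presented_def)
    have "lspan R M (\<pi> ` unit_vector R n ` {..<n}) = carrier M"
      using image_lspan[OF \<pi>(1) F M unit] \<pi>(2) by (simp add: M.R.lspan_unit_vectors)
    moreover have "\<pi> ` unit_vector R n ` {..<n} \<subseteq> carrier M" using \<pi>(2) unit by blast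
    ultimately show "\<exists>S. finite S \<and> S \<subseteq> carrier M \<and> lspan R M S = carrier M"
      by (intro exI[of _ "\<pi> ` unit_vector R n ` {..<n}"]) simp
  }
  assume "\<exists>S. finite S \<and> S \<subseteq> carrier M \<and> lspan R M S = carrier M"
  then obtain S where S: "finite S" "S \<subseteq> carrier M" "lspan R M S = carrier M" by auto
  obtain n and s :: "nat \<Rightarrow> 'a" where s: "S = s ` {..<n}"
    using finite_imp_nat_seg_image_inj_on[OF S(1)] by (auto simp: lessThan_def)
  obtain \<pi> where \<pi>: "\<pi> \<in> mod_hom R (free_module R n) M"
    "\<pi> ` carrier (free_module R n) = carrier M"
  proof -
    have "s i \<in> carrier M" if "i < n" for i using S(2) s that by auto
    from M.free_module_map[where s = s, OF this]
    obtain \<pi> where "\<pi> \<in> mod_hom R (free_module R n) M"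
      "\<pi> ` carrier (free_module R n) = lspan R M (s ` {..<n})" .
    then show thesis using that S(3) s by simp
  qed
  interpret F: module R "free_module R n" by (rule F)
  let ?K = "{x \<in> carrier (free_module R n). \<pi> x \<in> {\<zero>\<^bsub>M\<^esub>}}"
  have "submodule ?K R (free_module R n)"
    by (rule submodule_preimage[OF \<pi>(1) F M]) (rule M.submoduleI', auto)
  then obtain T where T: "finite T" "T \<subseteq> ?K" "?K = lspan R (free_module R n) T"
    using F.noetherian_submodule_finitely_generated[OF noeth _ unit, where N = ?K]
    by (auto simp: M.R.lspan_unit_vectors)
  obtain m and t :: "nat \<Rightarrow> nat \<Rightarrow> 'r" where t: "T = t ` {..<m}"
    using finite_imp_nat_seg_image_inj_on[OF T(1)] by (auto simp: lessThan_def)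
  obtain \<phi> where \<phi>: "\<phi> \<in> mod_hom R (free_module R m) (free_module R n)"
    "\<phi> ` carrier (free_module R m) = ?K"
  proof -
    have "t i \<in> carrier (free_module R n)" if "i < m" for i using T(2) t that by auto
    from F.free_module_map[where s = t, OF this]
    obtain \<phi> where "\<phi> \<in> mod_hom R (free_module R m) (free_module R n)"
      "\<phi> ` carrier (free_module R m) = lspan R (free_module R n) (t ` {..<m})" .
    then show thesis using that T(3) t by simp
  qed
  have "exact_at (free_module R m) (free_module R n) M \<phi> \<pi>"
    using \<phi>(2) by (auto simp: exact_at_def kernel_def)
  then show "finitely_presented R M"
    using M \<pi> \<phi> by (auto simp: finitely_presented_def)
qed

lemma finitely_presented_module: "finitely_presented R M \<Longrightarrow> module R M"
  by (simp add: finitely_presented_def)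

lemma finitely_presented_surj:
  assumes noeth: "noetherian_ring R" and A: "finitely_presented R A" and B: "module R B"
    and f: "f \<in> mod_hom R A B" "f ` carrier A = carrier B"
  shows "finitely_presented R B"
proof -
  have mA: "module R A" by (rule finitely_presented_module[OF A])
  obtain S where S: "finite S" "S \<subseteq> carrier A" "lspan R A S = carrier A"
    using A finitely_presented_iff_finitely_generated[OF noeth mA] by auto
  have "lspan R B (f ` S) = carrier B" using image_lspan[OF f(1) mA B S(2)] S(3) f(2) by simp
  then show ?thesis
    using S(1,2) f(2) finitely_presented_iff_finitely_generated[OF noeth B]
    by (metis finite_imageI image_mono)
qed

lemma finitely_presented_submodule:
  assumes noeth: "noetherian_ring R" and A: "finitely_presented R A" and "submodule N R A"
  obtains T where "finite T" "T \<subseteq> N" "N = lspan R A T"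
proof -
  interpret A: module R A by (rule finitely_presented_module[OF A])
  obtain S where S: "finite S" "S \<subseteq> carrier A" "lspan R A S = carrier A"
    using A finitely_presented_iff_finitely_generated[OF noeth A.module_axioms] by auto
  then show thesis
    using A.noetherian_submodule_finitely_generated[OF noeth S(1,2) assms(3)]
      A.submoduleE(1)[OF assms(3)] that by auto
qed

text \<open>
  In an exact sequence the middle term is generated by the images of generators on the left
  together with lifts of generators of the image on the right.
\<close>

lemma finitely_presented_middle:
  assumes noeth: "noetherian_ring R" and A: "finitely_presented R A" and B: "module R B"
    and C: "finitely_presented R C"
    and f: "f \<in> mod_hom R A B" and g: "g \<in> mod_hom R B C"
    and ex: "\<And>b. \<lbrakk>b \<in> carrier B; g b = \<zero>\<^bsub>C\<^esub>\<rbrakk> \<Longrightarrow> \<exists>a\<in>carrier A. f a = b"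
  shows "finitely_presented R B"
proof -
  have mA: "module R A" by (rule finitely_presented_module[OF A])
  have mC: "module R C" by (rule finitely_presented_module[OF C])
  interpret B: module R B by (rule B)
  interpret C: module R C by (rule mC)
  obtain S where S: "finite S" "S \<subseteq> carrier A" "lspan R A S = carrier A"
    using A finitely_presented_iff_finitely_generated[OF noeth mA] by auto
  obtain T where T: "finite T" "T \<subseteq> g ` carrier B" "g ` carrier B = lspan R C T"
    using finitely_presented_submodule[OF noeth C
        submodule_image[OF g B mC B.carrier_is_submodule]] by metis
  obtain U where U: "U \<subseteq> carrier B" "finite U" "T = g ` U"
    using finite_subset_image[OF T(1,2)] by metis
  let ?G = "f ` S \<union> U"
  have G: "?G \<subseteq> carrier B" using U(1) S(2) mod_homD(1)[OF f] by auto
  have sub: "submodule (lspan R B ?G) R B" by (rule B.lspan_submodule[OF G])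
  have "b \<in> lspan R B ?G" if b: "b \<in> carrier B" for b
  proof -
    have "g b \<in> g ` lspan R B U" using image_lspan[OF g B mC U(1)] T(3) U(3) b by auto
    then obtain u where u: "u \<in> lspan R B U" "g b = g u" by auto
    have uB: "u \<in> carrier B" using u(1) B.lspan_carrier[OF U(1)] by auto
    have "g (b \<ominus>\<^bsub>B\<^esub> u) = \<zero>\<^bsub>C\<^esub>"
      using mod_hom_minus[OF g B mC b uB] u(2) mod_homD(1)[OF g uB] by (simp add: C.M.minus_eq C.M.r_neg)
    then obtain a where a: "a \<in> carrier A" "f a = b \<ominus>\<^bsub>B\<^esub> u" using ex[of "b \<ominus>\<^bsub>B\<^esub> u"] b uB by auto
    have "f a \<in> lspan R B (f ` S)" using image_lspan[OF f mA B S(2)] S(3) a(1) by auto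
    then have "f a \<in> lspan R B ?G" using B.lspan_mono[of "f ` S" ?G] G by auto
    moreover have "u \<in> lspan R B ?G" using B.lspan_mono[of U ?G] G u(1) by auto
    ultimately have "f a \<oplus>\<^bsub>B\<^esub> u \<in> lspan R B ?G" by (rule lspan.add)
    moreover have "f a \<oplus>\<^bsub>B\<^esub> u = b" using a(2) b uB by (simp add: B.M.minus_eq B.M.a_assoc B.M.l_neg)
    ultimately show ?thesis by simp
  qed
  then have "lspan R B ?G = carrier B" using B.lspan_carrier[OF G] by auto
  then show ?thesis using G S(1) U(2) finitely_presented_iff_finitely_generated[OF noeth B]
    by (metis finite_UnI finite_imageI)
qed

section \<open>Linear categories\<close>

context linear_category
begin

lemma Hom_abelian_group: "\<lbrakk>X \<in> Obj D; Y \<in> Obj D\<rbrakk> \<Longrightarrow> abelian_group (Hom D X Y)"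
  using Hom_module module.axioms(2) by blast

lemma zero_arr: "\<lbrakk>X \<in> Obj D; Y \<in> Obj D\<rbrakk> \<Longrightarrow> \<zero>\<^bsub>Hom D X Y\<^esub> \<in> Arr D X Y"
  using Hom_abelian_group abelian_group.axioms(1) abelian_monoid.zero_closed by blast

lemma add_arr: "\<lbrakk>X \<in> Obj D; Y \<in> Obj D; f \<in> Arr D X Y; g \<in> Arr D X Y\<rbrakk>
    \<Longrightarrow> f \<oplus>\<^bsub>Hom D X Y\<^esub> g \<in> Arr D X Y"
  using Hom_abelian_group abelian_group.axioms(1) abelian_monoid.a_closed by metis

lemma minus_arr: "\<lbrakk>X \<in> Obj D; Y \<in> Obj D; f \<in> Arr D X Y; g \<in> Arr D X Y\<rbrakk>
    \<Longrightarrow> f \<ominus>\<^bsub>Hom D X Y\<^esub> g \<in> Arr D X Y"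
  using Hom_abelian_group abelian_group.minus_closed by metis

lemma neg_arr: "\<lbrakk>X \<in> Obj D; Y \<in> Obj D; f \<in> Arr D X Y\<rbrakk> \<Longrightarrow> \<ominus>\<^bsub>Hom D X Y\<^esub> f \<in> Arr D X Y"
  using Hom_abelian_group abelian_group.a_inv_closed by metis

lemma neg_neg_arr: "\<lbrakk>X \<in> Obj D; Y \<in> Obj D; f \<in> Arr D X Y\<rbrakk>
    \<Longrightarrow> \<ominus>\<^bsub>Hom D X Y\<^esub> (\<ominus>\<^bsub>Hom D X Y\<^esub> f) = f"
  using Hom_abelian_group abelian_group.minus_minus by metis

lemma zero_add_arr: "\<lbrakk>X \<in> Obj D; Y \<in> Obj D; f \<in> Arr D X Y\<rbrakk> \<Longrightarrow> \<zero>\<^bsub>Hom D X Y\<^esub> \<oplus>\<^bsub>Hom D X Y\<^esub> f = f"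
  using Hom_abelian_group abelian_group.axioms(1) abelian_monoid.l_zero by metis

lemma add_zero_arr: "\<lbrakk>X \<in> Obj D; Y \<in> Obj D; f \<in> Arr D X Y\<rbrakk> \<Longrightarrow> f \<oplus>\<^bsub>Hom D X Y\<^esub> \<zero>\<^bsub>Hom D X Y\<^esub> = f"
  using Hom_abelian_group abelian_group.axioms(1) abelian_monoid.r_zero by metis

lemma minus_zero_arr: "\<lbrakk>X \<in> Obj D; Y \<in> Obj D; f \<in> Arr D X Y\<rbrakk> \<Longrightarrow> f \<ominus>\<^bsub>Hom D X Y\<^esub> \<zero>\<^bsub>Hom D X Y\<^esub> = f"
proof -
  assume *: "X \<in> Obj D" "Y \<in> Obj D" "f \<in> Arr D X Y"
  interpret abelian_group "Hom D X Y" by (rule Hom_abelian_group[OF *(1,2)])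
  show ?thesis using *(3) by (simp add: minus_eq)
qed

lemma minus_add_cancel_arr:
  assumes "X \<in> Obj D" "Y \<in> Obj D" "f \<in> Arr D X Y" "g \<in> Arr D X Y"
  shows "(f \<ominus>\<^bsub>Hom D X Y\<^esub> g) \<oplus>\<^bsub>Hom D X Y\<^esub> g = f"
proof -
  interpret abelian_group "Hom D X Y" by (rule Hom_abelian_group[OF assms(1,2)])
  show ?thesis using assms(3,4) by (simp add: minus_eq a_assoc l_neg)
qed

lemma minus_eq_zero_arr:
  assumes "X \<in> Obj D" "Y \<in> Obj D" "f \<in> Arr D X Y" "g \<in> Arr D X Y"
  shows "f \<ominus>\<^bsub>Hom D X Y\<^esub> g = \<zero>\<^bsub>Hom D X Y\<^esub> \<longleftrightarrow> f = g"
proof -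
  interpret abelian_group "Hom D X Y" by (rule Hom_abelian_group[OF assms(1,2)])
  have "f = g" if "f \<ominus>\<^bsub>Hom D X Y\<^esub> g = \<zero>\<^bsub>Hom D X Y\<^esub>"
    using minus_add_cancel_arr[OF assms] that assms(4) by simp
  then show ?thesis using assms(4) by (auto simp: minus_eq r_neg)
qed

lemma neg_zero_arr:
  assumes "X \<in> Obj D" "Y \<in> Obj D" shows "\<ominus>\<^bsub>Hom D X Y\<^esub> \<zero>\<^bsub>Hom D X Y\<^esub> = \<zero>\<^bsub>Hom D X Y\<^esub>"
proof -
  interpret abelian_group "Hom D X Y" by (rule Hom_abelian_group[OF assms(1,2)])
  show ?thesis using l_neg[of "\<zero>\<^bsub>Hom D X Y\<^esub>"] by simp
qed

lemma neg_eq_zero_minus: 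
  assumes "X \<in> Obj D" "Y \<in> Obj D" "f \<in> Arr D X Y"
  shows "\<ominus>\<^bsub>Hom D X Y\<^esub> f = \<zero>\<^bsub>Hom D X Y\<^esub> \<ominus>\<^bsub>Hom D X Y\<^esub> f"
proof -
  interpret abelian_group "Hom D X Y" by (rule Hom_abelian_group[OF assms(1,2)])
  show ?thesis using assms(3) by (simp add: minus_eq)
qed

context
  fixes X Y Z assumes XYZ: "X \<in> Obj D" "Y \<in> Obj D" "Z \<in> Obj D"
begin

lemma cmp_zero_left: "f \<in> Arr D X Y \<Longrightarrow> \<zero>\<^bsub>Hom D Y Z\<^esub> \<bullet> f = \<zero>\<^bsub>Hom D X Z\<^esub>"
  using mod_hom_zero[OF cmp_linear_left] Hom_module XYZ by blast

lemma cmp_zero_right: "g \<in> Arr D Y Z \<Longrightarrow> g \<bullet> \<zero>\<^bsub>Hom D X Y\<^esub> = \<zero>\<^bsub>Hom D X Z\<^esub>"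
  using mod_hom_zero[OF cmp_linear_right] Hom_module XYZ by blast

lemma cmp_add_left: "\<lbrakk>f \<in> Arr D X Y; g \<in> Arr D Y Z; h \<in> Arr D Y Z\<rbrakk>
    \<Longrightarrow> (g \<oplus>\<^bsub>Hom D Y Z\<^esub> h) \<bullet> f = g \<bullet> f \<oplus>\<^bsub>Hom D X Z\<^esub> h \<bullet> f"
  using mod_homD(2)[OF cmp_linear_left] XYZ by blast

lemma cmp_add_right: "\<lbrakk>f \<in> Arr D X Y; h \<in> Arr D X Y; g \<in> Arr D Y Z\<rbrakk>
    \<Longrightarrow> g \<bullet> (f \<oplus>\<^bsub>Hom D X Y\<^esub> h) = g \<bullet> f \<oplus>\<^bsub>Hom D X Z\<^esub> g \<bullet> h"
  using mod_homD(2)[OF cmp_linear_right] XYZ by blast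

lemma cmp_minus_left: "\<lbrakk>f \<in> Arr D X Y; g \<in> Arr D Y Z; h \<in> Arr D Y Z\<rbrakk>
    \<Longrightarrow> (g \<ominus>\<^bsub>Hom D Y Z\<^esub> h) \<bullet> f = g \<bullet> f \<ominus>\<^bsub>Hom D X Z\<^esub> h \<bullet> f"
  using mod_hom_minus[OF cmp_linear_left] Hom_module XYZ by blast

lemma cmp_minus_right: "\<lbrakk>f \<in> Arr D X Y; h \<in> Arr D X Y; g \<in> Arr D Y Z\<rbrakk>
    \<Longrightarrow> g \<bullet> (f \<ominus>\<^bsub>Hom D X Y\<^esub> h) = g \<bullet> f \<ominus>\<^bsub>Hom D X Z\<^esub> g \<bullet> h"
  using mod_hom_minus[OF cmp_linear_right] Hom_module XYZ by blast

lemma cmp_neg_left: "\<lbrakk>f \<in> Arr D X Y; g \<in> Arr D Y Z\<rbrakk>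
    \<Longrightarrow> (\<ominus>\<^bsub>Hom D Y Z\<^esub> g) \<bullet> f = \<ominus>\<^bsub>Hom D X Z\<^esub> (g \<bullet> f)"
  using cmp_minus_left[OF _ zero_arr] cmp_zero_left XYZ cmp_arr[OF XYZ]
  by (simp add: neg_eq_zero_minus zero_arr)

lemma cmp_neg_right: "\<lbrakk>f \<in> Arr D X Y; g \<in> Arr D Y Z\<rbrakk>
    \<Longrightarrow> g \<bullet> (\<ominus>\<^bsub>Hom D X Y\<^esub> f) = \<ominus>\<^bsub>Hom D X Z\<^esub> (g \<bullet> f)"
  using cmp_minus_right[OF zero_arr] cmp_zero_right XYZ cmp_arr[OF XYZ]
  by (simp add: neg_eq_zero_minus zero_arr)

end

end

section \<open>Coproducts and compact objects\<close>

locale coproduct_in = linear_category R D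
  for R :: "('r, 'x) ring_scheme" and D :: "('r, 'o, 'm, 'y) tricat_scheme" (structure) +
  fixes I :: "'j set" and X :: "'j \<Rightarrow> 'o" and P :: 'o and \<iota> :: "'j \<Rightarrow> 'm"
  assumes coproduct: "coproduct D I X P \<iota>" and summands: "X \<in> I \<rightarrow> Obj D"
begin

lemma summand_obj: "i \<in> I \<Longrightarrow> X i \<in> Obj D"
  using summands by auto

lemma coproduct_obj: "P \<in> Obj D"
  using coproduct by (simp add: coproduct_def)

lemma injection_arr: "i \<in> I \<Longrightarrow> \<iota> i \<in> Arr D (X i) P"
  using coproduct by (simp add: coproduct_def)

lemma coproduct_ex1:
  "\<lbrakk>Y \<in> Obj D; \<And>i. i \<in> I \<Longrightarrow> f i \<in> Arr D (X i) Y\<rbrakk>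
    \<Longrightarrow> \<exists>!h. h \<in> Arr D P Y \<and> (\<forall>i\<in>I. h \<bullet> \<iota> i = f i)"
  using coproduct unfolding coproduct_def by blast

lemma coproduct_arr_eqI:
  assumes "Y \<in> Obj D" "g \<in> Arr D P Y" "h \<in> Arr D P Y" "\<And>i. i \<in> I \<Longrightarrow> g \<bullet> \<iota> i = h \<bullet> \<iota> i"
  shows "g = h"
  using coproduct_ex1[OF assms(1), of "\<lambda>i. h \<bullet> \<iota> i"] assms
    cmp_arr[OF summand_obj coproduct_obj assms(1) injection_arr] by metis

text \<open>
  The idempotent endomorphism of the coproduct that retains the summands in \<open>F\<close>.
\<close>

definition part :: "'j set \<Rightarrow> 'm"
  where "part F = (THE e. e \<in> Arr D P P \<and> (\<forall>i\<in>I. e \<bullet> \<iota> i = (if i \<in> F then \<iota> i else \<zero>\<^bsub>Hom D (X i) P\<^esub>)))"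

definition proj :: "'j \<Rightarrow> 'm"
  where "proj j = (THE p. p \<in> Arr D P (X j) \<and>
    (\<forall>i\<in>I. p \<bullet> \<iota> i = (if i = j then ident D (X i) else \<zero>\<^bsub>Hom D (X i) (X j)\<^esub>)))"

lemma part: "part F \<in> Arr D P P \<and> (\<forall>i\<in>I. part F \<bullet> \<iota> i = (if i \<in> F then \<iota> i else \<zero>\<^bsub>Hom D (X i) P\<^esub>))"
  unfolding part_def
  by (rule theI', rule coproduct_ex1)
    (auto simp: coproduct_obj injection_arr summand_obj zero_arr)

lemma part_arr: "part F \<in> Arr D P P"
  using part by blast

lemma part_injection:
  "i \<in> I \<Longrightarrow> part F \<bullet> \<iota> i = (if i \<in> F then \<iota> i else \<zero>\<^bsub>Hom D (X i) P\<^esub>)"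
  using part by blast

lemma proj:
  assumes "j \<in> I"
  shows "proj j \<in> Arr D P (X j) \<and>
    (\<forall>i\<in>I. proj j \<bullet> \<iota> i = (if i = j then ident D (X i) else \<zero>\<^bsub>Hom D (X i) (X j)\<^esub>))"
  unfolding proj_def
  by (rule theI', rule coproduct_ex1) (use assms in \<open>auto simp: summand_obj ident_arr zero_arr\<close>)

lemma proj_arr: "j \<in> I \<Longrightarrow> proj j \<in> Arr D P (X j)"
  using proj by blast

lemma proj_injection: "\<lbrakk>j \<in> I; i \<in> I\<rbrakk>
    \<Longrightarrow> proj j \<bullet> \<iota> i = (if i = j then ident D (X i) else \<zero>\<^bsub>Hom D (X i) (X j)\<^esub>)"
  using proj by blast

lemma part_eqI:
  assumes "e \<in> Arr D P P" "\<And>i. i \<in> I \<Longrightarrow> e \<bullet> \<iota> i = (if i \<in> F then \<iota> i else \<zero>\<^bsub>Hom D (X i) P\<^esub>)"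
  shows "part F = e"
  by (rule coproduct_arr_eqI[OF coproduct_obj part_arr assms(1)]) (simp add: part_injection assms(2))

lemma part_empty: "part {} = \<zero>\<^bsub>Hom D P P\<^esub>"
  by (rule part_eqI)
    (auto simp: zero_arr coproduct_obj summand_obj cmp_zero_left[OF summand_obj] injection_arr)

lemma part_insert:
  assumes j: "j \<in> I" "j \<notin> F"
  shows "part (insert j F) = \<iota> j \<bullet> proj j \<oplus>\<^bsub>Hom D P P\<^esub> part F"
proof (rule part_eqI)
  note o = coproduct_obj summand_obj
  have jp: "\<iota> j \<bullet> proj j \<in> Arr D P P"
    using j by (intro cmp_arr[of _ "X j"]) (auto simp: o proj_arr injection_arr)
  show "\<iota> j \<bullet> proj j \<oplus>\<^bsub>Hom D P P\<^esub> part F \<in> Arr D P P"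
    by (intro add_arr o jp part_arr)
  fix i assume i: "i \<in> I"
  have "(\<iota> j \<bullet> proj j) \<bullet> \<iota> i = \<iota> j \<bullet> (proj j \<bullet> \<iota> i)"
    using i j by (intro cmp_assoc[of "X i" P "X j" P]) (auto simp: o proj_arr injection_arr)
  also have "\<dots> = (if i = j then \<iota> i else \<zero>\<^bsub>Hom D (X i) P\<^esub>)"
    using i j by (simp add: proj_injection cmp_ident_right[of "X j" P] cmp_zero_right[of "X i" "X j" P] o injection_arr)
  finally have 1: "(\<iota> j \<bullet> proj j) \<bullet> \<iota> i = (if i = j then \<iota> i else \<zero>\<^bsub>Hom D (X i) P\<^esub>)" .
  have "(\<iota> j \<bullet> proj j \<oplus>\<^bsub>Hom D P P\<^esub> part F) \<bullet> \<iota> i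
      = (\<iota> j \<bullet> proj j) \<bullet> \<iota> i \<oplus>\<^bsub>Hom D (X i) P\<^esub> part F \<bullet> \<iota> i"
    using i by (intro cmp_add_left) (auto simp: o jp part_arr injection_arr)
  also have "\<dots> = (if i \<in> insert j F then \<iota> i else \<zero>\<^bsub>Hom D (X i) P\<^esub>)"
    unfolding 1 part_injection[OF i] using i j
    by (auto simp: o zero_add_arr add_zero_arr injection_arr zero_arr)
  finally show "(\<iota> j \<bullet> proj j \<oplus>\<^bsub>Hom D P P\<^esub> part F) \<bullet> \<iota> i
      = (if i \<in> insert j F then \<iota> i else \<zero>\<^bsub>Hom D (X i) P\<^esub>)" .
qed

lemma part_part:
  assumes "F \<subseteq> F'" shows "part F' \<bullet> part F = part F"
proof (rule sym, rule part_eqI)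
  note o = coproduct_obj summand_obj
  show "part F' \<bullet> part F \<in> Arr D P P" by (rule cmp_arr[OF o(1) o(1) o(1) part_arr part_arr])
  fix i assume i: "i \<in> I"
  have "(part F' \<bullet> part F) \<bullet> \<iota> i = part F' \<bullet> (part F \<bullet> \<iota> i)"
    using i by (intro cmp_assoc[of "X i" P P P]) (auto simp: o part_arr injection_arr)
  then show "(part F' \<bullet> part F) \<bullet> \<iota> i = (if i \<in> F then \<iota> i else \<zero>\<^bsub>Hom D (X i) P\<^esub>)"
    using i assms by (auto simp: part_injection cmp_zero_right[of "X i" P P] o part_arr)
qed

lemma proj_part:
  assumes j: "j \<in> I" "j \<notin> F" shows "proj j \<bullet> part F = \<zero>\<^bsub>Hom D P (X j)\<^esub>"
proof (rule coproduct_arr_eqI)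
  note o = coproduct_obj summand_obj
  show "X j \<in> Obj D" "\<zero>\<^bsub>Hom D P (X j)\<^esub> \<in> Arr D P (X j)" using j by (simp_all add: o zero_arr)
  show "proj j \<bullet> part F \<in> Arr D P (X j)"
    using j by (intro cmp_arr[of P P]) (auto simp: o part_arr proj_arr)
  fix i assume i: "i \<in> I"
  have "(proj j \<bullet> part F) \<bullet> \<iota> i = proj j \<bullet> (part F \<bullet> \<iota> i)"
    using i j by (intro cmp_assoc[of "X i" P P "X j"]) (auto simp: o part_arr injection_arr proj_arr)
  then show "(proj j \<bullet> part F) \<bullet> \<iota> i = \<zero>\<^bsub>Hom D P (X j)\<^esub> \<bullet> \<iota> i"
    using i j by (auto simp: part_injection proj_injection o proj_arr injection_arr
        cmp_zero_right[of "X i" P "X j"] cmp_zero_left[of "X i" P "X j"])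
qed

lemma part_mono:
  assumes "F \<subseteq> F'" "B \<in> Obj D" "h \<in> Arr D B P" "part F \<bullet> h = h"
  shows "part F' \<bullet> h = h"
  using cmp_assoc[OF assms(2) coproduct_obj coproduct_obj coproduct_obj assms(3) part_arr part_arr, of F' F]
    part_part[OF assms(1)] assms(4) by simp

lemma part_finsum:
  assumes "finite F" "F \<subseteq> I" and C: "C \<in> Obj D" and x: "\<And>i. i \<in> F \<Longrightarrow> x i \<in> Arr D C (X i)"
  shows "part F \<bullet> (\<Oplus>\<^bsub>Hom D C P\<^esub>i\<in>F. \<iota> i \<bullet> x i) = (\<Oplus>\<^bsub>Hom D C P\<^esub>i\<in>F. \<iota> i \<bullet> x i)"
proof -
  note o = coproduct_obj summand_obj
  interpret H: module R "Hom D C P" by (rule Hom_module[OF C o(1)])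
  have ar: "\<iota> i \<bullet> x i \<in> Arr D C P" if "i \<in> F" for i
    using assms that by (intro cmp_arr[of C "X i"]) (auto simp: o injection_arr)
  have "part F \<bullet> (\<Oplus>\<^bsub>Hom D C P\<^esub>i\<in>F. \<iota> i \<bullet> x i) = (\<Oplus>\<^bsub>Hom D C P\<^esub>i\<in>F. part F \<bullet> \<iota> i \<bullet> x i)"
    by (rule mod_hom_finsum[OF cmp_linear_right[OF C o(1) o(1) part_arr] _ _ assms(1) ar])
      (simp_all add: Hom_module C o)
  also have "\<dots> = (\<Oplus>\<^bsub>Hom D C P\<^esub>i\<in>F. \<iota> i \<bullet> x i)"
  proof (rule H.M.finsum_cong')
    fix i assume i: "i \<in> F"
    have "part F \<bullet> \<iota> i \<bullet> x i = (part F \<bullet> \<iota> i) \<bullet> x i"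
      using i assms by (intro cmp_assoc[of C "X i" P P, symmetric]) (auto simp: o injection_arr part_arr)
    then show "part F \<bullet> \<iota> i \<bullet> x i = \<iota> i \<bullet> x i" using i assms(2) by (auto simp: part_injection)
  qed (use ar in auto)
  finally show ?thesis .
qed

lemma proj_finsum:
  assumes "finite F" "F \<subseteq> I" and C: "C \<in> Obj D" and x: "\<And>i. i \<in> F \<Longrightarrow> x i \<in> Arr D C (X i)"
    and j: "j \<in> I"
  shows "proj j \<bullet> (\<Oplus>\<^bsub>Hom D C P\<^esub>i\<in>F. \<iota> i \<bullet> x i) = (if j \<in> F then x j else \<zero>\<^bsub>Hom D C (X j)\<^esub>)"
proof -
  note o = coproduct_obj summand_obj
  interpret H: module R "Hom D C (X j)" by (rule Hom_module[OF C o(2)[OF j]])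
  have ar: "\<iota> i \<bullet> x i \<in> Arr D C P" if "i \<in> F" for i
    using assms that by (intro cmp_arr[of C "X i"]) (auto simp: o injection_arr)
  have "proj j \<bullet> (\<Oplus>\<^bsub>Hom D C P\<^esub>i\<in>F. \<iota> i \<bullet> x i) = (\<Oplus>\<^bsub>Hom D C (X j)\<^esub>i\<in>F. proj j \<bullet> \<iota> i \<bullet> x i)"
    by (rule mod_hom_finsum[OF cmp_linear_right[OF C o(1) o(2)[OF j] proj_arr[OF j]] _ _ assms(1) ar])
      (simp_all add: Hom_module C o j)
  also have "\<dots> = (\<Oplus>\<^bsub>Hom D C (X j)\<^esub>i\<in>F. if j = i then x i else \<zero>\<^bsub>Hom D C (X j)\<^esub>)"
  proof (rule H.M.finsum_cong')
    fix i assume i: "i \<in> F"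
    have "proj j \<bullet> \<iota> i \<bullet> x i = (proj j \<bullet> \<iota> i) \<bullet> x i"
      using i assms by (intro cmp_assoc[of C "X i" P "X j", symmetric]) (auto simp: o injection_arr proj_arr)
    then show "proj j \<bullet> \<iota> i \<bullet> x i = (if j = i then x i else \<zero>\<^bsub>Hom D C (X j)\<^esub>)"
      using i assms(2) j x[OF i] C
      by (auto simp: proj_injection o cmp_ident_left[of C "X i"] cmp_zero_left[of C "X i" "X j"])
  qed (use x in auto)
  also have "\<dots> = (if j \<in> F then x j else \<zero>\<^bsub>Hom D C (X j)\<^esub>)"
  proof (cases "j \<in> F")
    case True
    have "(\<Oplus>\<^bsub>Hom D C (X j)\<^esub>i\<in>F. if j = i then x i else \<zero>\<^bsub>Hom D C (X j)\<^esub>)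
        = (\<Oplus>\<^bsub>Hom D C (X j)\<^esub>i\<in>F. if j = i then x j else \<zero>\<^bsub>Hom D C (X j)\<^esub>)"
      by (rule H.M.finsum_cong') (use x in auto)
    also have "\<dots> = x j" using H.M.finsum_singleton[OF True assms(1), of "\<lambda>_. x j"] x[OF True] by simp
    finally show ?thesis using True by simp
  next
    case False
    have "(\<Oplus>\<^bsub>Hom D C (X j)\<^esub>i\<in>F. if j = i then x i else \<zero>\<^bsub>Hom D C (X j)\<^esub>)
        = (\<Oplus>\<^bsub>Hom D C (X j)\<^esub>i\<in>F. \<zero>\<^bsub>Hom D C (X j)\<^esub>)"
      by (rule H.M.finsum_cong') (use False in auto)
    then show ?thesis using False by simp
  qed
  finally show ?thesis .
qed

lemma finsum_proj:
  assumes "finite F" "F \<subseteq> I" and C: "C \<in> Obj D" and h: "h \<in> Arr D C P"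
  shows "(\<Oplus>\<^bsub>Hom D C P\<^esub>i\<in>F. \<iota> i \<bullet> proj i \<bullet> h) = part F \<bullet> h"
proof -
  note o = coproduct_obj summand_obj
  interpret H: module R "Hom D C P" by (rule Hom_module[OF C o(1)])
  have ip: "\<iota> i \<bullet> proj i \<in> Arr D P P" if "i \<in> I" for i
    using that by (intro cmp_arr[of P "X i" P]) (auto simp: o injection_arr proj_arr)
  have as: "(\<iota> i \<bullet> proj i) \<bullet> h = \<iota> i \<bullet> proj i \<bullet> h" if "i \<in> I" for i
    using that by (intro cmp_assoc[of C P "X i" P]) (auto simp: o C h injection_arr proj_arr)
  have ar: "\<iota> i \<bullet> proj i \<bullet> h \<in> Arr D C P" if "i \<in> I" for i
    unfolding as[OF that, symmetric] by (rule cmp_arr[OF C o(1) o(1) h ip[OF that]])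
  show ?thesis using assms(1,2)
  proof (induction F rule: finite_induct)
    case empty
    show ?case by (simp add: part_empty cmp_zero_left[OF C o(1) o(1) h])
  next
    case (insert j F)
    then have j: "j \<in> I" "j \<notin> F" by auto
    have "part (insert j F) \<bullet> h = \<iota> j \<bullet> proj j \<bullet> h \<oplus>\<^bsub>Hom D C P\<^esub> part F \<bullet> h"
      unfolding part_insert[OF j] as[OF j(1), symmetric]
      by (rule cmp_add_left[OF C o(1) o(1) h ip[OF j(1)] part_arr])
    moreover have "(\<lambda>i. \<iota> i \<bullet> proj i \<bullet> h) \<in> F \<rightarrow> Arr D C P" using ar insert.prems by auto
    ultimately show ?case using insert ar[OF j(1)] by simp
  qed
qed

end

text \<open>
  A map into a coproduct factors through a finite subcoproduct iff it is fixed by one of the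
  idempotents that retain finitely many summands. Phrasing compactness with these idempotents
  keeps sums of maps out of the arguments below.
\<close>

definition finitary :: "('r, 'x) ring_scheme \<Rightarrow> ('i set \<Rightarrow> bool) \<Rightarrow> ('r, 'o, 'm, 'y) tricat_scheme \<Rightarrow> 'o \<Rightarrow> bool"
  where "finitary R small D C \<longleftrightarrow> C \<in> Obj D \<and>
    (\<forall>I X P \<iota>. small I \<longrightarrow> X \<in> I \<rightarrow> Obj D \<longrightarrow> coproduct D I X P \<iota> \<longrightarrow>
      (\<forall>h\<in>Arr D C P. \<exists>F. finite F \<and> F \<subseteq> I \<and> coproduct_in.part D I X P \<iota> F \<bullet>\<^bsub>D\<^esub> h = h))"

context coproduct_in
begin

text \<open>
  Injectivity is automatic because the projections recover the components of a finite sum. What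
  remains is surjectivity: the image of the sum map consists of the maps that some
  \<open>part F\<close> with \<open>F\<close> finite leaves unchanged.
\<close>

lemma Hom_coproduct_bij_iff:
  assumes C: "C \<in> Obj D"
  shows "bij_betw (\<lambda>x. \<Oplus>\<^bsub>Hom D C P\<^esub>i\<in>{i \<in> I. x i \<noteq> \<zero>\<^bsub>Hom D C (X i)\<^esub>}. \<iota> i \<bullet> x i)
      (carrier (sum_group I (\<lambda>i. add_monoid (Hom D C (X i))))) (Arr D C P)
    \<longleftrightarrow> (\<forall>h\<in>Arr D C P. \<exists>F. finite F \<and> F \<subseteq> I \<and> part F \<bullet> h = h)"
    (is "bij_betw ?f ?A _ \<longleftrightarrow> ?R")
proof
  note o = coproduct_obj summand_obj
  interpret H: module R "Hom D C P" by (rule Hom_module[OF C o(1)])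
  let ?S = "\<lambda>x. {i \<in> I. x i \<noteq> \<zero>\<^bsub>Hom D C (X i)\<^esub>}"
  have A: "?A = {x \<in> \<Pi>\<^sub>E i\<in>I. Arr D C (X i). finite (?S x)}"
    using abelian_group.a_group[OF Hom_abelian_group[OF C o(2)]] by (subst carrier_sum_group) auto
  have xA: "x i \<in> Arr D C (X i)" if "x \<in> ?A" "i \<in> I" for x i using that A by auto
  have fin: "finite (?S x)" if "x \<in> ?A" for x using that A by auto
  have ar: "\<iota> i \<bullet> x i \<in> Arr D C P" if "x i \<in> Arr D C (X i)" "i \<in> I" for x i
    using that by (intro cmp_arr[of C "X i"]) (auto simp: o C injection_arr)
  have f: "?f x \<in> Arr D C P" if "x \<in> ?A" for x
    by (rule H.M.finsum_closed) (auto intro!: ar xA[OF that])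
  have projf: "proj j \<bullet> ?f x = x j" if x: "x \<in> ?A" and j: "j \<in> I" for x j
    using proj_finsum[OF fin[OF x] _ C _ j, of x] xA[OF x] j by auto
  {
    assume bij: "bij_betw ?f ?A (Arr D C P)"
    show ?R
    proof
      fix h assume "h \<in> Arr D C P"
      then obtain x where x: "x \<in> ?A" "h = ?f x" using bij_betw_imp_surj_on[OF bij] by blast
      have "part (?S x) \<bullet> h = h" unfolding x(2)
        by (rule part_finsum[OF fin[OF x(1)] _ C]) (auto simp: xA[OF x(1)])
      then show "\<exists>F. finite F \<and> F \<subseteq> I \<and> part F \<bullet> h = h" using fin[OF x(1)] by (intro exI[of _ "?S x"]) auto
    qed
  next
    assume R: ?R
    have "inj_on ?f ?A"
    proof (rule inj_onI)
      fix x y assume xy: "x \<in> ?A" "y \<in> ?A" "?f x = ?f y"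
      have "x \<in> extensional I" "y \<in> extensional I" using xy(1,2) A by (auto simp: PiE_iff)
      then show "x = y"
      proof (rule extensionalityI)
        show "x i = y i" if "i \<in> I" for i
          using projf[OF xy(1) that] projf[OF xy(2) that] unfolding xy(3) by (rule trans[OF sym])
      qed
    qed
    moreover have "h \<in> ?f ` ?A" if h: "h \<in> Arr D C P" for h
    proof -
      obtain F where F: "finite F" "F \<subseteq> I" "part F \<bullet> h = h" using R h by blast
      define x where "x = (\<lambda>i\<in>I. proj i \<bullet> h)"
      have xi: "x i \<in> Arr D C (X i)" if "i \<in> I" for i
        unfolding x_def using that by (auto intro!: cmp_arr[of C P] simp: C o h proj_arr)
      have S: "?S x \<subseteq> F"
      proof
        fix i assume i: "i \<in> ?S x"
        show "i \<in> F"
        proof (rule ccontr)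
          assume nF: "i \<notin> F"
          have "proj i \<bullet> h = proj i \<bullet> part F \<bullet> h" using F by simp
          also have "\<dots> = (proj i \<bullet> part F) \<bullet> h"
            using i by (intro cmp_assoc[of C P P "X i", symmetric]) (auto simp: C o h part_arr proj_arr)
          also have "\<dots> = \<zero>\<^bsub>Hom D C (X i)\<^esub>"
            using i nF by (auto simp: proj_part cmp_zero_left C o h)
          finally show False using i by (auto simp: x_def)
        qed
      qed
      then have finS: "finite (?S x)" using F(1) finite_subset by blast
      have xA: "x \<in> ?A" unfolding A using xi finS by (auto simp: x_def)
      have "?f x = (\<Oplus>\<^bsub>Hom D C P\<^esub>i\<in>F. \<iota> i \<bullet> x i)"
        by (rule H.M.add.finprod_mono_neutral_cong_left[OF F(1) S, folded finsum_def])
          (use F(2) xi ar in \<open>auto simp: cmp_zero_right C o injection_arr\<close>)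
      also have "\<dots> = (\<Oplus>\<^bsub>Hom D C P\<^esub>i\<in>F. \<iota> i \<bullet> proj i \<bullet> h)"
      proof (rule H.M.finsum_cong')
        have "\<iota> i \<bullet> proj i \<bullet> h \<in> Arr D C P" if "i \<in> F" for i
          using ar[of x i] xi[of i] F(2) that by (auto simp: x_def)
        then show "(\<lambda>i. \<iota> i \<bullet> proj i \<bullet> h) \<in> F \<rightarrow> Arr D C P" by blast
        show "\<iota> i \<bullet> x i = \<iota> i \<bullet> proj i \<bullet> h" if "i \<in> F" for i
          using F(2) that by (auto simp: x_def)
      qed simp
      also have "\<dots> = h" using finsum_proj[OF F(1,2) C h] F(3) by simp
      finally show ?thesis using xA by blast
    qed
    ultimately show "bij_betw ?f ?A (Arr D C P)" using f by (auto simp: bij_betw_def)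
  }
qed

end

lemma (in linear_category) compact_objects_eq_finitary:
  "compact_objects small D = {C. finitary R small D C}"
proof -
  have eq: "bij_betw (\<lambda>x. \<Oplus>\<^bsub>Hom D C P\<^esub>i\<in>{i \<in> I. x i \<noteq> \<zero>\<^bsub>Hom D C (X i)\<^esub>}. \<iota> i \<bullet> x i)
      (carrier (sum_group I (\<lambda>i. add_monoid (Hom D C (X i))))) (Arr D C P)
    \<longleftrightarrow> (\<forall>h\<in>Arr D C P. \<exists>F. finite F \<and> F \<subseteq> I \<and> coproduct_in.part D I X P \<iota> F \<bullet> h = h)"
    if "C \<in> Obj D" "X \<in> I \<rightarrow> Obj D" "coproduct D I X P \<iota>" for C I X P \<iota>
  proof -
    interpret coproduct_in R D I X P \<iota> by unfold_locales (use that in auto)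
    show ?thesis by (rule Hom_coproduct_bij_iff[OF that(1)])
  qed
  show ?thesis unfolding compact_objects_def finitary_def
    by (intro Collect_cong conj_cong refl all_cong1 imp_cong eq) assumption+
qed

section \<open>Triangles\<close>

context triangulated_category
begin

lemma shO_obj: "X \<in> Obj D \<Longrightarrow> shO D X \<in> Obj D"
  by (rule bij_betw_apply[OF shO_bij])

lemma shM_arr: "\<lbrakk>X \<in> Obj D; Y \<in> Obj D; f \<in> Arr D X Y\<rbrakk> \<Longrightarrow> shM D f \<in> Arr D (shO D X) (shO D Y)"
  by (rule bij_betw_apply[OF shM_bij])

lemma unshift_arr:
  assumes "X \<in> Obj D" "Y \<in> Obj D" "f \<in> Arr D (shO D X) (shO D Y)"
  obtains g where "g \<in> Arr D X Y" "shM D g = f"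
proof -
  have "f \<in> shM D ` Arr D X Y"
    using bij_betw_imp_surj_on[OF shM_bij[OF assms(1,2)]] assms(3) by simp
  then show thesis using that by auto
qed

lemma unshift_obj:
  assumes "X \<in> Obj D" obtains Y where "Y \<in> Obj D" "shO D Y = X"
proof -
  have "X \<in> shO D ` Obj D" using bij_betw_imp_surj_on[OF shO_bij] assms by simp
  then show thesis using that by auto
qed

lemma shM_inj: "\<lbrakk>X \<in> Obj D; Y \<in> Obj D; f \<in> Arr D X Y; g \<in> Arr D X Y; shM D f = shM D g\<rbrakk> \<Longrightarrow> f = g"
  by (rule inj_onD[OF bij_betw_imp_inj_on[OF shM_bij]])

lemma shM_zero:
  assumes "X \<in> Obj D" "Y \<in> Obj D" shows "shM D \<zero>\<^bsub>Hom D X Y\<^esub> = \<zero>\<^bsub>Hom D (shO D X) (shO D Y)\<^esub>"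
  by (rule mod_hom_zero[OF shM_linear[OF assms] Hom_module[OF assms] Hom_module])
    (simp_all add: shO_obj assms)

lemma zero_object_iff: "Z \<in> Obj D \<Longrightarrow> zero_object D Z \<longleftrightarrow> ident D Z = \<zero>\<^bsub>Hom D Z Z\<^esub>"
proof
  assume Z: "Z \<in> Obj D"
  show "zero_object D Z \<Longrightarrow> ident D Z = \<zero>\<^bsub>Hom D Z Z\<^esub>"
    using ident_arr[OF Z] unfolding zero_object_def by blast
  assume id: "ident D Z = \<zero>\<^bsub>Hom D Z Z\<^esub>"
  have "f = \<zero>\<^bsub>Hom D Z X\<^esub>" if "X \<in> Obj D" "f \<in> Arr D Z X" for X f
    using cmp_ident_right[OF Z that] cmp_zero_right[OF Z Z that] id by simp
  moreover have "f = \<zero>\<^bsub>Hom D X Z\<^esub>" if "X \<in> Obj D" "f \<in> Arr D X Z" for X f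
    using cmp_ident_left[OF that(1) Z that(2)] cmp_zero_left[OF that(1) Z Z that(2)] id by simp
  ultimately show "zero_object D Z" using Z zero_arr unfolding zero_object_def by blast
qed

lemma zero_object_shift: "zero_object D Z \<Longrightarrow> zero_object D (shO D Z)"
  using zero_object_iff[of Z] zero_object_iff[of "shO D Z"] shM_ident shM_zero shO_obj
  by (metis zero_object_def)

lemma Tri_rotate_left_to_right:
  "Tri D X Y Z u v w \<Longrightarrow> Tri D Y Z (shO D X) v w (\<ominus>\<^bsub>Hom D (shO D X) (shO D Y)\<^esub> shM D u)"
  using Tri_rotate[of X Y Z u v w] Tri_arr[of X Y Z u v w] by simp

text \<open>
  Compare with the triangle on the identity of \<open>X\<close>, in which the composite passes through a
  zero object.
\<close>

lemma Tri_cmp_zero: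
  assumes T: "Tri D X Y Z u v w" shows "v \<bullet> u = \<zero>\<^bsub>Hom D X Z\<^esub>"
proof -
  note a = Tri_arr[OF T]
  obtain N where N: "zero_object D N" using ex_zero_object by auto
  then have N': "N \<in> Obj D" by (simp add: zero_object_def)
  have "u \<bullet> ident D X = u \<bullet> ident D X" ..
  then obtain c where c: "c \<in> Arr D N Z" "c \<bullet> \<zero>\<^bsub>Hom D X N\<^esub> = v \<bullet> u"
    using Tri_morphism[OF Tri_ident[of X N] T, of "ident D X" u] a N ident_arr by blast
  then show ?thesis using cmp_zero_right[of X N Z c] a N' by simp
qed

text \<open>
  The square formed by \<open>f\<close>, \<open>v\<close> and a zero object extends to a morphism from the rotated
  triangle on the identity of \<open>W\<close> to the rotation of the given triangle; its third component is
  the shift of the factorisation.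
\<close>

lemma Tri_exact_covariant:
  assumes T: "Tri D X Y Z u v w" and W: "W \<in> Obj D" and f: "f \<in> Arr D W Y"
    and vf: "v \<bullet> f = \<zero>\<^bsub>Hom D W Z\<^esub>"
  shows "\<exists>g\<in>Arr D W X. u \<bullet> g = f"
proof -
  have a: "X \<in> Obj D" "Y \<in> Obj D" "Z \<in> Obj D" "u \<in> Arr D X Y" "v \<in> Arr D Y Z" using Tri_arr[OF T] by auto
  obtain N where N: "zero_object D N" using ex_zero_object by auto
  then have N': "N \<in> Obj D" by (simp add: zero_object_def)
  note s = shO_obj
  have "\<zero>\<^bsub>Hom D N Z\<^esub> \<bullet> \<zero>\<^bsub>Hom D W N\<^esub> = v \<bullet> f"
    using vf cmp_zero_left[of W N Z] zero_arr W N' a by simp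
  then obtain c where c: "c \<in> Arr D (shO D W) (shO D X)"
    "shM D f \<bullet> (\<ominus>\<^bsub>Hom D (shO D W) (shO D W)\<^esub> shM D (ident D W))
      = (\<ominus>\<^bsub>Hom D (shO D X) (shO D Y)\<^esub> shM D u) \<bullet> c"
    using Tri_morphism[OF Tri_rotate_left_to_right[OF Tri_ident[OF W N]] Tri_rotate_left_to_right[OF T] f,
        of "\<zero>\<^bsub>Hom D N Z\<^esub>"] zero_arr[OF N' a(3)] by blast
  obtain g where g: "g \<in> Arr D W X" "shM D g = c" using unshift_arr[OF W a(1) c(1)] .
  have sf: "shM D f \<in> Arr D (shO D W) (shO D Y)" using shM_arr W a f by blast
  have su: "shM D u \<in> Arr D (shO D X) (shO D Y)" using shM_arr a by blast
  have ug: "u \<bullet> g \<in> Arr D W Y" using cmp_arr[OF W a(1,2) g(1) a(4)] .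
  have "shM D f \<bullet> (\<ominus>\<^bsub>Hom D (shO D W) (shO D W)\<^esub> shM D (ident D W)) = \<ominus>\<^bsub>Hom D (shO D W) (shO D Y)\<^esub> shM D f"
    using cmp_neg_right[OF s[OF W] s[OF W] s[OF a(2)] ident_arr[OF s[OF W]] sf]
    by (simp add: shM_ident W cmp_ident_right[OF s[OF W] s[OF a(2)] sf])
  moreover have "(\<ominus>\<^bsub>Hom D (shO D X) (shO D Y)\<^esub> shM D u) \<bullet> c = \<ominus>\<^bsub>Hom D (shO D W) (shO D Y)\<^esub> shM D (u \<bullet> g)"
    using cmp_neg_left[OF s[OF W] s[OF a(1)] s[OF a(2)] c(1) su]
    by (simp add: shM_cmp[OF W a(1,2) g(1) a(4)] g(2))
  ultimately have "\<ominus>\<^bsub>Hom D (shO D W) (shO D Y)\<^esub> shM D f = \<ominus>\<^bsub>Hom D (shO D W) (shO D Y)\<^esub> shM D (u \<bullet> g)"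
    using c(2) by simp
  then have "shM D f = shM D (u \<bullet> g)"
    using neg_neg_arr[OF s[OF W] s[OF a(2)]] sf shM_arr[OF W a(2) ug] by metis
  then have "u \<bullet> g = f" using shM_inj[OF W a(2) ug f] by simp
  then show ?thesis using g(1) by blast
qed

text \<open>
  Dually, map the given triangle to the triangle that begins with a zero object and continues
  with the identity of \<open>W\<close>.
\<close>

lemma Tri_exact_contravariant:
  assumes T: "Tri D X Y Z u v w" and W: "W \<in> Obj D" and f: "f \<in> Arr D Y W"
    and fu: "f \<bullet> u = \<zero>\<^bsub>Hom D X W\<^esub>"
  shows "\<exists>g\<in>Arr D Z W. g \<bullet> v = f"
proof -
  have a: "X \<in> Obj D" "Y \<in> Obj D" "Z \<in> Obj D" "u \<in> Arr D X Y" "v \<in> Arr D Y Z" using Tri_arr[OF T] by auto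
  obtain N where N: "zero_object D N" using ex_zero_object by auto
  then have N': "N \<in> Obj D" by (simp add: zero_object_def)
  have "Tri D W W (shO D N) (ident D W) \<zero>\<^bsub>Hom D W (shO D N)\<^esub>
      (\<ominus>\<^bsub>Hom D (shO D N) (shO D W)\<^esub> shM D \<zero>\<^bsub>Hom D N W\<^esub>)"
    using Tri_ident[OF W zero_object_shift[OF N]]
    by (simp add: shM_zero N' W neg_zero_arr shO_obj)
  then have T': "Tri D N W W \<zero>\<^bsub>Hom D N W\<^esub> (ident D W) \<zero>\<^bsub>Hom D W (shO D N)\<^esub>"
    using Tri_rotate[OF N' W W zero_arr[OF N' W] ident_arr[OF W] zero_arr[OF W shO_obj[OF N']]] by blast
  have "f \<bullet> u = \<zero>\<^bsub>Hom D N W\<^esub> \<bullet> \<zero>\<^bsub>Hom D X N\<^esub>"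
    using fu cmp_zero_left[of X N W] zero_arr W N' a by simp
  then obtain c where "c \<in> Arr D Z W" "c \<bullet> v = ident D W \<bullet> f"
    using Tri_morphism[OF T T' zero_arr[OF a(1) N'] f] by blast
  then show ?thesis using cmp_ident_left[OF a(2) W f] by auto
qed

text \<open>
  A cone of \<open>f\<close> shifted back once. The sign of its map to \<open>C\<close> compensates the sign that rotation
  introduces.
\<close>

lemma Tri_fiber:
  assumes C: "C \<in> Obj D" and F: "F \<in> Obj D" and f: "f \<in> Arr D C F"
  obtains K k w where "Tri D K C F k f w"
proof -
  obtain Z v w where T: "Tri D C F Z f v w" using Tri_cone[OF C F f] by blast
  then have Z: "Z \<in> Obj D" "v \<in> Arr D F Z" "w \<in> Arr D Z (shO D C)" using Tri_arr by auto
  obtain K where K: "K \<in> Obj D" "shO D K = Z" using unshift_obj[OF Z(1)] .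
  obtain k where k: "k \<in> Arr D K C" "shM D k = w" using unshift_arr[OF K(1) C] K(2) Z(3) by metis
  let ?k = "\<ominus>\<^bsub>Hom D K C\<^esub> k"
  have "shM D ?k = \<ominus>\<^bsub>Hom D Z (shO D C)\<^esub> w"
    using mod_hom_minus[OF shM_linear[OF K(1) C] Hom_module[OF K(1) C]
        Hom_module[OF shO_obj[OF K(1)] shO_obj[OF C]] zero_arr[OF K(1) C] k(1)] k(2)
    by (simp add: neg_eq_zero_minus K(1) C k(1) shM_zero Z(1,3) K(2) shO_obj)
  then have "\<ominus>\<^bsub>Hom D (shO D K) (shO D C)\<^esub> shM D ?k = w"
    using K(2) by (simp add: neg_neg_arr Z shO_obj C)
  then have "Tri D K C F ?k f v"
    using Tri_rotate[OF K(1) C F neg_arr[OF K(1) C k(1)] f, of v] Z(2) T K(2) by simp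
  then show thesis by (rule that)
qed

end

section \<open>Closure properties of compact objects\<close>

lemma finitaryI:
  assumes "C \<in> Obj D"
    and "\<And>I X P \<iota> h. \<lbrakk>small I; X \<in> I \<rightarrow> Obj D; coproduct D I X P \<iota>; h \<in> Arr D C P\<rbrakk>
      \<Longrightarrow> \<exists>F. finite F \<and> F \<subseteq> I \<and> coproduct_in.part D I X P \<iota> F \<bullet>\<^bsub>D\<^esub> h = h"
  shows "finitary R small D C"
  unfolding finitary_def by (intro conjI allI impI ballI assms)

lemma finitary_obj: "finitary R small D C \<Longrightarrow> C \<in> Obj D"
  by (simp add: finitary_def)

lemma (in coproduct_in) finitaryD:
  assumes "finitary R small D C" "small I" "h \<in> Arr D C P"
  shows "\<exists>F. finite F \<and> F \<subseteq> I \<and> part F \<bullet> h = h"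
  using assms(1)[unfolded finitary_def, THEN conjunct2, rule_format, OF assms(2) _ coproduct assms(3)]
    summands by simp

context triangulated_category
begin

lemma coproduct_inI: "\<lbrakk>X \<in> I \<rightarrow> Obj D; coproduct D I X P \<iota>\<rbrakk> \<Longrightarrow> coproduct_in R D I X P \<iota>"
  by (intro coproduct_in.intro coproduct_in_axioms.intro linear_category_axioms)

text \<open>
  For a map out of the cone, first split off the part supported on the finitely many summands
  met by the restriction to the middle term; the rest factors through the shifted first term
  and hence meets finitely many summands as well.
\<close>

lemma finitary_cone:
  assumes T: "Tri D X Y Z u v w" and Y: "finitary R small D Y" and X: "finitary R small D (shO D X)"
  shows "finitary R small D Z"
proof (rule finitaryI)
  have a: "X \<in> Obj D" "Y \<in> Obj D" "Z \<in> Obj D" "u \<in> Arr D X Y" "v \<in> Arr D Y Z" "w \<in> Arr D Z (shO D X)"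
    using Tri_arr[OF T] by auto
  then show "Z \<in> Obj D" by simp
  fix I A P \<iota> h
  assume I: "small I" and "A \<in> I \<rightarrow> Obj D" "coproduct D I A P \<iota>" and h: "h \<in> Arr D Z P"
  then interpret coproduct_in R D I A P \<iota> by (intro coproduct_inI)
  note P = coproduct_obj
  have "h \<bullet> v \<in> Arr D Y P" by (rule cmp_arr[OF a(2,3) P a(5) h])
  then obtain F where F: "finite F" "F \<subseteq> I" "part F \<bullet> h \<bullet> v = h \<bullet> v" using finitaryD[OF Y I] by blast
  have ph: "part F \<bullet> h \<in> Arr D Z P" by (rule cmp_arr[OF a(3) P P h part_arr])
  let ?r = "h \<ominus>\<^bsub>Hom D Z P\<^esub> part F \<bullet> h"
  have r: "?r \<in> Arr D Z P" by (rule minus_arr[OF a(3) P h ph])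
  have "?r \<bullet> v = \<zero>\<^bsub>Hom D Y P\<^esub>"
    using cmp_minus_left[OF a(2,3) P a(5) h ph] F(3) cmp_assoc[OF a(2,3) P P a(5) h part_arr, of F]
      minus_eq_zero_arr[OF a(2) P \<open>h \<bullet> v \<in> Arr D Y P\<close> \<open>h \<bullet> v \<in> Arr D Y P\<close>] by simp
  then obtain t where t: "t \<in> Arr D (shO D X) P" "t \<bullet> w = ?r"
    using Tri_exact_contravariant[OF Tri_rotate_left_to_right[OF T] P r] by blast
  obtain F' where F': "finite F'" "F' \<subseteq> I" "part F' \<bullet> t = t" using finitaryD[OF X I t(1)] by blast
  have F'r: "part F' \<bullet> ?r = ?r"
    using cmp_assoc[OF a(3) shO_obj[OF a(1)] P P a(6) t(1) part_arr, of F'] t(2) F'(3) by simp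
  let ?G = "F \<union> F'"
  have pp: "part F \<bullet> part F \<bullet> h = part F \<bullet> h"
    using cmp_assoc[OF a(3) P P P h part_arr part_arr, of F F] part_part[of F F] by simp
  have "part ?G \<bullet> ?r = ?r" by (rule part_mono[OF _ a(3) r F'r]) simp
  moreover have "part ?G \<bullet> part F \<bullet> h = part F \<bullet> h" by (rule part_mono[OF _ a(3) ph pp]) simp
  moreover have "h = ?r \<oplus>\<^bsub>Hom D Z P\<^esub> part F \<bullet> h"
    using minus_add_cancel_arr[OF a(3) P h ph] by simp
  ultimately have "part ?G \<bullet> h = h"
    using cmp_add_right[OF a(3) P P r ph part_arr, of ?G] by simp
  then show "\<exists>F. finite F \<and> F \<subseteq> I \<and> part F \<bullet> h = h" using F(1,2) F'(1,2) by (intro exI[of _ ?G]) auto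
qed

lemma finitary_biproduct:
  assumes B: "biproduct D X Y Q i j p q" and X: "finitary R small D X" and Y: "finitary R small D Y"
  shows "finitary R small D Q"
proof (rule finitaryI)
  have a: "X \<in> Obj D" "Y \<in> Obj D" "Q \<in> Obj D" "i \<in> Arr D X Q" "j \<in> Arr D Y Q" "p \<in> Arr D Q X" "q \<in> Arr D Q Y"
    "(i \<bullet> p) \<oplus>\<^bsub>Hom D Q Q\<^esub> (j \<bullet> q) = ident D Q"
    using B finitary_obj[OF X] finitary_obj[OF Y] by (auto simp: biproduct_def)
  then show "Q \<in> Obj D" by simp
  fix I A P \<iota> h
  assume I: "small I" and "A \<in> I \<rightarrow> Obj D" "coproduct D I A P \<iota>" and h: "h \<in> Arr D Q P"
  then interpret coproduct_in R D I A P \<iota> by (intro coproduct_inI)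
  note P = coproduct_obj
  have hi: "h \<bullet> i \<in> Arr D X P" by (rule cmp_arr[OF a(1,3) P a(4) h])
  have hj: "h \<bullet> j \<in> Arr D Y P" by (rule cmp_arr[OF a(2,3) P a(5) h])
  obtain F where F: "finite F" "F \<subseteq> I" "part F \<bullet> h \<bullet> i = h \<bullet> i" using finitaryD[OF X I hi] by blast
  obtain F' where F': "finite F'" "F' \<subseteq> I" "part F' \<bullet> h \<bullet> j = h \<bullet> j" using finitaryD[OF Y I hj] by blast
  let ?G = "F \<union> F'"
  have G: "part ?G \<bullet> h \<bullet> i = h \<bullet> i" "part ?G \<bullet> h \<bullet> j = h \<bullet> j"
    using part_mono[OF _ a(1) hi F(3), of ?G] part_mono[OF _ a(2) hj F'(3), of ?G] by auto
  have ip: "i \<bullet> p \<in> Arr D Q Q" "j \<bullet> q \<in> Arr D Q Q"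
    using cmp_arr[OF a(3,1,3,6,4)] cmp_arr[OF a(3,2,3,7,5)] by auto
  have "h = h \<bullet> ident D Q" using cmp_ident_right[OF a(3) P h] by simp
  also have "\<dots> = h \<bullet> i \<bullet> p \<oplus>\<^bsub>Hom D Q P\<^esub> h \<bullet> j \<bullet> q"
    unfolding a(8)[symmetric] by (rule cmp_add_right[OF a(3,3) P ip h])
  also have "\<dots> = (h \<bullet> i) \<bullet> p \<oplus>\<^bsub>Hom D Q P\<^esub> (h \<bullet> j) \<bullet> q"
    using cmp_assoc[OF a(3,1,3) P a(6,4) h] cmp_assoc[OF a(3,2,3) P a(7,5) h] by simp
  finally have h': "h = (h \<bullet> i) \<bullet> p \<oplus>\<^bsub>Hom D Q P\<^esub> (h \<bullet> j) \<bullet> q" .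
  have "part ?G \<bullet> ((h \<bullet> i) \<bullet> p \<oplus>\<^bsub>Hom D Q P\<^esub> (h \<bullet> j) \<bullet> q)
      = part ?G \<bullet> (h \<bullet> i) \<bullet> p \<oplus>\<^bsub>Hom D Q P\<^esub> part ?G \<bullet> (h \<bullet> j) \<bullet> q"
    by (rule cmp_add_right[OF a(3) P P cmp_arr[OF a(3,1) P a(6) hi] cmp_arr[OF a(3,2) P a(7) hj] part_arr])
  also have "\<dots> = (part ?G \<bullet> h \<bullet> i) \<bullet> p \<oplus>\<^bsub>Hom D Q P\<^esub> (part ?G \<bullet> h \<bullet> j) \<bullet> q"
    using cmp_assoc[OF a(3,1) P P a(6) hi part_arr] cmp_assoc[OF a(3,2) P P a(7) hj part_arr] by simp
  also have "\<dots> = h" unfolding G h'[symmetric] ..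
  finally have "part ?G \<bullet> h = h" unfolding h'[symmetric] .
  then show "\<exists>F. finite F \<and> F \<subseteq> I \<and> part F \<bullet> h = h" using F(1,2) F'(1,2) by (intro exI[of _ ?G]) auto
qed

lemma coproduct_universal:
  assumes "coproduct D I X P \<iota>" "Y \<in> Obj D" "\<forall>i\<in>I. f i \<in> Arr D (X i) Y"
  shows "\<exists>!h. h \<in> Arr D P Y \<and> (\<forall>i\<in>I. h \<bullet> \<iota> i = f i)"
proof -
  have "\<forall>Y\<in>Obj D. \<forall>f. (\<forall>i\<in>I. f i \<in> Arr D (X i) Y) \<longrightarrow> (\<exists>!h. h \<in> Arr D P Y \<and> (\<forall>i\<in>I. h \<bullet> \<iota> i = f i))"
    using assms(1) unfolding coproduct_def by (elim conjE)
  then have "\<forall>f. (\<forall>i\<in>I. f i \<in> Arr D (X i) Y) \<longrightarrow> (\<exists>!h. h \<in> Arr D P Y \<and> (\<forall>i\<in>I. h \<bullet> \<iota> i = f i))"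
    using assms(2) by (rule bspec)
  then have "(\<forall>i\<in>I. f i \<in> Arr D (X i) Y) \<longrightarrow> ?thesis" by (rule spec)
  then show ?thesis using assms(3) by (rule mp)
qed

text \<open>
  The shift is an automorphism of the category, so it preserves and reflects universal
  properties. Families are compared on the index set only, because they are unconstrained
  outside of it.
\<close>

lemma coproduct_shift_iff:
  assumes X: "\<And>i. i \<in> I \<Longrightarrow> X i \<in> Obj D" and P: "P \<in> Obj D" and \<iota>: "\<And>i. i \<in> I \<Longrightarrow> \<iota> i \<in> Arr D (X i) P"
    and X': "\<And>i. i \<in> I \<Longrightarrow> X' i = shO D (X i)" and \<iota>': "\<And>i. i \<in> I \<Longrightarrow> \<iota>' i = shM D (\<iota> i)"
  shows "coproduct D I X' (shO D P) \<iota>' \<longleftrightarrow> coproduct D I X P \<iota>"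
proof -
  have eq: "(\<exists>!h'. h' \<in> Arr D (shO D P) (shO D Y) \<and> (\<forall>i\<in>I. h' \<bullet> \<iota>' i = shM D (f i)))
      \<longleftrightarrow> (\<exists>!h. h \<in> Arr D P Y \<and> (\<forall>i\<in>I. h \<bullet> \<iota> i = f i))" (is "?L' \<longleftrightarrow> ?L")
    if Y: "Y \<in> Obj D" and f: "\<And>i. i \<in> I \<Longrightarrow> f i \<in> Arr D (X i) Y" for Y f
  proof -
    have iff: "shM D h \<bullet> \<iota>' i = shM D (f i) \<longleftrightarrow> h \<bullet> \<iota> i = f i" if "i \<in> I" "h \<in> Arr D P Y" for i h
      using shM_cmp[OF X[OF that(1)] P Y \<iota>[OF that(1)] that(2)] \<iota>'[OF that(1)]
        shM_inj[OF X[OF that(1)] Y cmp_arr[OF X[OF that(1)] P Y \<iota>[OF that(1)] that(2)] f[OF that(1)]]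
      by auto
    have "?L' \<longleftrightarrow> (\<exists>!h'. h' \<in> shM D ` Arr D P Y \<and> (\<forall>i\<in>I. h' \<bullet> \<iota>' i = shM D (f i)))"
      using bij_betw_imp_surj_on[OF shM_bij[OF P Y]] by simp
    also have "\<dots> \<longleftrightarrow> ?L"
    proof
      assume "\<exists>!h'. h' \<in> shM D ` Arr D P Y \<and> (\<forall>i\<in>I. h' \<bullet> \<iota>' i = shM D (f i))"
      then obtain h where h: "h \<in> Arr D P Y" "\<forall>i\<in>I. shM D h \<bullet> \<iota>' i = shM D (f i)"
        and un: "\<And>g. g \<in> Arr D P Y \<Longrightarrow> \<forall>i\<in>I. shM D g \<bullet> \<iota>' i = shM D (f i) \<Longrightarrow> shM D g = shM D h"
        by blast
      show ?L
        by (rule ex1I[of _ h]) (use h un iff shM_inj[OF P Y] in blast)+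
    next
      assume ?L
      then obtain h where h: "h \<in> Arr D P Y" "\<forall>i\<in>I. h \<bullet> \<iota> i = f i"
        and un: "\<And>g. g \<in> Arr D P Y \<Longrightarrow> \<forall>i\<in>I. g \<bullet> \<iota> i = f i \<Longrightarrow> g = h" by blast
      show "\<exists>!h'. h' \<in> shM D ` Arr D P Y \<and> (\<forall>i\<in>I. h' \<bullet> \<iota>' i = shM D (f i))"
        by (rule ex1I[of _ "shM D h"]) (use h un iff in blast)+
    qed
    finally show ?thesis .
  qed
  show ?thesis
  proof
    assume L: "coproduct D I X' (shO D P) \<iota>'"
    show "coproduct D I X P \<iota>" unfolding coproduct_def
    proof (intro conjI ballI allI impI)
      fix Y f assume Y: "Y \<in> Obj D" and f: "\<forall>i\<in>I. f i \<in> Arr D (X i) Y"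
      have "\<forall>i\<in>I. shM D (f i) \<in> Arr D (X' i) (shO D Y)" using f X X' Y shM_arr by simp
      then have "\<exists>!h'. h' \<in> Arr D (shO D P) (shO D Y) \<and> (\<forall>i\<in>I. h' \<bullet> \<iota>' i = shM D (f i))"
        by (rule coproduct_universal[OF L shO_obj[OF Y]])
      then show "\<exists>!h. h \<in> Arr D P Y \<and> (\<forall>i\<in>I. h \<bullet> \<iota> i = f i)"
        using eq[OF Y, of f] f by simp
    qed (use P \<iota> in auto)
  next
    assume L: "coproduct D I X P \<iota>"
    show "coproduct D I X' (shO D P) \<iota>'" unfolding coproduct_def
    proof (intro conjI ballI allI impI)
      fix Y' f' assume Y': "Y' \<in> Obj D" and f': "\<forall>i\<in>I. f' i \<in> Arr D (X' i) Y'"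
      obtain Y where Y: "Y \<in> Obj D" "shO D Y = Y'" using unshift_obj[OF Y'] .
      have "\<forall>i\<in>I. \<exists>g. g \<in> Arr D (X i) Y \<and> shM D g = f' i"
        using f' X X' Y by (metis unshift_arr)
      then obtain f where f: "\<And>i. i \<in> I \<Longrightarrow> f i \<in> Arr D (X i) Y \<and> shM D (f i) = f' i" by metis
      have "\<exists>!h. h \<in> Arr D P Y \<and> (\<forall>i\<in>I. h \<bullet> \<iota> i = f i)"
        by (rule coproduct_universal[OF L Y(1)]) (simp add: f)
      then have "\<exists>!h'. h' \<in> Arr D (shO D P) (shO D Y) \<and> (\<forall>i\<in>I. h' \<bullet> \<iota>' i = shM D (f i))"
        using eq[OF Y(1), of f] f by simp
      then show "\<exists>!h. h \<in> Arr D (shO D P) Y' \<and> (\<forall>i\<in>I. h \<bullet> \<iota>' i = f' i)"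
        using f Y(2) by (simp cong: ball_cong)
    qed (use P \<iota> X X' \<iota>' shO_obj shM_arr in auto)
  qed
qed

lemma part_shift:
  assumes X: "X \<in> I \<rightarrow> Obj D" and X': "\<And>i. i \<in> I \<Longrightarrow> X' i = shO D (X i)"
    and \<iota>': "\<And>i. i \<in> I \<Longrightarrow> \<iota>' i = shM D (\<iota> i)"
    and cop: "coproduct D I X P \<iota>" and cop': "coproduct D I X' (shO D P) \<iota>'"
  shows "coproduct_in.part D I X' (shO D P) \<iota>' F = shM D (coproduct_in.part D I X P \<iota> F)"
proof -
  interpret A: coproduct_in R D I X P \<iota> by (rule coproduct_inI[OF X cop])
  have "X' \<in> I \<rightarrow> Obj D" using A.summand_obj X' shO_obj by auto
  then interpret B: coproduct_in R D I X' "shO D P" \<iota>' by (rule coproduct_inI[OF _ cop'])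
  show ?thesis
  proof (rule B.part_eqI)
    show "shM D (A.part F) \<in> Arr D (shO D P) (shO D P)"
      by (rule shM_arr[OF A.coproduct_obj A.coproduct_obj A.part_arr])
    fix i assume i: "i \<in> I"
    show "shM D (A.part F) \<bullet> \<iota>' i = (if i \<in> F then \<iota>' i else \<zero>\<^bsub>Hom D (X' i) (shO D P)\<^esub>)"
      unfolding X'[OF i] \<iota>'[OF i]
        shM_cmp[OF A.summand_obj[OF i] A.coproduct_obj A.coproduct_obj A.injection_arr[OF i] A.part_arr, symmetric]
        A.part_injection[OF i]
      by (simp add: shM_zero[OF A.summand_obj[OF i] A.coproduct_obj])
  qed
qed

lemma finitary_shift_iff:
  assumes C: "C \<in> Obj D" shows "finitary R small D (shO D C) \<longleftrightarrow> finitary R small D C"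
proof
  assume sC: "finitary R small D (shO D C)"
  show "finitary R small D C"
  proof (rule finitaryI[OF C])
    fix I X P \<iota> h
    assume I: "small I" and X: "X \<in> I \<rightarrow> Obj D" and cop: "coproduct D I X P \<iota>" and h: "h \<in> Arr D C P"
    then interpret coproduct_in R D I X P \<iota> by (intro coproduct_inI)
    have cop': "coproduct D I (\<lambda>i. shO D (X i)) (shO D P) (\<lambda>i. shM D (\<iota> i))"
      using cop by (subst coproduct_shift_iff) (auto simp: summand_obj coproduct_obj injection_arr)
    have sX: "(\<lambda>i. shO D (X i)) \<in> I \<rightarrow> Obj D" using summand_obj shO_obj by auto
    interpret S: coproduct_in R D I "\<lambda>i. shO D (X i)" "shO D P" "\<lambda>i. shM D (\<iota> i)"
      by (rule coproduct_inI[OF sX cop'])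
    obtain F where F: "finite F" "F \<subseteq> I" "S.part F \<bullet> shM D h = shM D h"
      using S.finitaryD[OF sC I shM_arr[OF C coproduct_obj h]] by blast
    have "shM D (part F \<bullet> h) = shM D h"
      using F(3) shM_cmp[OF C coproduct_obj coproduct_obj h part_arr]
        part_shift[OF X refl refl cop cop'] by simp
    then have "part F \<bullet> h = h"
      by (rule shM_inj[OF C coproduct_obj cmp_arr[OF C coproduct_obj coproduct_obj h part_arr] h])
    then show "\<exists>F. finite F \<and> F \<subseteq> I \<and> part F \<bullet> h = h" using F by blast
  qed
next
  assume fC: "finitary R small D C"
  show "finitary R small D (shO D C)"
  proof (rule finitaryI[OF shO_obj[OF C]])
    fix I X' P' \<iota>' h'
    assume I: "small I" and X': "X' \<in> I \<rightarrow> Obj D" and cop': "coproduct D I X' P' \<iota>'" and h': "h' \<in> Arr D (shO D C) P'"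
    interpret S: coproduct_in R D I X' P' \<iota>' by (rule coproduct_inI[OF X' cop'])
    obtain P where P: "P \<in> Obj D" "shO D P = P'" using unshift_obj[OF S.coproduct_obj] .
    have "\<forall>i\<in>I. \<exists>x. x \<in> Obj D \<and> shO D x = X' i" by (metis S.summand_obj unshift_obj)
    then obtain X where X: "\<And>i. i \<in> I \<Longrightarrow> X i \<in> Obj D \<and> shO D (X i) = X' i" by metis
    have "\<forall>i\<in>I. \<exists>g. g \<in> Arr D (X i) P \<and> shM D g = \<iota>' i"
      using X P S.injection_arr by (metis unshift_arr)
    then obtain \<iota> where \<iota>: "\<And>i. i \<in> I \<Longrightarrow> \<iota> i \<in> Arr D (X i) P \<and> shM D (\<iota> i) = \<iota>' i" by metis
    have cop: "coproduct D I X P \<iota>"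
      using coproduct_shift_iff[of I X P \<iota> X' \<iota>'] X P \<iota> cop' by simp
    have Xf: "X \<in> I \<rightarrow> Obj D" using X by auto
    interpret coproduct_in R D I X P \<iota> by (rule coproduct_inI[OF Xf cop])
    obtain h where h: "h \<in> Arr D C P" "shM D h = h'" using unshift_arr[OF C P(1)] h' P(2) by metis
    obtain F where F: "finite F" "F \<subseteq> I" "part F \<bullet> h = h" using finitaryD[OF fC I h(1)] by blast
    have "coproduct_in.part D I X' (shO D P) \<iota>' F = shM D (part F)"
      by (rule part_shift[OF Xf _ _ cop]) (use X \<iota> cop' P(2) in auto)
    then have "S.part F \<bullet> h' = h'"
      using F(3) shM_cmp[OF C P(1) P(1) h(1) part_arr, of F] h(2) P(2) by simp
    then show "\<exists>F. finite F \<and> F \<subseteq> I \<and> S.part F \<bullet> h' = h'" using F by blast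
  qed
qed

text \<open>
  The shift of \<open>K\<close> is the cone in the rotated triangle \<open>C \<rightarrow> F \<rightarrow> K[1]\<close>.
\<close>

lemma finitary_fiber:
  assumes T: "Tri D K C F k f w" and C: "finitary R small D C" and F: "finitary R small D F"
  shows "finitary R small D K"
proof -
  have K: "K \<in> Obj D" using Tri_arr[OF T] by simp
  have "finitary R small D (shO D K)"
    by (rule finitary_cone[OF Tri_rotate_left_to_right[OF T] F])
      (use C finitary_shift_iff finitary_obj[OF C] in blast)
  then show ?thesis using finitary_shift_iff[OF K] by blast
qed

end

section \<open>Small families and shifts of the generator\<close>

lemma (in smallness) small_countable_Union:
  assumes "\<And>n :: nat. small (A n)"
  shows "small (\<Union>n. A n)"
proof -
  obtain N where N: "small N" "infinite N" using small_infinite by auto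
  obtain e where e: "inj (e :: nat \<Rightarrow> _)" "range e \<subseteq> N"
    using infinite_countable_subset[OF N(2)] by auto
  have "small (\<Union>a\<in>N. A (inv_into UNIV e a))" by (rule small_Union[OF N(1)]) (rule assms)
  moreover have "(\<Union>n. A n) \<subseteq> (\<Union>a\<in>N. A (inv_into UNIV e a))"
  proof
    fix x assume "x \<in> (\<Union>n. A n)"
    then obtain n where "x \<in> A n" by auto
    then have "x \<in> A (inv_into UNIV e (e n))" using e(1) by simp
    then show "x \<in> (\<Union>a\<in>N. A (inv_into UNIV e a))" using e(2) by blast
  qed
  ultimately show ?thesis using small_lepoll subset_imp_lepoll by blast
qed

text \<open>
  All bounds embed in one infinite small set \<open>U\<close>, and a countable union of sets no larger than an
  infinite \<open>U\<close> is no larger than \<open>U\<close>.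
\<close>

lemma (in smallness) lepoll_small_countable_Union:
  fixes B :: "nat \<Rightarrow> 'b set"
  assumes "\<And>n. \<exists>A. small A \<and> B n \<lesssim> A"
  shows "\<exists>A. small A \<and> (\<Union>n. B n) \<lesssim> A"
proof -
  obtain N where N: "small N" "infinite N" using small_infinite by auto
  obtain A where A: "\<And>n. small (A n) \<and> B n \<lesssim> A n" using assms by metis
  define U where "U = (\<Union>n. case n of 0 \<Rightarrow> N | Suc n \<Rightarrow> A n)"
  have U: "small U" unfolding U_def
    by (rule small_countable_Union) (use N A in \<open>simp split: nat.split\<close>)
  have NU: "N \<subseteq> U" and AU: "A n \<subseteq> U" for n unfolding U_def by (force split: nat.splits)+
  have inf: "infinite U" using NU N(2) finite_subset by blast
  have "B n \<lesssim> U" for n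
    using lepoll_trans[OF _ subset_imp_lepoll[OF AU]] A by blast
  then have "\<forall>n\<in>UNIV. (card_of (B n), card_of U) \<in> ordLeq" unfolding lepoll_def card_of_ordLeq[symmetric] by blast
  moreover have "(card_of (UNIV :: nat set), card_of U) \<in> ordLeq" using inf infinite_iff_card_of_nat by blast
  ultimately have "(card_of (\<Union>n. B n), card_of U) \<in> ordLeq" using card_of_UNION_ordLeq_infinite[OF inf] by blast
  then have "(\<Union>n. B n) \<lesssim> U" unfolding lepoll_def card_of_ordLeq[symmetric] .
  then show ?thesis using U by blast
qed

text \<open>
  Coproducts and compactness are tested on small subsets of a fixed index type. The tower below
  uses coproducts indexed by arrows and by natural numbers, so both are carried over to
  any index set of small cardinality.
\<close>

lemma (in triangulated_category) coproduct_any_index: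
  fixes J :: "'j set" and small :: "'i set \<Rightarrow> bool"
  assumes sm: "smallness small" and cop: "has_coproducts small D" and A: "small A" "J \<lesssim> A"
    and X: "X \<in> J \<rightarrow> Obj D"
  shows "\<exists>P \<iota>. coproduct D J X P \<iota> \<and> (\<forall>C h. finitary R small D C \<longrightarrow> h \<in> Arr D C P
    \<longrightarrow> (\<exists>F. finite F \<and> F \<subseteq> J \<and> coproduct_in.part D J X P \<iota> F \<bullet> h = h))"
proof -
  obtain e where e: "inj_on e J" "e ` J \<subseteq> A" using A(2) by (auto simp: lepoll_def)
  let ?I = "e ` J" and ?e = "inv_into J e"
  have ee: "?e (e j) = j" if "j \<in> J" for j using e(1) that by simp
  have I: "small ?I" using smallness.small_lepoll[OF sm A(1)] e(2) subset_imp_lepoll by blast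
  have X': "(\<lambda>i. X (?e i)) \<in> ?I \<rightarrow> Obj D" using X ee by auto
  then obtain P \<iota> where P: "coproduct D ?I (\<lambda>i. X (?e i)) P \<iota>"
    using cop I unfolding has_coproducts_def by blast
  interpret S: coproduct_in R D ?I "\<lambda>i. X (?e i)" P \<iota> by (rule coproduct_inI[OF X' P])
  have c: "coproduct D J X P (\<lambda>j. \<iota> (e j))"
    unfolding coproduct_def
  proof (intro conjI ballI allI impI)
    show "P \<in> Obj D" by (rule S.coproduct_obj)
    show "\<iota> (e j) \<in> Arr D (X j) P" if "j \<in> J" for j using S.injection_arr[of "e j"] ee that by simp
    fix Y f assume Y: "Y \<in> Obj D" and f: "\<forall>j\<in>J. f j \<in> Arr D (X j) Y"
    have "\<exists>!h. h \<in> Arr D P Y \<and> (\<forall>i\<in>?I. h \<bullet> \<iota> i = f (?e i))"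
      by (rule S.coproduct_ex1[OF Y]) (use f ee in auto)
    then show "\<exists>!h. h \<in> Arr D P Y \<and> (\<forall>j\<in>J. h \<bullet> \<iota> (e j) = f j)"
      using ee by (simp cong: ball_cong)
  qed
  interpret T: coproduct_in R D J X P "\<lambda>j. \<iota> (e j)" by (rule coproduct_inI[OF X c])
  show ?thesis
  proof (rule exI[of _ P], rule exI[of _ "\<lambda>j. \<iota> (e j)"], rule conjI[OF c], intro allI impI)
    fix C h assume C: "finitary R small D C" and h: "h \<in> Arr D C P"
    obtain F where F: "finite F" "F \<subseteq> ?I" "S.part F \<bullet> h = h" using S.finitaryD[OF C I h] by blast
    have "T.part (?e ` F) = S.part F"
    proof (rule T.part_eqI[OF S.part_arr])
      fix j assume j: "j \<in> J"
      have "e j \<in> F \<longleftrightarrow> j \<in> ?e ` F"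
      proof
        show "e j \<in> F \<Longrightarrow> j \<in> ?e ` F" using ee[OF j] by (metis image_eqI)
        show "j \<in> ?e ` F \<Longrightarrow> e j \<in> F" using F(2) by (metis f_inv_into_f imageE subsetD)
      qed
      then show "S.part F \<bullet> \<iota> (e j) = (if j \<in> ?e ` F then \<iota> (e j) else \<zero>\<^bsub>Hom D (X j) P\<^esub>)"
        using S.part_injection[of "e j" F] j ee by simp
    qed
    moreover have "finite (?e ` F)" "?e ` F \<subseteq> J" using F(1,2) ee by auto
    ultimately show "\<exists>F. finite F \<and> F \<subseteq> J \<and> T.part F \<bullet> h = h" using F(3) by metis
  qed
qed

locale compactly_generated = triangulated_category R D + smallness small
  for R :: "('r, 'x) ring_scheme" and D :: "('r, 'o, 'm, 'y) tricat_scheme" (structure)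
    and small :: "'i set \<Rightarrow> bool" +
  fixes G :: 'o
  assumes locally_small: "locally_small small D" and coproducts: "has_coproducts small D"
    and generator: "compact_generator small D G"

lemma (in triangulated_category) inv_shO: 
  assumes "X \<in> Obj D"
  shows "inv_into (Obj D) (shO D) X \<in> Obj D" "shO D (inv_into (Obj D) (shO D) X) = X"
proof -
  have "X \<in> shO D ` Obj D" using bij_betw_imp_surj_on[OF shO_bij] assms by simp
  then show "inv_into (Obj D) (shO D) X \<in> Obj D" "shO D (inv_into (Obj D) (shO D) X) = X"
    by (rule inv_into_into, rule f_inv_into_f)
qed

lemma (in triangulated_category) shift_obj:
  assumes X: "X \<in> Obj D" shows "shift D n X \<in> Obj D"
proof -
  have 1: "(shO D ^^ k) X \<in> Obj D" for k by (induction k) (auto simp: X shO_obj)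
  have 2: "(inv_into (Obj D) (shO D) ^^ k) X \<in> Obj D" for k by (induction k) (auto simp: X inv_shO)
  show ?thesis using 1 2 by (simp add: shift_def)
qed

lemma (in triangulated_category) shO_shift:
  assumes X: "X \<in> Obj D" shows "shO D (shift D n X) = shift D (n + 1) X"
proof (cases "0 \<le> n")
  case True
  then have "nat (n + 1) = Suc (nat n)" by simp
  then show ?thesis using True by (simp add: shift_def)
next
  case False
  define k where "k = nat (- n - 1)"
  have n: "n = - int (Suc k)" using False by (simp add: k_def)
  have o: "(inv_into (Obj D) (shO D) ^^ k) X \<in> Obj D" by (induction k) (auto simp: X inv_shO)
  have "shift D n X = inv_into (Obj D) (shO D) ((inv_into (Obj D) (shO D) ^^ k) X)"
    unfolding n by (simp add: shift_def nat_add_distrib)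
  moreover have "shift D (n + 1) X = (inv_into (Obj D) (shO D) ^^ k) X"
    unfolding n by (cases k) (simp_all add: shift_def nat_add_distrib)
  ultimately show ?thesis using inv_shO(2)[OF o] by simp
qed

lemma (in triangulated_category) finitary_shift:
  assumes X: "finitary R small D X" shows "finitary R small D (shift D n X)"
proof -
  note o = finitary_obj[OF X]
  have step: "finitary R small D (shift D (n + 1) X) \<longleftrightarrow> finitary R small D (shift D n X)" for n
    unfolding shO_shift[OF o, symmetric] by (rule finitary_shift_iff[OF shift_obj[OF o]])
  show ?thesis
  proof (induction n rule: int_induct[where k = 0])
    case base
    show ?case using X by (simp add: shift_def)
  next
    case (step1 i)
    then show ?case using step by blast
  next
    case (step2 i)
    then show ?case using step[of "i - 1"] by simp
  qed
qed

context compactly_generated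
begin

lemma generator_finitary: "finitary R small D (shift D n G)"
proof (rule finitary_shift)
  show "finitary R small D G"
    using generator compact_objects_eq_finitary[of small] unfolding compact_generator_def by simp
qed

lemma generator_obj: "shift D n G \<in> Obj D"
  by (rule finitary_obj[OF generator_finitary])

lemma generator_detects:
  assumes "X \<in> Obj D" "\<And>n f. f \<in> Arr D (shift D n G) X \<Longrightarrow> f = \<zero>\<^bsub>Hom D (shift D n G) X\<^esub>"
  shows "zero_object D X"
proof -
  have "Arr D (shift D n G) X = {\<zero>\<^bsub>Hom D (shift D n G) X\<^esub>}" for n
    using assms(2) zero_arr[OF generator_obj assms(1)] by blast
  then show ?thesis using generator assms(1) unfolding compact_generator_def by simp
qed

lemma generator_maps_small:
  assumes X: "X \<in> Obj D" shows "\<exists>A. small A \<and> (\<Union>n. Arr D (shift D n G) X) \<lesssim> A"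
proof -
  have "\<exists>A. small A \<and> Arr D (shift D (int_decode k) G) X \<lesssim> A" for k
    using locally_small generator_obj X unfolding locally_small_def by simp
  then obtain A where A: "small A" "(\<Union>k. Arr D (shift D (int_decode k) G) X) \<lesssim> A"
    using lepoll_small_countable_Union[of "\<lambda>k. Arr D (shift D (int_decode k) G) X"] by auto
  have "(\<Union>n. Arr D (shift D n G) X) = (\<Union>k. Arr D (shift D (int_decode k) G) X)"
  proof
    show "(\<Union>n. Arr D (shift D n G) X) \<subseteq> (\<Union>k. Arr D (shift D (int_decode k) G) X)"
    proof
      fix f assume "f \<in> (\<Union>n. Arr D (shift D n G) X)"
      then obtain n where "f \<in> Arr D (shift D n G) X" by auto
      then have "f \<in> Arr D (shift D (int_decode (int_encode n)) G) X" by simp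
      then show "f \<in> (\<Union>k. Arr D (shift D (int_decode k) G) X)" by blast
    qed
  qed auto
  then show ?thesis using A by auto
qed

end

section \<open>Compact objects lie in the thick closure of the generator\<close>

text \<open>
  A map whose cone lies in \<open>T\<close> is an isomorphism up to \<open>T\<close>; the octahedral axiom composes such
  maps.
\<close>

definition cone_in ::
  "('o \<Rightarrow> bool) \<Rightarrow> ('r, 'o, 'm, 'y) tricat_scheme \<Rightarrow> 'o \<Rightarrow> 'o \<Rightarrow> 'm \<Rightarrow> bool"
  where "cone_in T D K C k \<longleftrightarrow> (\<exists>Z v w. Tri D K C Z k v w \<and> T Z)"

lemma (in triangulated_category) cone_in_arr:
  assumes "cone_in T D K C k" shows "K \<in> Obj D" "C \<in> Obj D" "k \<in> Arr D K C"
  using assms Tri_arr unfolding cone_in_def by auto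

locale thick_predicate = triangulated_category R D
  for R :: "('r, 'x) ring_scheme" and D :: "('r, 'o, 'm, 'y) tricat_scheme" (structure) +
  fixes T :: "'o \<Rightarrow> bool"
  assumes T_extension: "\<lbrakk>Tri D X Y Z u v w; T X; T Z\<rbrakk> \<Longrightarrow> T Y"
    and T_retract: "\<lbrakk>X \<in> Obj D; Y \<in> Obj D; s \<in> Arr D X Y; r \<in> Arr D Y X; r \<bullet> s = ident D X; T Y\<rbrakk> \<Longrightarrow> T X"
    and T_inhabited: "\<exists>X\<in>Obj D. T X"
begin

text \<open>
  A zero object is a retract of every object.
\<close>

lemma T_zero_object:
  assumes N: "zero_object D N" shows "T N"
proof -
  obtain X where X: "X \<in> Obj D" "T X" using T_inhabited by auto
  have N': "N \<in> Obj D" using N by (simp add: zero_object_def)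
  have "\<zero>\<^bsub>Hom D X N\<^esub> \<bullet> \<zero>\<^bsub>Hom D N X\<^esub> = ident D N"
    using cmp_zero_left[OF N' X(1) N' zero_arr[OF N' X(1)]] zero_object_iff[OF N'] N by simp
  from T_retract[OF N' X(1) zero_arr[OF N' X(1)] zero_arr[OF X(1) N'] this X(2)] show ?thesis .
qed

lemma cone_in_ident:
  assumes "K \<in> Obj D" shows "cone_in T D K K (ident D K)"
  using ex_zero_object Tri_ident[OF assms] T_zero_object unfolding cone_in_def by blast

lemma cone_in_cmp:
  assumes k': "cone_in T D K' K k'" and k: "cone_in T D K C k"
  shows "cone_in T D K' C (k \<bullet> k')"
proof -
  obtain Z' j l where 1: "Tri D K' K Z' k' j l" "T Z'" using k' unfolding cone_in_def by blast
  obtain X' m n where 2: "Tri D K C X' k m n" "T X'" using k unfolding cone_in_def by blast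
  have o: "K' \<in> Obj D" "K \<in> Obj D" "C \<in> Obj D" "k' \<in> Arr D K' K" "k \<in> Arr D K C"
    using cone_in_arr[OF k'] cone_in_arr[OF k] by auto
  obtain Y' p q where 3: "Tri D K' C Y' (k \<bullet> k') p q"
    using Tri_cone[OF o(1,3) cmp_arr[OF o(1,2,3,4,5)]] by blast
  obtain f g where "Tri D Z' Y' X' f g (shM D j \<bullet> n)"
    using Tri_octahedral[OF 1(1) 2(1) 3] by blast
  then have "T Y'" using T_extension 1(2) 2(2) by blast
  then show ?thesis using 3 unfolding cone_in_def by blast
qed

text \<open>
  The identity of \<open>C\<close> vanishes on \<open>K\<close>, hence extends over the cone of the zero map. So \<open>C\<close> is a
  retract of that cone.
\<close>

lemma T_of_zero_cone_in:
  assumes "cone_in T D K C \<zero>\<^bsub>Hom D K C\<^esub>" shows "T C"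
proof -
  obtain Z v w where Z: "Tri D K C Z \<zero>\<^bsub>Hom D K C\<^esub> v w" "T Z" using assms unfolding cone_in_def by blast
  then have o: "K \<in> Obj D" "C \<in> Obj D" "Z \<in> Obj D" "v \<in> Arr D C Z" using Tri_arr by auto
  have "ident D C \<bullet> \<zero>\<^bsub>Hom D K C\<^esub> = \<zero>\<^bsub>Hom D K C\<^esub>"
    by (rule cmp_zero_right[OF o(1,2,2) ident_arr[OF o(2)]])
  then obtain r where r: "r \<in> Arr D Z C" "r \<bullet> v = ident D C"
    using Tri_exact_contravariant[OF Z(1) o(2) ident_arr[OF o(2)]] by blast
  from T_retract[OF o(2,3,4) r Z(2)] show ?thesis .
qed

text \<open>
  The finitely many components of \<open>h\<close> are killed one after the other, each by passing to the fiber
  of a map to a summand. Every step enlarges the cone by one summand and keeps the source compact.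
\<close>

lemma kill_finite_part:
  fixes small :: "'i set \<Rightarrow> bool"
  assumes cop: "coproduct_in R D J X P \<iota>" and X: "\<And>j. j \<in> J \<Longrightarrow> finitary R small D (X j) \<and> T (X j)"
    and K: "finitary R small D K" and h: "h \<in> Arr D K P" and F: "finite F" "F \<subseteq> J"
  shows "\<exists>K' k. finitary R small D K' \<and> cone_in T D K' K k \<and>
    (coproduct_in.part D J X P \<iota> F \<bullet> h) \<bullet> k = \<zero>\<^bsub>Hom D K' P\<^esub>"
  using F
proof (induction F rule: finite_induct)
  interpret coproduct_in R D J X P \<iota> by (rule cop)
  note P = coproduct_obj
  have oK: "K \<in> Obj D" by (rule finitary_obj[OF K])
  {
    case empty
    show ?case
    proof (intro exI conjI)
      show "finitary R small D K" by (rule K)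
      show "cone_in T D K K (ident D K)" by (rule cone_in_ident[OF oK])
      have z: "part {} \<bullet> h = \<zero>\<^bsub>Hom D K P\<^esub>" unfolding part_empty by (rule cmp_zero_left[OF oK P P h])
      show "(part {} \<bullet> h) \<bullet> ident D K = \<zero>\<^bsub>Hom D K P\<^esub>"
        unfolding z by (rule cmp_ident_right[OF oK P zero_arr[OF oK P]])
    qed
  next
    case (insert j F)
    then obtain K' k where K': "finitary R small D K'" "cone_in T D K' K k"
      "(part F \<bullet> h) \<bullet> k = \<zero>\<^bsub>Hom D K' P\<^esub>" by auto
    have j: "j \<in> J" "j \<notin> F" using insert by auto
    have oK': "K' \<in> Obj D" and k: "k \<in> Arr D K' K" using cone_in_arr[OF K'(2)] by auto
    have oX: "X j \<in> Obj D" by (rule summand_obj[OF j(1)])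
    have hk: "h \<bullet> k \<in> Arr D K' P" by (rule cmp_arr[OF oK' oK P k h])
    have phk: "proj j \<bullet> h \<bullet> k \<in> Arr D K' (X j)" by (rule cmp_arr[OF oK' P oX hk proj_arr[OF j(1)]])
    obtain K'' k' w where T': "Tri D K'' K' (X j) k' (proj j \<bullet> h \<bullet> k) w" using Tri_fiber[OF oK' oX phk] .
    have K'': "finitary R small D K''" by (rule finitary_fiber[OF T' K'(1)]) (use X j in blast)
    have cone': "cone_in T D K'' K' k'" unfolding cone_in_def using T' X j by blast
    have oK'': "K'' \<in> Obj D" and k': "k' \<in> Arr D K'' K'" using cone_in_arr[OF cone'] by auto
    have ip: "\<iota> j \<bullet> proj j \<in> Arr D P P" by (rule cmp_arr[OF P oX P proj_arr[OF j(1)] injection_arr[OF j(1)]])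
    have p2: "part (insert j F) \<bullet> h \<in> Arr D K P" by (rule cmp_arr[OF oK P P h part_arr])
    have "(part (insert j F) \<bullet> h) \<bullet> k = part (insert j F) \<bullet> h \<bullet> k"
      by (rule cmp_assoc[OF oK' oK P P k h part_arr])
    also have "\<dots> = (\<iota> j \<bullet> proj j) \<bullet> h \<bullet> k \<oplus>\<^bsub>Hom D K' P\<^esub> part F \<bullet> h \<bullet> k"
      unfolding part_insert[OF j] by (rule cmp_add_left[OF oK' P P hk ip part_arr])
    also have "part F \<bullet> h \<bullet> k = \<zero>\<^bsub>Hom D K' P\<^esub>"
      using K'(3) cmp_assoc[OF oK' oK P P k h part_arr] by simp
    also have "(\<iota> j \<bullet> proj j) \<bullet> h \<bullet> k = \<iota> j \<bullet> proj j \<bullet> h \<bullet> k"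
      by (rule cmp_assoc[OF oK' P oX P hk proj_arr[OF j(1)] injection_arr[OF j(1)]])
    also have "\<iota> j \<bullet> (proj j \<bullet> h \<bullet> k) \<oplus>\<^bsub>Hom D K' P\<^esub> \<zero>\<^bsub>Hom D K' P\<^esub> = \<iota> j \<bullet> proj j \<bullet> h \<bullet> k"
      by (rule add_zero_arr[OF oK' P cmp_arr[OF oK' oX P phk injection_arr[OF j(1)]]])
    finally have e: "(part (insert j F) \<bullet> h) \<bullet> k = \<iota> j \<bullet> proj j \<bullet> h \<bullet> k" .
    show ?case
    proof (intro exI conjI)
      show "finitary R small D K''" by (rule K'')
      show "cone_in T D K'' K (k \<bullet> k')" by (rule cone_in_cmp[OF cone' K'(2)])
      have "(part (insert j F) \<bullet> h) \<bullet> k \<bullet> k' = ((part (insert j F) \<bullet> h) \<bullet> k) \<bullet> k'"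
        by (rule cmp_assoc[OF oK'' oK' oK P k' k p2, symmetric])
      also have "\<dots> = \<iota> j \<bullet> (proj j \<bullet> h \<bullet> k) \<bullet> k'"
        unfolding e by (rule cmp_assoc[OF oK'' oK' oX P k' phk injection_arr[OF j(1)]])
      also have "\<dots> = \<zero>\<^bsub>Hom D K'' P\<^esub>"
        unfolding Tri_cmp_zero[OF T'] by (rule cmp_zero_right[OF oK'' oX P injection_arr[OF j(1)]])
      finally show "(part (insert j F) \<bullet> h) \<bullet> k \<bullet> k' = \<zero>\<^bsub>Hom D K'' P\<^esub>" .
    qed
  }
qed

end

context compactly_generated
begin

text \<open>
  One stage of a tower. The map \<open>g\<close> annihilates all maps from shifts of the generator, at a price
  that compact objects can pay: a map from a compact object that dies under \<open>g\<close> is already zero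
  after precomposition with some \<open>K' \<rightarrow> K\<close> with compact source and cone in \<open>T\<close>.
\<close>

definition kills_generator_maps :: "('o \<Rightarrow> bool) \<Rightarrow> 'o \<Rightarrow> 'o \<Rightarrow> 'm \<Rightarrow> bool"
  where "kills_generator_maps T X X' g \<longleftrightarrow> X' \<in> Obj D \<and> g \<in> Arr D X X' \<and>
    (\<forall>n. \<forall>f\<in>Arr D (shift D n G) X. g \<bullet> f = \<zero>\<^bsub>Hom D (shift D n G) X'\<^esub>) \<and>
    (\<forall>K x. finitary R small D K \<longrightarrow> x \<in> Arr D K X \<longrightarrow> g \<bullet> x = \<zero>\<^bsub>Hom D K X'\<^esub> \<longrightarrow>
      (\<exists>K' k. finitary R small D K' \<and> cone_in T D K' K k \<and> x \<bullet> k = \<zero>\<^bsub>Hom D K' X\<^esub>))"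

text \<open>
  Take for \<open>g\<close> the map to the cone of the evaluation \<open>q\<close> from the coproduct of the sources of all maps
  \<open>G[n] \<rightarrow> X\<close>, indexed by these maps. A map killed by \<open>g\<close> lifts along \<open>q\<close>, and if its source is
  compact the lift has only finitely many components.
\<close>

lemma ex_kills_generator_maps:
  assumes T: "thick_predicate R D T" and TG: "\<And>n. T (shift D n G)" and X: "X \<in> Obj D"
  shows "\<exists>X' g. kills_generator_maps T X X' g"
proof -
  interpret T: thick_predicate R D T by (rule T)
  let ?J = "\<Union>n. Arr D (shift D n G) X"
  have "\<forall>f\<in>?J. \<exists>A. A \<in> range (\<lambda>n. shift D n G) \<and> f \<in> Arr D A X" by blast
  then obtain A where A: "\<And>f. f \<in> ?J \<Longrightarrow> A f \<in> range (\<lambda>n. shift D n G) \<and> f \<in> Arr D (A f) X" by metis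
  have AO: "A f \<in> Obj D" if "f \<in> ?J" for f using A[OF that] generator_obj by auto
  then have Af: "A \<in> ?J \<rightarrow> Obj D" by blast
  obtain S where S: "small S" "?J \<lesssim> S" using generator_maps_small[OF X] by blast
  obtain P \<iota> where P: "coproduct D ?J A P \<iota>"
    and fin: "\<And>C h. \<lbrakk>finitary R small D C; h \<in> Arr D C P\<rbrakk>
      \<Longrightarrow> \<exists>F. finite F \<and> F \<subseteq> ?J \<and> coproduct_in.part D ?J A P \<iota> F \<bullet> h = h"
    using coproduct_any_index[OF smallness_axioms coproducts S Af] by (elim exE conjE) simp
  interpret coproduct_in R D ?J A P \<iota> by (rule coproduct_inI[OF Af P])
  note oP = coproduct_obj
  have "\<exists>!q. q \<in> Arr D P X \<and> (\<forall>f\<in>?J. q \<bullet> \<iota> f = f)"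
    by (rule coproduct_ex1[OF X]) (rule A[THEN conjunct2])
  from ex1_implies_ex[OF this] obtain q where Q: "q \<in> Arr D P X \<and> (\<forall>f\<in>?J. q \<bullet> \<iota> f = f)" ..
  note q = Q[THEN conjunct1] bspec[OF Q[THEN conjunct2]]
  obtain X' g r where Tr: "Tri D P X X' q g r" using Tri_cone[OF oP X q(1)] by blast
  then have X': "X' \<in> Obj D" and g: "g \<in> Arr D X X'" using Tri_arr by auto
  have "kills_generator_maps T X X' g"
    unfolding kills_generator_maps_def
  proof (intro conjI[OF X'] conjI[OF g] conjI allI ballI impI)
    fix n f assume f: "f \<in> Arr D (shift D n G) X"
    then have fJ: "f \<in> ?J" by blast
    have Aeq: "A f = shift D n G"
      using Arr_unique[OF AO[OF fJ] X generator_obj[of n] X] A[OF fJ] f by blast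
    have i: "\<iota> f \<in> Arr D (A f) P" by (rule injection_arr[OF fJ])
    have "g \<bullet> f = (g \<bullet> q) \<bullet> \<iota> f"
      using cmp_assoc[OF AO[OF fJ] oP X X' i q(1) g] q(2)[OF fJ] by simp
    also have "\<dots> = \<zero>\<^bsub>Hom D (A f) X'\<^esub>"
      unfolding Tri_cmp_zero[OF Tr] by (rule cmp_zero_left[OF AO[OF fJ] oP X' i])
    finally show "g \<bullet> f = \<zero>\<^bsub>Hom D (shift D n G) X'\<^esub>" unfolding Aeq .
  next
    fix K x assume K: "finitary R small D K" and x: "x \<in> Arr D K X" and gx: "g \<bullet> x = \<zero>\<^bsub>Hom D K X'\<^esub>"
    have oK: "K \<in> Obj D" by (rule finitary_obj[OF K])
    obtain h where h: "h \<in> Arr D K P" "q \<bullet> h = x" using Tri_exact_covariant[OF Tr oK x gx] by blast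
    obtain F where F: "finite F" "F \<subseteq> ?J" "part F \<bullet> h = h" using fin[OF K h(1)] by blast
    have sum: "finitary R small D (A f) \<and> T (A f)" if "f \<in> ?J" for f
      using A[OF that] generator_finitary TG by auto
    obtain K' k where K': "finitary R small D K'" "cone_in T D K' K k" "(part F \<bullet> h) \<bullet> k = \<zero>\<^bsub>Hom D K' P\<^esub>"
      using T.kill_finite_part[OF coproduct_in_axioms sum K h(1) F(1,2)] by blast
    have o: "K' \<in> Obj D" "k \<in> Arr D K' K" using cone_in_arr[OF K'(2)] by auto
    have "x \<bullet> k = q \<bullet> h \<bullet> k" using cmp_assoc[OF o(1) oK oP X o(2) h(1) q(1)] h(2) by simp
    also have "\<dots> = \<zero>\<^bsub>Hom D K' X\<^esub>"
      using K'(3) F(3) cmp_zero_right[OF o(1) oP X q(1)] by simp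
    finally show "\<exists>K' k. finitary R small D K' \<and> cone_in T D K' K k \<and> x \<bullet> k = \<zero>\<^bsub>Hom D K' X\<^esub>"
      using K'(1,2) by blast
  qed
  then show ?thesis by blast
qed

text \<open>
  Let \<open>s\<close> be the endomorphism of the coproduct \<open>P\<close> of the tower induced by the transition maps. It
  annihilates every map from a shift of the generator, so \<open>1 - s\<close> acts on these maps, in all degrees, as the
  identity. Hence the cone of \<open>1 - s\<close>, the homotopy colimit of the tower, receives only zero maps from shifts of the
  generator and is zero. Now the inclusion of \<open>X 0\<close> lifts along \<open>1 - s\<close>. Comparing components, those
  of the lift are forced to be the composites \<open>X 0 \<rightarrow> X n\<close> along the tower; as \<open>X 0\<close> is
  compact, almost all of them vanish.
\<close>

lemma tower_vanishes:
  fixes X :: "nat \<Rightarrow> 'o"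
  assumes X: "\<And>n. X n \<in> Obj D" and g: "\<And>n. g n \<in> Arr D (X n) (X (Suc n))"
    and kill: "\<And>n m f. f \<in> Arr D (shift D m G) (X n) \<Longrightarrow> g n \<bullet> f = \<zero>\<^bsub>Hom D (shift D m G) (X (Suc n))\<^esub>"
    and C: "finitary R small D (X 0)"
    and p0: "p 0 = ident D (X 0)" and pSuc: "\<And>n. p (Suc n) = g n \<bullet> p n"
  shows "\<exists>n. p n = \<zero>\<^bsub>Hom D (X 0) (X n)\<^esub>"
proof -
  obtain S where S: "small S" "(UNIV :: nat set) \<lesssim> S"
    using small_infinite infinite_countable_subset unfolding lepoll_def by (metis subset_UNIV)
  have XU: "X \<in> UNIV \<rightarrow> Obj D" using X by auto
  obtain P \<iota> where P: "coproduct D UNIV X P \<iota>"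
    and fin: "\<And>C h. \<lbrakk>finitary R small D C; h \<in> Arr D C P\<rbrakk>
      \<Longrightarrow> \<exists>F. finite F \<and> F \<subseteq> UNIV \<and> coproduct_in.part D UNIV X P \<iota> F \<bullet> h = h"
    using coproduct_any_index[OF smallness_axioms coproducts S XU] by (elim exE conjE) simp
  interpret coproduct_in R D UNIV X P \<iota> by (rule coproduct_inI[OF XU P])
  note oP = coproduct_obj and i = injection_arr[OF UNIV_I] and pr = proj_arr[OF UNIV_I]
  have ig: "\<iota> (Suc n) \<bullet> g n \<in> Arr D (X n) P" for n by (rule cmp_arr[OF X X oP g i])
  have "\<exists>!s. s \<in> Arr D P P \<and> (\<forall>n\<in>UNIV. s \<bullet> \<iota> n = \<iota> (Suc n) \<bullet> g n)"
    by (rule coproduct_ex1[OF oP]) (rule ig)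
  from ex1_implies_ex[OF this]
  obtain s where "s \<in> Arr D P P \<and> (\<forall>n\<in>UNIV. s \<bullet> \<iota> n = \<iota> (Suc n) \<bullet> g n)" ..
  then have s: "s \<in> Arr D P P" "\<And>n. s \<bullet> \<iota> n = \<iota> (Suc n) \<bullet> g n" by simp_all
  have ps0: "proj 0 \<bullet> s = \<zero>\<^bsub>Hom D P (X 0)\<^esub>"
  proof (rule coproduct_arr_eqI[OF X cmp_arr[OF oP oP X s(1) pr] zero_arr[OF oP X]])
    fix n
    have "(proj 0 \<bullet> s) \<bullet> \<iota> n = proj 0 \<bullet> \<iota> (Suc n) \<bullet> g n"
      using cmp_assoc[OF X oP oP X i s(1) pr] s(2) by simp
    also have "\<dots> = (proj 0 \<bullet> \<iota> (Suc n)) \<bullet> g n" by (rule cmp_assoc[OF X X oP X g i pr, symmetric])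
    also have "\<dots> = \<zero>\<^bsub>Hom D (X n) (X 0)\<^esub>"
      using proj_injection[of 0 "Suc n"] cmp_zero_left[OF X X X g] by simp
    also have "\<dots> = \<zero>\<^bsub>Hom D P (X 0)\<^esub> \<bullet> \<iota> n" by (rule cmp_zero_left[OF X oP X i, symmetric])
    finally show "(proj 0 \<bullet> s) \<bullet> \<iota> n = \<zero>\<^bsub>Hom D P (X 0)\<^esub> \<bullet> \<iota> n" .
  qed
  have psS: "proj (Suc m) \<bullet> s = g m \<bullet> proj m" for m
  proof (rule coproduct_arr_eqI[OF X cmp_arr[OF oP oP X s(1) pr] cmp_arr[OF oP X X pr g]])
    fix n
    have "(proj (Suc m) \<bullet> s) \<bullet> \<iota> n = proj (Suc m) \<bullet> \<iota> (Suc n) \<bullet> g n"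
      using cmp_assoc[OF X oP oP X i s(1) pr] s(2) by simp
    also have "\<dots> = (proj (Suc m) \<bullet> \<iota> (Suc n)) \<bullet> g n" by (rule cmp_assoc[OF X X oP X g i pr, symmetric])
    also have "\<dots> = (if n = m then g m else \<zero>\<^bsub>Hom D (X n) (X (Suc m))\<^esub>)"
      using proj_injection[of "Suc m" "Suc n"] cmp_zero_left[OF X X X g] cmp_ident_left[OF X X g] by simp
    also have "\<dots> = g m \<bullet> proj m \<bullet> \<iota> n"
      using proj_injection[of m n] cmp_zero_right[OF X X X g] cmp_ident_right[OF X X g] by simp
    also have "\<dots> = (g m \<bullet> proj m) \<bullet> \<iota> n" by (rule cmp_assoc[OF X oP X X i pr g, symmetric])
    finally show "(proj (Suc m) \<bullet> s) \<bullet> \<iota> n = (g m \<bullet> proj m) \<bullet> \<iota> n" .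
  qed
  have sh: "s \<bullet> h = \<zero>\<^bsub>Hom D (shift D m G) P\<^esub>" if h: "h \<in> Arr D (shift D m G) P" for m h
  proof -
    let ?H = "shift D m G"
    note oH = generator_obj[of m]
    have "s \<bullet> part F \<bullet> h = \<zero>\<^bsub>Hom D ?H P\<^esub>" if "finite F" for F
      using that
    proof (induction F rule: finite_induct)
      case empty
      have z: "part {} \<bullet> h = \<zero>\<^bsub>Hom D ?H P\<^esub>" unfolding part_empty by (rule cmp_zero_left[OF oH oP oP h])
      show ?case unfolding z by (rule cmp_zero_right[OF oH oP oP s(1)])
    next
      case (insert j F)
      have ph: "proj j \<bullet> h \<in> Arr D ?H (X j)" by (rule cmp_arr[OF oH oP X h pr])
      have iph: "\<iota> j \<bullet> proj j \<bullet> h \<in> Arr D ?H P" by (rule cmp_arr[OF oH X oP ph i])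
      have pFh: "part F \<bullet> h \<in> Arr D ?H P" by (rule cmp_arr[OF oH oP oP h part_arr])
      have "part (insert j F) \<bullet> h = (\<iota> j \<bullet> proj j) \<bullet> h \<oplus>\<^bsub>Hom D ?H P\<^esub> part F \<bullet> h"
        unfolding part_insert[OF UNIV_I insert.hyps(2)]
        by (rule cmp_add_left[OF oH oP oP h cmp_arr[OF oP X oP pr i] part_arr])
      also have "(\<iota> j \<bullet> proj j) \<bullet> h = \<iota> j \<bullet> proj j \<bullet> h" by (rule cmp_assoc[OF oH oP X oP h pr i])
      finally have "s \<bullet> part (insert j F) \<bullet> h
          = s \<bullet> (\<iota> j \<bullet> proj j \<bullet> h) \<oplus>\<^bsub>Hom D ?H P\<^esub> s \<bullet> part F \<bullet> h"
        using cmp_add_right[OF oH oP oP iph pFh s(1)] by simp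
      also have "s \<bullet> (\<iota> j \<bullet> proj j \<bullet> h) = (s \<bullet> \<iota> j) \<bullet> proj j \<bullet> h"
        by (rule cmp_assoc[OF oH X oP oP ph i s(1), symmetric])
      also have "\<dots> = \<iota> (Suc j) \<bullet> g j \<bullet> proj j \<bullet> h"
        unfolding s(2) by (rule cmp_assoc[OF oH X X oP ph g i])
      also have "g j \<bullet> proj j \<bullet> h = \<zero>\<^bsub>Hom D ?H (X (Suc j))\<^esub>" by (rule kill[OF ph])
      also have "\<iota> (Suc j) \<bullet> \<zero>\<^bsub>Hom D ?H (X (Suc j))\<^esub> = \<zero>\<^bsub>Hom D ?H P\<^esub>"
        by (rule cmp_zero_right[OF oH X oP i])
      finally show ?case using insert.IH zero_add_arr[OF oH oP zero_arr[OF oH oP]] by simp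
    qed
    moreover obtain F where "finite F" "part F \<bullet> h = h" using fin[OF generator_finitary h] by blast
    ultimately show ?thesis by metis
  qed
  \<comment> \<open>The cone of \<open>t = 1 - s\<close> is the homotopy colimit of the tower.\<close>
  define t where "t = ident D P \<ominus>\<^bsub>Hom D P P\<^esub> s"
  have t: "t \<in> Arr D P P" unfolding t_def by (rule minus_arr[OF oP oP ident_arr[OF oP] s(1)])
  have th: "t \<bullet> h = h \<ominus>\<^bsub>Hom D W P\<^esub> s \<bullet> h" if "W \<in> Obj D" "h \<in> Arr D W P" for W h
    unfolding t_def
    using cmp_minus_left[OF that(1) oP oP that(2) ident_arr[OF oP] s(1)] cmp_ident_left[OF that(1) oP that(2)]
    by simp
  have tG: "t \<bullet> h = h" if "h \<in> Arr D (shift D m G) P" for m h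
    using th[OF generator_obj that] sh[OF that] minus_zero_arr[OF generator_obj oP that] by simp
  obtain Y v w where Tr: "Tri D P P Y t v w" using Tri_cone[OF oP oP t] by blast
  then have Y: "Y \<in> Obj D" "v \<in> Arr D P Y" "w \<in> Arr D Y (shO D P)" using Tri_arr by auto
  note Tr' = Tri_rotate_left_to_right[OF Tr]
  note osP = shO_obj[OF oP]
  have "zero_object D Y"
  proof (rule generator_detects[OF Y(1)])
    fix n y assume y: "y \<in> Arr D (shift D n G) Y"
    let ?H = "shift D n G" and ?H' = "shift D (n - 1) G"
    note oH = generator_obj[of n] and oH' = generator_obj[of "n - 1"]
    have G': "G \<in> Obj D" using generator_obj[of 0] by (simp add: shift_def)
    have H: "shO D ?H' = ?H" using shO_shift[OF G', of "n - 1"] by simp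
    have st: "shM D t \<in> Arr D (shO D P) (shO D P)" by (rule shM_arr[OF oP oP t])
    have wy: "w \<bullet> y \<in> Arr D ?H (shO D P)" by (rule cmp_arr[OF oH Y(1) osP y Y(3)])
    obtain h where h: "h \<in> Arr D ?H' P" "shM D h = w \<bullet> y"
      using unshift_arr[OF oH' oP] wy H by metis
    have "\<ominus>\<^bsub>Hom D Y (shO D P)\<^esub> (shM D t \<bullet> w) = \<zero>\<^bsub>Hom D Y (shO D P)\<^esub>"
      using Tri_cmp_zero[OF Tri_rotate_left_to_right[OF Tr']] cmp_neg_left[OF Y(1) osP osP Y(3) st] by simp
    then have tw: "shM D t \<bullet> w = \<zero>\<^bsub>Hom D Y (shO D P)\<^esub>"
      using neg_neg_arr[OF Y(1) osP cmp_arr[OF Y(1) osP osP Y(3) st]] neg_zero_arr[OF Y(1) osP] by simp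
    have "w \<bullet> y = shM D (t \<bullet> h)" using tG[OF h(1)] h(2) by simp
    also have "\<dots> = shM D t \<bullet> w \<bullet> y" using shM_cmp[OF oH' oP oP h(1) t] h(2) by simp
    also have "\<dots> = (shM D t \<bullet> w) \<bullet> y" by (rule cmp_assoc[OF oH Y(1) osP osP y Y(3) st, symmetric])
    also have "\<dots> = \<zero>\<^bsub>Hom D ?H (shO D P)\<^esub>" unfolding tw by (rule cmp_zero_left[OF oH Y(1) osP y])
    finally obtain x where x: "x \<in> Arr D ?H P" "v \<bullet> x = y"
      using Tri_exact_covariant[OF Tr' oH y] by blast
    have "y = v \<bullet> t \<bullet> x" using tG[OF x(1)] x(2) by simp
    also have "\<dots> = (v \<bullet> t) \<bullet> x" by (rule cmp_assoc[OF oH oP oP Y(1) x(1) t Y(2), symmetric])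
    also have "\<dots> = \<zero>\<^bsub>Hom D ?H Y\<^esub>"
      unfolding Tri_cmp_zero[OF Tr] by (rule cmp_zero_left[OF oH oP Y(1) x(1)])
    finally show "y = \<zero>\<^bsub>Hom D ?H Y\<^esub>" .
  qed
  \<comment> \<open>Now the inclusion of the first stage lifts to some \<open>h\<close>; its components satisfy the recursion of \<open>p\<close>.\<close>
  then have "v \<bullet> \<iota> 0 = \<zero>\<^bsub>Hom D (X 0) Y\<^esub>"
    using cmp_arr[OF X oP Y(1) i Y(2)] X unfolding zero_object_def by blast
  then obtain h where h: "h \<in> Arr D (X 0) P" "t \<bullet> h = \<iota> 0"
    using Tri_exact_covariant[OF Tr X i] by blast
  have eq: "proj m \<bullet> h \<ominus>\<^bsub>Hom D (X 0) (X m)\<^esub> (proj m \<bullet> s) \<bullet> h = proj m \<bullet> \<iota> 0" for m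
    using th[OF X h(1)] h(2) cmp_minus_right[OF X oP X h(1) cmp_arr[OF X oP oP h(1) s(1)] pr, of m]
      cmp_assoc[OF X oP oP X h(1) s(1) pr, of m] by simp
  have ph: "proj m \<bullet> h \<in> Arr D (X 0) (X m)" for m by (rule cmp_arr[OF X oP X h(1) pr])
  have "proj m \<bullet> h = p m" for m
  proof (induction m)
    case 0
    show ?case
      using eq[of 0] p0 proj_injection[of 0 0] ps0 cmp_zero_left[OF X oP X h(1), of 0]
        minus_zero_arr[OF X X ph] by simp
  next
    case (Suc m)
    have "(proj (Suc m) \<bullet> s) \<bullet> h = g m \<bullet> p m"
      unfolding psS Suc.IH[symmetric] by (rule cmp_assoc[OF X oP X X h(1) pr g])
    then have "proj (Suc m) \<bullet> h \<ominus>\<^bsub>Hom D (X 0) (X (Suc m))\<^esub> p (Suc m) = \<zero>\<^bsub>Hom D (X 0) (X (Suc m))\<^esub>"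
      using eq[of "Suc m"] proj_injection[of "Suc m" 0] pSuc by simp
    moreover have "p (Suc m) \<in> Arr D (X 0) (X (Suc m))"
      unfolding pSuc Suc.IH[symmetric] by (rule cmp_arr[OF X X X ph g])
    ultimately show ?case using minus_eq_zero_arr[OF X X ph] by simp
  qed
  moreover obtain F where F: "finite F" "part F \<bullet> h = h" using fin[OF C h(1)] by blast
  moreover obtain n where n: "n \<notin> F" using F(1) ex_new_if_finite infinite_UNIV_nat by blast
  moreover have "proj n \<bullet> h = \<zero>\<^bsub>Hom D (X 0) (X n)\<^esub>"
    using cmp_assoc[OF X oP oP X h(1) part_arr pr, of n F] proj_part[OF UNIV_I n] F(2)
      cmp_zero_left[OF X oP X h(1)] by simp
  ultimately show ?thesis by metis
qed

text \<open>
  Build the tower on \<open>C\<close> itself. The composite \<open>C \<rightarrow> X n\<close> is zero for some \<open>n\<close>. Going back down, each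
  stage replaces a compact \<open>K \<rightarrow> C\<close> with cone in \<open>T\<close> by another one whose composite vanishes one stage
  earlier. At stage \<open>0\<close> the map to \<open>C\<close> itself is zero, and \<open>C\<close> is a retract of its cone.
\<close>

theorem thick_induction:
  assumes T: "thick_predicate R D T" and TG: "\<And>n. T (shift D n G)" and C: "finitary R small D C"
  shows "T C"
proof -
  interpret T: thick_predicate R D T by (rule T)
  have oC: "C \<in> Obj D" by (rule finitary_obj[OF C])
  have "\<forall>X\<in>Obj D. \<exists>N. kills_generator_maps T X (fst N) (snd N)"
    using ex_kills_generator_maps[OF T TG] by auto
  then obtain N where N: "\<forall>X\<in>Obj D. kills_generator_maps T X (fst (N X)) (snd (N X))"
    by (rule bchoice[THEN exE])
  define X where "X n = ((fst \<circ> N) ^^ n) C" for n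
  define g where "g n = snd (N (X n))" for n
  have XS: "X (Suc n) = fst (N (X n))" for n by (simp add: X_def)
  have X: "X n \<in> Obj D" for n
  proof (induction n)
    case 0
    show ?case using oC by (simp add: X_def)
  next
    case (Suc n)
    from bspec[OF N Suc] show ?case unfolding kills_generator_maps_def XS by (rule conjunct1)
  qed
  have "kills_generator_maps T (X n) (X (Suc n)) (g n)" for n
    unfolding XS g_def by (rule bspec[OF N X])
  note kills = this[unfolded kills_generator_maps_def]
  have g: "g n \<in> Arr D (X n) (X (Suc n))" for n using kills by simp
  have kill: "g n \<bullet> f = \<zero>\<^bsub>Hom D (shift D m G) (X (Suc n))\<^esub>" if "f \<in> Arr D (shift D m G) (X n)" for n m f
    using kills[of n] that by simp
  have lift: "\<exists>K' k. finitary R small D K' \<and> cone_in T D K' K k \<and> x \<bullet> k = \<zero>\<^bsub>Hom D K' (X n)\<^esub>"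
    if "finitary R small D K" "x \<in> Arr D K (X n)" "g n \<bullet> x = \<zero>\<^bsub>Hom D K (X (Suc n))\<^esub>" for n K x
    using kills[of n] that by simp
  define p where "p = rec_nat (ident D C) (\<lambda>n q. g n \<bullet> q)"
  have p0: "p 0 = ident D (X 0)" and pS: "p (Suc n) = g n \<bullet> p n" for n by (simp_all add: p_def X_def)
  have p: "p n \<in> Arr D (X 0) (X n)" for n
    by (induction n) (auto simp: p0 pS intro: ident_arr X cmp_arr[OF X X X _ g])
  have C0: "X 0 = C" by (simp add: X_def)
  obtain n where n: "p n = \<zero>\<^bsub>Hom D (X 0) (X n)\<^esub>"
    using tower_vanishes[OF X g kill _ p0 pS] C C0 by auto
  have "\<exists>K k. finitary R small D K \<and> cone_in T D K C k \<and> p m \<bullet> k = \<zero>\<^bsub>Hom D K (X m)\<^esub>" if "m \<le> n" for m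
    using that
  proof (induction m rule: inc_induct)
    case base
    show ?case
      using C T.cone_in_ident[OF oC] cmp_ident_right[OF X X p] n C0 by metis
  next
    case (step m)
    then obtain K k where K: "finitary R small D K" "cone_in T D K C k" "p (Suc m) \<bullet> k = \<zero>\<^bsub>Hom D K (X (Suc m))\<^esub>"
      by blast
    have oK: "K \<in> Obj D" "k \<in> Arr D K (X 0)" using cone_in_arr[OF K(2)] C0 by auto
    have pk: "p m \<bullet> k \<in> Arr D K (X m)" by (rule cmp_arr[OF oK(1) X X oK(2) p])
    have "g m \<bullet> p m \<bullet> k = \<zero>\<^bsub>Hom D K (X (Suc m))\<^esub>"
      using K(3) cmp_assoc[OF oK(1) X X X oK(2) p g] unfolding pS by simp
    then obtain K' k' where K': "finitary R small D K'" "cone_in T D K' K k'" "(p m \<bullet> k) \<bullet> k' = \<zero>\<^bsub>Hom D K' (X m)\<^esub>"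
      using lift[OF K(1) pk] by blast
    have oK': "K' \<in> Obj D" "k' \<in> Arr D K' K" using cone_in_arr[OF K'(2)] by auto
    have "p m \<bullet> k \<bullet> k' = \<zero>\<^bsub>Hom D K' (X m)\<^esub>"
      using K'(3) cmp_assoc[OF oK'(1) oK(1) X X oK'(2) oK(2) p] by simp
    then show ?case using K'(1) T.cone_in_cmp[OF K'(2) K(2)] by blast
  qed
  from this[of 0] obtain K k where K: "cone_in T D K C k" "p 0 \<bullet> k = \<zero>\<^bsub>Hom D K (X 0)\<^esub>" by blast
  have "k = \<zero>\<^bsub>Hom D K C\<^esub>"
    using K(2) cmp_ident_left[OF cone_in_arr[OF K(1)]] unfolding p0 C0 by simp
  then show ?thesis using T.T_of_zero_cone_in K(1) by simp
qed

end

section \<open>Finitely presented hom-modules\<close>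

context triangulated_category
begin

lemma finitely_presented_Hom_retract_left:
  assumes noeth: "noetherian_ring R" and o: "A \<in> Obj D" "B \<in> Obj D" "X \<in> Obj D"
    and s: "s \<in> Arr D A B" and r: "r \<in> Arr D B A" and rs: "r \<bullet> s = ident D A"
    and fp: "finitely_presented R (Hom D B X)"
  shows "finitely_presented R (Hom D A X)"
proof (rule finitely_presented_surj[OF noeth fp Hom_module[OF o(1,3)] cmp_linear_left[OF o s]])
  show "(\<lambda>g. g \<bullet> s) ` Arr D B X = Arr D A X"
  proof
    show "(\<lambda>g. g \<bullet> s) ` Arr D B X \<subseteq> Arr D A X" using cmp_arr[OF o s] by blast
    show "Arr D A X \<subseteq> (\<lambda>g. g \<bullet> s) ` Arr D B X"
    proof
      fix g assume g: "g \<in> Arr D A X"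
      have "g = (g \<bullet> r) \<bullet> s"
        using cmp_assoc[OF o(1,2,1,3) s r g] rs cmp_ident_right[OF o(1,3) g] by simp
      then show "g \<in> (\<lambda>g. g \<bullet> s) ` Arr D B X" using cmp_arr[OF o(2,1,3) r g] by (rule image_eqI)
    qed
  qed
qed

lemma finitely_presented_Hom_retract_right:
  assumes noeth: "noetherian_ring R" and o: "H \<in> Obj D" "B \<in> Obj D" "A \<in> Obj D"
    and s: "s \<in> Arr D A B" and r: "r \<in> Arr D B A" and rs: "r \<bullet> s = ident D A"
    and fp: "finitely_presented R (Hom D H B)"
  shows "finitely_presented R (Hom D H A)"
proof (rule finitely_presented_surj[OF noeth fp Hom_module[OF o(1,3)] cmp_linear_right[OF o r]])
  show "(\<lambda>g. r \<bullet> g) ` Arr D H B = Arr D H A"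
  proof
    show "(\<lambda>g. r \<bullet> g) ` Arr D H B \<subseteq> Arr D H A" using cmp_arr[OF o _ r] by blast
    show "Arr D H A \<subseteq> (\<lambda>g. r \<bullet> g) ` Arr D H B"
    proof
      fix g assume g: "g \<in> Arr D H A"
      have "g = r \<bullet> s \<bullet> g"
        using cmp_assoc[OF o(1,3,2,3) g s r] rs cmp_ident_left[OF o(1,3) g] by simp
      then show "g \<in> (\<lambda>g. r \<bullet> g) ` Arr D H B" using cmp_arr[OF o(1,3,2) g s] by (rule image_eqI)
    qed
  qed
qed

lemma thick_predicate_Hom_into:
  assumes noeth: "noetherian_ring R" and X: "X \<in> Obj D"
    and Z: "Z \<in> Obj D" "finitely_presented R (Hom D Z X)"
  shows "thick_predicate R D (\<lambda>A. finitely_presented R (Hom D A X))"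
proof (intro thick_predicate.intro thick_predicate_axioms.intro triangulated_category_axioms)
  fix A B C u v w
  assume T: "Tri D A B C u v w" and fp: "finitely_presented R (Hom D A X)" "finitely_presented R (Hom D C X)"
  have o: "A \<in> Obj D" "B \<in> Obj D" "C \<in> Obj D" "u \<in> Arr D A B" "v \<in> Arr D B C" using Tri_arr[OF T] by auto
  show "finitely_presented R (Hom D B X)"
    by (rule finitely_presented_middle[OF noeth fp(2) Hom_module[OF o(2) X] fp(1)
          cmp_linear_left[OF o(2,3) X o(5)] cmp_linear_left[OF o(1,2) X o(4)]])
      (rule Tri_exact_contravariant[OF T X])
next
  fix A B s r
  assume "A \<in> Obj D" "B \<in> Obj D" "s \<in> Arr D A B" "r \<in> Arr D B A" "r \<bullet> s = ident D A"
    "finitely_presented R (Hom D B X)"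
  then show "finitely_presented R (Hom D A X)"
    using finitely_presented_Hom_retract_left[OF noeth _ _ X] by blast
next
  show "\<exists>A\<in>Obj D. finitely_presented R (Hom D A X)" using Z by blast
qed

lemma thick_predicate_Hom_from:
  assumes noeth: "noetherian_ring R" and H: "H \<in> Obj D"
    and Z: "Z \<in> Obj D" "finitely_presented R (Hom D H Z)"
  shows "thick_predicate R D (\<lambda>A. finitely_presented R (Hom D H A))"
proof (intro thick_predicate.intro thick_predicate_axioms.intro triangulated_category_axioms)
  fix A B C u v w
  assume T: "Tri D A B C u v w" and fp: "finitely_presented R (Hom D H A)" "finitely_presented R (Hom D H C)"
  have o: "A \<in> Obj D" "B \<in> Obj D" "C \<in> Obj D" "u \<in> Arr D A B" "v \<in> Arr D B C" using Tri_arr[OF T] by auto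
  show "finitely_presented R (Hom D H B)"
    by (rule finitely_presented_middle[OF noeth fp(1) Hom_module[OF H o(2)] fp(2)
          cmp_linear_right[OF H o(1,2,4)] cmp_linear_right[OF H o(2,3,5)]])
      (rule Tri_exact_covariant[OF T H])
next
  fix A B s r
  assume "A \<in> Obj D" "B \<in> Obj D" "s \<in> Arr D A B" "r \<in> Arr D B A" "r \<bullet> s = ident D A"
    "finitely_presented R (Hom D H B)"
  then show "finitely_presented R (Hom D H A)"
    using finitely_presented_Hom_retract_right[OF noeth H] by blast
next
  show "\<exists>A\<in>Obj D. finitely_presented R (Hom D H A)" using Z by blast
qed

lemma finitely_presented_Hom_shift_iff:
  assumes noeth: "noetherian_ring R" and o: "A \<in> Obj D" "B \<in> Obj D"
  shows "finitely_presented R (Hom D (shO D A) (shO D B)) \<longleftrightarrow> finitely_presented R (Hom D A B)"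
proof
  note os = shO_obj[OF o(1)] shO_obj[OF o(2)]
  note bij = shM_bij[OF o] and lin = shM_linear[OF o]
  show "finitely_presented R (Hom D A B) \<Longrightarrow> finitely_presented R (Hom D (shO D A) (shO D B))"
    using finitely_presented_surj[OF noeth _ Hom_module[OF os] lin] bij_betw_imp_surj_on[OF bij] by blast
  assume fp: "finitely_presented R (Hom D (shO D A) (shO D B))"
  let ?g = "inv_into (Arr D A B) (shM D)"
  have g: "?g y \<in> Arr D A B \<and> shM D (?g y) = y" if "y \<in> Arr D (shO D A) (shO D B)" for y
  proof -
    have "y \<in> shM D ` Arr D A B" using bij_betw_imp_surj_on[OF bij] that by simp
    then show ?thesis using inv_into_into f_inv_into_f by metis
  qed
  have gI: "?g y = x" if "x \<in> Arr D A B" "shM D x = y" for x y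
    using inv_into_f_eq[OF bij_betw_imp_inj_on[OF bij] that] .
  interpret H: module R "Hom D A B" by (rule Hom_module[OF o])
  have "?g \<in> mod_hom R (Hom D (shO D A) (shO D B)) (Hom D A B)"
    by (rule mod_homI) (use g in \<open>auto intro!: gI simp: mod_homD[OF lin]\<close>)
  moreover have "?g ` Arr D (shO D A) (shO D B) = Arr D A B"
    by (rule bij_betw_imp_surj_on[OF bij_betw_inv_into[OF bij]])
  ultimately show "finitely_presented R (Hom D A B)"
    by (rule finitely_presented_surj[OF noeth fp Hom_module[OF o]])
qed

text \<open>
  Up to isomorphism \<open>Hom(X[i], Y[j])\<close> depends only on \<open>j - i\<close>.
\<close>

lemma finitely_presented_Hom_shifts:
  assumes noeth: "noetherian_ring R" and X: "X \<in> Obj D" "Y \<in> Obj D"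
    and fp: "\<And>n. finitely_presented R (Hom D X (shift D n Y))"
  shows "finitely_presented R (Hom D (shift D i X) (shift D j Y))"
proof -
  have step: "finitely_presented R (Hom D (shift D (i + 1) X) (shift D (j + 1) Y))
      \<longleftrightarrow> finitely_presented R (Hom D (shift D i X) (shift D j Y))" for i j
    unfolding shO_shift[OF X(1), symmetric] shO_shift[OF X(2), symmetric]
    by (rule finitely_presented_Hom_shift_iff[OF noeth shift_obj[OF X(1)] shift_obj[OF X(2)]])
  have "\<forall>j. finitely_presented R (Hom D (shift D i X) (shift D j Y))"
  proof (induction i rule: int_induct[where k = 0])
    case base
    have "shift D 0 X = X" by (simp add: shift_def)
    then show ?case using fp by simp
  next
    case (step1 i)
    show ?case
    proof
      fix j show "finitely_presented R (Hom D (shift D (i + 1) X) (shift D j Y))"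
        using step[of i "j - 1"] step1.IH by simp
    qed
  next
    case (step2 i)
    show ?case
    proof
      fix j show "finitely_presented R (Hom D (shift D (i - 1) X) (shift D j Y))"
        using step[of "i - 1" j] step2.IH by simp
    qed
  qed
  then show ?thesis by simp
qed

end

section \<open>Local coherence\<close>

lemma category_moduleD:
  assumes "category_module R D K M"
  shows "A \<in> K \<Longrightarrow> module R (val M A)"
    and "\<lbrakk>A \<in> K; B \<in> K; f \<in> Arr D A B\<rbrakk> \<Longrightarrow> act M f \<in> mod_hom R (val M B) (val M A)"
    and "\<lbrakk>A \<in> K; x \<in> carrier (val M A)\<rbrakk> \<Longrightarrow> act M (ident D A) x = x"
    and "\<lbrakk>A \<in> K; B \<in> K; C \<in> K; f \<in> Arr D A B; g \<in> Arr D B C; x \<in> carrier (val M C)\<rbrakk>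
      \<Longrightarrow> act M (g \<bullet>\<^bsub>D\<^esub> f) x = act M f (act M g x)"
    and "\<lbrakk>A \<in> K; B \<in> K; x \<in> carrier (val M B)\<rbrakk> \<Longrightarrow> (\<lambda>f. act M f x) \<in> mod_hom R (Hom D A B) (val M A)"
  using assms by (simp_all add: category_module_def)

lemma natural_transformationD:
  assumes "\<alpha> \<in> natural_transformations R D K M N"
  shows "A \<in> K \<Longrightarrow> \<alpha> A \<in> mod_hom R (val M A) (val N A)"
    and "\<lbrakk>A \<in> K; B \<in> K; f \<in> Arr D A B; x \<in> carrier (val M B)\<rbrakk> \<Longrightarrow> \<alpha> A (act M f x) = act N f (\<alpha> B x)"
  using assms by (simp_all add: natural_transformations_def)

context linear_category
begin

lemma category_module_yoneda:
  assumes K: "K \<subseteq> Obj D" and X: "X \<in> Obj D"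
  shows "category_module R D K (yoneda D X)"
  unfolding category_module_def yoneda_def cmodule.simps
proof (intro conjI ballI)
  note o = subsetD[OF K]
  show "module R (Hom D A X)" if "A \<in> K" for A by (rule Hom_module[OF o[OF that] X])
  show "(\<lambda>h. h \<bullet> f) \<in> mod_hom R (Hom D B X) (Hom D A X)"
    if "A \<in> K" "B \<in> K" "f \<in> Arr D A B" for A B f
    by (rule cmp_linear_left[OF o[OF that(1)] o[OF that(2)] X that(3)])
  show "x \<bullet> ident D A = x" if "A \<in> K" "x \<in> Arr D A X" for A x
    by (rule cmp_ident_right[OF o[OF that(1)] X that(2)])
  show "x \<bullet> g \<bullet> f = (x \<bullet> g) \<bullet> f"
    if "A \<in> K" "B \<in> K" "C \<in> K" "f \<in> Arr D A B" "g \<in> Arr D B C" "x \<in> Arr D C X" for A B C f g x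
    by (rule cmp_assoc[OF o[OF that(1)] o[OF that(2)] o[OF that(3)] X that(4-6), symmetric])
  show "(\<lambda>f. x \<bullet> f) \<in> mod_hom R (Hom D A B) (Hom D A X)"
    if "A \<in> K" "B \<in> K" "x \<in> Arr D B X" for A B x
    by (rule cmp_linear_right[OF o[OF that(1)] o[OF that(2)] X that(3)])
qed

lemma yoneda_natural_transformation:
  assumes K: "K \<subseteq> Obj D" and M: "category_module R D K M" and B: "B \<in> K" and b: "b \<in> carrier (val M B)"
  shows "(\<lambda>A h. act M h b) \<in> natural_transformations R D K (yoneda D B) M"
  unfolding natural_transformations_def yoneda_def cmodule.simps
  using category_moduleD(5)[OF M _ B b] category_moduleD(4)[OF M _ _ B _ _ b] by blast

text \<open>
  Finitely many elements of \<open>N H\<close> come from a single element by restriction: over a biproduct of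
  copies of \<open>H\<close>, take the sum of the given elements transported along the projections. With
  \<open>N = M\<close> this yields the first condition of local coherence, with \<open>N\<close> the kernel of a natural
  transformation the second.
\<close>

lemma subfunctor_elements_realised:
  assumes K: "K \<subseteq> Obj D" and M: "category_module R D K M"
    and bip: "\<And>X Y. \<lbrakk>X \<in> K; Y \<in> K\<rbrakk> \<Longrightarrow> \<exists>P i j p q. P \<in> K \<and> biproduct D X Y P i j p q"
    and N: "\<And>A. A \<in> K \<Longrightarrow> submodule (N A) R (val M A)"
    and Nact: "\<And>A B f x. \<lbrakk>A \<in> K; B \<in> K; f \<in> Arr D A B; x \<in> N B\<rbrakk> \<Longrightarrow> act M f x \<in> N A"
    and H: "H \<in> K" and S: "finite S" "S \<subseteq> N H"
  shows "\<exists>B b. B \<in> K \<and> b \<in> N B \<and> S \<subseteq> (\<lambda>h. act M h b) ` Arr D H B"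
  using S
proof (induction S rule: finite_induct)
  case empty
  interpret module R "val M H" by (rule category_moduleD(1)[OF M H])
  show ?case using H submodule_zero[OF N[OF H]] by blast
next
  case (insert s S)
  then obtain B b where B: "B \<in> K" "b \<in> N B" "S \<subseteq> (\<lambda>h. act M h b) ` Arr D H B" by auto
  obtain P i j p q where P: "P \<in> K" and bi: "biproduct D B H P i j p q" using bip[OF B(1) H] by blast
  have a: "i \<in> Arr D B P" "j \<in> Arr D H P" "p \<in> Arr D P B" "q \<in> Arr D P H"
    "p \<bullet> i = ident D B" "q \<bullet> j = ident D H" "q \<bullet> i = \<zero>\<^bsub>Hom D B H\<^esub>" "p \<bullet> j = \<zero>\<^bsub>Hom D H B\<^esub>"
    using bi by (auto simp: biproduct_def)
  have o: "B \<in> Obj D" "H \<in> Obj D" "P \<in> Obj D" using B(1) H P K by auto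
  interpret MB: module R "val M B" by (rule category_moduleD(1)[OF M B(1)])
  interpret MH: module R "val M H" by (rule category_moduleD(1)[OF M H])
  interpret MP: module R "val M P" by (rule category_moduleD(1)[OF M P])
  have c: "b \<in> carrier (val M B)" "s \<in> carrier (val M H)"
    using MB.submoduleE(1)[OF N[OF B(1)]] B(2) MH.submoduleE(1)[OF N[OF H]] insert.prems by auto
  define b' where "b' = act M p b \<oplus>\<^bsub>val M P\<^esub> act M q s"
  have pb: "act M p b \<in> N P" and qs: "act M q s \<in> N P"
    using Nact[OF P B(1) a(3) B(2)] Nact[OF P H a(4)] insert.prems by auto
  have b': "b' \<in> N P" unfolding b'_def by (rule MP.submoduleE(5)[OF N[OF P] pb qs])
  have pbc: "act M p b \<in> carrier (val M P)" and qsc: "act M q s \<in> carrier (val M P)" and b'c: "b' \<in> carrier (val M P)"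
    using MP.submoduleE(1)[OF N[OF P]] pb qs b' by auto
  have zero: "act M \<zero>\<^bsub>Hom D A A'\<^esub> x = \<zero>\<^bsub>val M A\<^esub>" if "A \<in> K" "A' \<in> K" "x \<in> carrier (val M A')" for A A' x
    using mod_hom_zero[OF category_moduleD(5)[OF M that] Hom_module category_moduleD(1)[OF M that(1)]] that K by blast
  have "act M i b' = act M i (act M p b) \<oplus>\<^bsub>val M B\<^esub> act M i (act M q s)"
    unfolding b'_def by (rule mod_homD(2)[OF category_moduleD(2)[OF M B(1) P a(1)] pbc qsc])
  also have "act M i (act M p b) = b"
    using category_moduleD(4)[OF M B(1) P B(1) a(1,3) c(1)] category_moduleD(3)[OF M B(1) c(1)] a(5) by simp
  also have "act M i (act M q s) = \<zero>\<^bsub>val M B\<^esub>"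
    using category_moduleD(4)[OF M B(1) P H a(1,4) c(2)] zero[OF B(1) H c(2)] a(7) by simp
  finally have ib: "act M i b' = b" using c(1) by simp
  have "act M j b' = act M j (act M p b) \<oplus>\<^bsub>val M H\<^esub> act M j (act M q s)"
    unfolding b'_def by (rule mod_homD(2)[OF category_moduleD(2)[OF M H P a(2)] pbc qsc])
  also have "act M j (act M q s) = s"
    using category_moduleD(4)[OF M H P H a(2,4) c(2)] category_moduleD(3)[OF M H c(2)] a(6) by simp
  also have "act M j (act M p b) = \<zero>\<^bsub>val M H\<^esub>"
    using category_moduleD(4)[OF M H P B(1) a(2,3) c(1)] zero[OF H B(1) c(1)] a(8) by simp
  finally have jb: "act M j b' = s" using c(2) by simp
  have "insert s S \<subseteq> (\<lambda>h. act M h b') ` Arr D H P"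
  proof
    fix t assume t: "t \<in> insert s S"
    show "t \<in> (\<lambda>h. act M h b') ` Arr D H P"
    proof (cases "t = s")
      case True
      then show ?thesis using jb a(2) by (intro image_eqI[of _ _ j]) auto
    next
      case False
      then obtain h where h: "h \<in> Arr D H B" "t = act M h b" using t B(3) by auto
      then have "t = act M (i \<bullet> h) b'"
        using category_moduleD(4)[OF M H B(1) P h(1) a(1) b'c] ib by simp
      then show ?thesis using cmp_arr[OF o(2,1,3) h(1) a(1)] by (rule image_eqI)
    qed
  qed
  then show ?case using P b' by blast
qed

lemma locally_coherent_at_imp_finitely_presented:
  assumes noeth: "noetherian_ring R" and M: "category_module R D K M" and H: "H \<in> K"
    and fp: "\<And>B. B \<in> K \<Longrightarrow> finitely_presented R (Hom D H B)"
    and lc: "locally_coherent_at R D K H M"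
  shows "finitely_presented R (val M H)"
proof -
  obtain B \<alpha> where B: "B \<in> K" "\<alpha> \<in> natural_transformations R D K (yoneda D B) M"
    "\<alpha> H ` Arr D H B = carrier (val M H)"
    using lc unfolding locally_coherent_at_def by blast
  have "\<alpha> H \<in> mod_hom R (Hom D H B) (val M H)"
    using natural_transformationD(1)[OF B(2) H] by (simp add: yoneda_def)
  then show ?thesis
    by (rule finitely_presented_surj[OF noeth fp[OF B(1)] category_moduleD(1)[OF M H] _ B(3)])
qed

text \<open>
  Natural transformations out of a representable functor are given by elements, by Yoneda. Both
  conditions thus ask for one element whose restrictions to \<open>H\<close> exhaust a finitely generated module:
  the value of \<open>M\<close> at \<open>H\<close>, respectively the kernel of \<open>\<beta>\<close> at \<open>H\<close>, which is a submodule of the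
  finitely presented \<open>Hom(H, B)\<close>.
\<close>

lemma finitely_presented_imp_locally_coherent_at:
  assumes noeth: "noetherian_ring R" and K: "K \<subseteq> Obj D" and M: "category_module R D K M"
    and bip: "\<And>X Y. \<lbrakk>X \<in> K; Y \<in> K\<rbrakk> \<Longrightarrow> \<exists>P i j p q. P \<in> K \<and> biproduct D X Y P i j p q"
    and H: "H \<in> K" and fp: "\<And>B. B \<in> K \<Longrightarrow> finitely_presented R (Hom D H B)"
    and fpM: "finitely_presented R (val M H)"
  shows "locally_coherent_at R D K H M"
  unfolding locally_coherent_at_def
proof (intro conjI ballI)
  have mM: "module R (val M A)" if "A \<in> K" for A by (rule category_moduleD(1)[OF M that])
  have oH: "H \<in> Obj D" using H K by auto
  interpret MH: module R "val M H" by (rule mM[OF H])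
  obtain S where S: "finite S" "S \<subseteq> carrier (val M H)" "lspan R (val M H) S = carrier (val M H)"
    using fpM finitely_presented_iff_finitely_generated[OF noeth mM[OF H]] by auto
  obtain B b where B: "B \<in> K" "b \<in> carrier (val M B)" "S \<subseteq> (\<lambda>h. act M h b) ` Arr D H B"
    using subfunctor_elements_realised[OF K M bip module.carrier_is_submodule[OF mM] _ H S(1,2)]
      mod_homD(1)[OF category_moduleD(2)[OF M]] by blast
  note lin = category_moduleD(5)[OF M H B(1,2)]
  have oB: "B \<in> Obj D" using B(1) K by auto
  interpret HB: module R "Hom D H B" by (rule Hom_module[OF oH oB])
  have im: "submodule ((\<lambda>h. act M h b) ` Arr D H B) R (val M H)"
    by (rule submodule_image[OF lin Hom_module[OF oH oB] mM[OF H] HB.carrier_is_submodule])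
  have "(\<lambda>h. act M h b) ` Arr D H B = carrier (val M H)"
    using MH.lspan_least[OF im B(3)] S(3) MH.submoduleE(1)[OF im] by simp
  then show "\<exists>B\<in>K. \<exists>\<alpha>\<in>natural_transformations R D K (yoneda D B) M. \<alpha> H ` Arr D H B = carrier (val M H)"
    using yoneda_natural_transformation[OF K M B(1,2)] B(1) by (intro bexI[of _ B] bexI[of _ "\<lambda>A h. act M h b"])
next
  fix B \<beta> assume B: "B \<in> K" and \<beta>: "\<beta> \<in> natural_transformations R D K (yoneda D B) M"
  have mM: "module R (val M A)" if "A \<in> K" for A by (rule category_moduleD(1)[OF M that])
  have oK: "A \<in> Obj D" if "A \<in> K" for A using that K by auto
  note oH = oK[OF H] and oB = oK[OF B]
  have Y: "category_module R D K (yoneda D B)" by (rule category_module_yoneda[OF K oB])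
  have \<beta>lin: "\<beta> A \<in> mod_hom R (Hom D A B) (val M A)" if "A \<in> K" for A
    using natural_transformationD(1)[OF \<beta> that] by (simp add: yoneda_def)
  have \<beta>nat: "\<beta> A (x \<bullet> f) = act M f (\<beta> C x)" if "A \<in> K" "C \<in> K" "f \<in> Arr D A C" "x \<in> Arr D C B" for A C f x
    using natural_transformationD(2)[OF \<beta> that(1-3), of x] that(4) by (simp add: yoneda_def)
  have act0: "act M f \<zero>\<^bsub>val M C\<^esub> = \<zero>\<^bsub>val M A\<^esub>" if "A \<in> K" "C \<in> K" "f \<in> Arr D A C" for A C f
    by (rule mod_hom_zero[OF category_moduleD(2)[OF M that] mM[OF that(2)] mM[OF that(1)]])
  \<comment> \<open>The kernel of \<open>\<beta>\<close>, a subfunctor of the representable functor of \<open>B\<close>.\<close>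
  define N where "N A = {x \<in> Arr D A B. \<beta> A x \<in> {\<zero>\<^bsub>val M A\<^esub>}}" for A
  have subN: "submodule (N A) R (Hom D A B)" if "A \<in> K" for A
  proof -
    interpret MA: module R "val M A" by (rule mM[OF that])
    have "submodule {\<zero>\<^bsub>val M A\<^esub>} R (val M A)" by (rule MA.submoduleI') auto
    then show ?thesis unfolding N_def
      by (rule submodule_preimage[OF \<beta>lin[OF that] Hom_module[OF oK[OF that] oB] mM[OF that]])
  qed
  have Nact: "x \<bullet> f \<in> N A" if "A \<in> K" "C \<in> K" "f \<in> Arr D A C" "x \<in> N C" for A C f x
    using that \<beta>nat[OF that(1-3)] act0[OF that(1-3)] cmp_arr[OF oK[OF that(1)] oK[OF that(2)] oB that(3)]
    by (simp add: N_def)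
  obtain S where S: "finite S" "S \<subseteq> N H" "N H = lspan R (Hom D H B) S"
    by (rule finitely_presented_submodule[OF noeth fp[OF B] subN[OF H]])
  have "\<exists>C f. C \<in> K \<and> f \<in> N C \<and> S \<subseteq> (\<lambda>h. act (yoneda D B) h f) ` Arr D H C"
    by (rule subfunctor_elements_realised[where N = N, OF K Y bip _ _ H S(1,2)])
      (simp_all add: yoneda_def subN Nact)
  then obtain C f where C: "C \<in> K" "f \<in> N C" "S \<subseteq> (\<lambda>h. f \<bullet> h) ` Arr D H C"
    by (auto simp: yoneda_def)
  note oC = oK[OF C(1)]
  have f: "f \<in> Arr D C B" using C(2) by (simp add: N_def)
  have fN: "f \<bullet> h \<in> N A" if "A \<in> K" "h \<in> Arr D A C" for A h by (rule Nact[OF that(1) C(1) that(2) C(2)])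
  interpret HC: module R "Hom D H C" by (rule Hom_module[OF oH oC])
  interpret HB: module R "Hom D H B" by (rule Hom_module[OF oH oB])
  have im: "submodule ((\<lambda>h. f \<bullet> h) ` Arr D H C) R (Hom D H B)"
    by (rule submodule_image[OF cmp_linear_right[OF oH oC oB f] Hom_module[OF oH oC] Hom_module[OF oH oB]
          HC.carrier_is_submodule])
  have "N H \<subseteq> (\<lambda>h. f \<bullet> h) ` Arr D H C" unfolding S(3) by (rule HB.lspan_least[OF im C(3)])
  then have "exact_at (Hom D H C) (Hom D H B) (val M H) (yoneda_map D f H) (\<beta> H)"
    using fN[OF H] by (intro exact_atI) (auto simp: N_def yoneda_map_def)
  moreover have "\<forall>A\<in>K. \<forall>h\<in>Arr D A C. \<beta> A (yoneda_map D f A h) = \<zero>\<^bsub>val M A\<^esub>"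
    using fN by (simp add: N_def yoneda_map_def)
  ultimately show "\<exists>C\<in>K. \<exists>f\<in>Arr D C B.
         (\<forall>A\<in>K. \<forall>h\<in>Arr D A C. \<beta> A (yoneda_map D f A h) = \<zero>\<^bsub>val M A\<^esub>) \<and>
         exact_at (Hom D H C) (Hom D H B) (val M H) (yoneda_map D f H) (\<beta> H)"
    using C(1) f by (intro bexI[of _ C] bexI[of _ f] conjI)
qed

end

section \<open>Locally coherent modules and objects\<close>

theorem corollary4p7:
  fixes R :: "('r, 'x) ring_scheme"
    and D :: "('r, 'o, 'm) tricat"
    and small :: "'i set \<Rightarrow> bool"
    and G :: 'o
  assumes "cring R" and "noetherian_ring R"
    and "triangulated_category R D"
    and "smallness small" and "locally_small small D" and "has_coproducts small D"
    and "compact_generator small D G"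
    and "\<And>n. finitely_presented R (Hom D G (shift D n G))"
  shows "(\<forall>M :: ('r, 'o, 'm, 'b) cmodule.
            category_module R D (compact_objects small D) M \<longrightarrow>
            cohomological D (compact_objects small D) M \<longrightarrow>
            (locally_coherent R D (compact_objects small D) (compact_objects small D) M \<longleftrightarrow>
             (\<forall>C\<in>compact_objects small D. finitely_presented R (val M C)))) \<and>
         lcoh_objects R small D G =
           {Y \<in> Obj D. \<forall>C\<in>compact_objects small D. finitely_presented R (Hom D C Y)}"
proof -
  note noeth = assms(2)
  interpret compactly_generated R D small G
    by (intro compactly_generated.intro compactly_generated_axioms.intro assms)
  let ?K = "compact_objects small D"
  have K_iff: "C \<in> ?K \<longleftrightarrow> finitary R small D C" for C
    by (simp add: compact_objects_eq_finitary)
  have K: "?K \<subseteq> Obj D" by (simp add: compact_objects_def)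
  have oG: "G \<in> Obj D" using generator_obj[of 0] by (simp add: shift_def)
  have GK: "shift D n G \<in> ?K" for n using K_iff generator_finitary by simp
  have bip: "\<exists>P i j p q. P \<in> ?K \<and> biproduct D X Y P i j p q" if XY: "X \<in> ?K" "Y \<in> ?K" for X Y
  proof -
    have "X \<in> Obj D" "Y \<in> Obj D" using XY K by auto
    from ex_biproduct[OF this] obtain P i j p q where P: "biproduct D X Y P i j p q" by auto
    have "P \<in> ?K" using finitary_biproduct[OF P, of small] XY K_iff by simp
    then show ?thesis using P by (intro exI conjI)
  qed
  have Hom_from_all: "finitely_presented R (Hom D C X)"
    if X: "X \<in> Obj D" and fp: "\<And>n. finitely_presented R (Hom D (shift D n G) X)" and C: "C \<in> ?K" for C X
    using thick_induction[OF thick_predicate_Hom_into[OF noeth X generator_obj fp] fp, of C] C K_iff by simp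
  have fp: "finitely_presented R (Hom D C B)" if C: "C \<in> ?K" and B: "B \<in> ?K" for B C
  proof -
    have G: "finitely_presented R (Hom D (shift D i G) (shift D j G))" for i j
      by (rule finitely_presented_Hom_shifts[OF noeth oG oG assms(8)])
    have GB: "finitely_presented R (Hom D (shift D i G) B)" for i
      using thick_induction[OF thick_predicate_Hom_from[OF noeth generator_obj generator_obj G] G, of B] B K_iff
      by simp
    show ?thesis by (rule Hom_from_all[OF _ GB C]) (use B K in auto)
  qed
  have "locally_coherent R D ?K ?K M \<longleftrightarrow> (\<forall>C\<in>?K. finitely_presented R (val M C))"
    if M: "category_module R D ?K M" for M :: "('r, 'o, 'm, 'b) cmodule"
    unfolding locally_coherent_def
  proof (rule ball_cong[OF refl])
    fix C assume C: "C \<in> ?K"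
    show "locally_coherent_at R D ?K C M \<longleftrightarrow> finitely_presented R (val M C)"
      using locally_coherent_at_imp_finitely_presented[OF noeth M C fp[OF C]]
        finitely_presented_imp_locally_coherent_at[OF noeth K M bip C fp[OF C]] by blast
  qed
  moreover have "locally_coherent R D ?K {shift D n G | n. True} (yoneda D X)
      \<longleftrightarrow> (\<forall>C\<in>?K. finitely_presented R (Hom D C X))" if X: "X \<in> Obj D" for X
  proof -
    note Y = category_module_yoneda[OF K X]
    have v: "val (yoneda D X) C = Hom D C X" for C by (simp add: yoneda_def)
    have "locally_coherent R D ?K {shift D n G | n. True} (yoneda D X)
        \<longleftrightarrow> (\<forall>n. locally_coherent_at R D ?K (shift D n G) (yoneda D X))"
      unfolding locally_coherent_def by blast
    also have "\<dots> \<longleftrightarrow> (\<forall>n. finitely_presented R (Hom D (shift D n G) X))"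
      using locally_coherent_at_imp_finitely_presented[OF noeth Y GK fp[OF GK]]
        finitely_presented_imp_locally_coherent_at[OF noeth K Y bip GK fp[OF GK]] unfolding v by blast
    also have "\<dots> \<longleftrightarrow> (\<forall>C\<in>?K. finitely_presented R (Hom D C X))"
      using Hom_from_all[OF X] GK by blast
    finally show ?thesis .
  qed
  ultimately show ?thesis unfolding lcoh_objects_def
    by (intro conjI allI impI Collect_cong conj_cong refl)
qed

end
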